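(* Let $E$ be a graph and let $E_{R+}$ be its unital reduction at $w$, where $w\in\mathrm{reg}(E)$ does not emit any edge that is a loop. Let $f_*\colon C^*(E_{R+})\to C^*(E)$ be the $*$-isomorphism given by $f_*(S_p)=S_p$ for $p\in E_{R+}^0\sqcup(E^1\setminus t_E^{-1}(w))$ and $f_*(S_{xy})=S_xS_y$ for the edges $xy$ of $E_{R+}$ with $t_E(x)=w=s_E(y)$. Then the inverse $*$-isomorphism $(f_* )^{-1}$, which is given by $(f_* )^{-1}(S_p)=S_p$ for $p\in E^0\sqcup(E^1\setminus t_E^{-1}(w))$ and $(f_* )^{-1}(S_p)=\sum_{y\in s_E^{-1}(w)}S_{py}S_y^*$ for $p\in t_E^{-1}(w)$, can be realized as a composition $$(f_* )^{-1}=g^*\circ\varphi_*,$$ where $g$ is an admissible graph homomorphism and $\varphi$ is a regular extended path homomorphism.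
   Context: A graph $E=(E^0,E^1,s_E,t_E)$ consists of arbitrary sets of vertices and edges with source and target maps. A vertex $v$ is regular if $s_E^{-1}(v)$ is finite and nonempty; $\mathrm{reg}(E)$ is the set of regular vertices. A loop is an edge with equal source and target. $\mathrm{FP}(E)$ is the set of finite paths (vertices, of length $0$, and sequences $e_1\ldots e_n$ of edges with $t_E(e_i)=s_E(e_{i+1})$); vertices act as units for concatenation. Unital reduction at $w$: $E_{R+}^0=E^0$, $E_{R+}^1=(E^1\setminus t_E^{-1}(w))\sqcup\{xy\mid x,y\in E^1,\ t_E(x)=w=s_E(y)\}$, where old edges keep their sources and targets and the (single) edge $xy$ has source $s_E(x)$ and target $t_E(y)$. A graph homomorphism $g\colon H\to F$ (maps on vertices and edges commuting with sources and targets) is admissible if (1) $g^{-1}(v)$, $g^{-1}(e)$ are finite for all $v\in F^0$, $e\in F^1$; (2) for every $x\in F^1$ the map $t_H\colon g^{-1}(x)\to g^{-1}(t_F(x))$ is bijective; (3) $g^{-1}(\mathrm{reg}(F))\subseteq\mathrm{reg}(H)$. It contravariantly induces a $*$-homomorphism $g^*\colon C^*(F)\to C^*(H)$, $S_v\mapsto\sum_{u\in g^{-1}(v)}S_u$, $S_e\mapsto\sum_{x\in g^{-1}(e)}S_x$. $C^*(E)$ is the universal C*-algebra generated by mutually orthogonal projections $S_v$ ($v\in E^0$) and elements $S_e$ ($e\in E^1$) with $S_e^*S_{e'}=\delta_{e,e'}S_{t_E(e)}$, $S_{s_E(e)}S_e=S_e$, and $S_v=\sum_{e\in s_E^{-1}(v)}S_eS_e^*$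 for $v\in\mathrm{reg}(E)$. For paths, $S_{e_1\ldots e_n}=S_{e_1}\cdots S_{e_n}$; put $S_{(\alpha,\beta)}=S_\alpha S_\beta^*$, $S_0=0$. That $f_*$ in the claim is a $*$-isomorphism with the stated inverse is quoted from the literature. The graph inverse semigroup is $S(E)=\{(\alpha,\beta)\in \mathrm{FP}(E)^2\mid t_E(\alpha)=t_E(\beta)\}\cup\{0\}$ with $(\alpha,\beta)(\gamma,\delta)=(\alpha\gamma',\delta)$ if $\gamma=\beta\gamma'$, $=(\alpha,\delta\beta')$ if $\beta=\gamma\beta'$, and $=0$ otherwise; $0$ is a zero element; $(\alpha,\beta)^*=(\beta,\alpha)$; $s\le t\iff ss^*t=s$. An extended path homomorphism from $E$ to $F$ is a semigroup homomorphism $\varphi\colon S(E)\to S(F)$ with $\varphi(0)=0$; it is regular if whenever $u\in\mathrm{reg}(E)$, $0\ne t\in S(F)$ and $t\le\varphi(u,u)$, there exists $e\in s_E^{-1}(u)$ with $t\varphi(e,e)\neq0$. A regular $\varphi$ covariantly induces the $*$-homomorphism $\varphi_*\colon C^*(E)\to C^*(F)$, $S_v\mapsto S_{\varphi(v,v)}$, $S_e\mapsto S_{\varphi(e,t_E(e))}$.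
   Formalization: The composition is proved in the order φ_*∘g^*, with g: H→E and φ: S(H)→S(E_{R+}) for some graph H; the displayed order g^*∘φ_* fails, e.g. for E with just the edges p: v→w, y1: w→u1, y2: w→u2 between distinct vertices. *)

theory Defs
  imports
    Complex_Main
    "HOL-Library.Poly_Mapping"
    "HOL-Library.Sublist"
    "HOL-Library.FuncSet"
    "Graph_Theory.Arc_Walk"
begin

section \<open>Graphs\<close>

text \<open>
  A graph is a well-formed \<^typ>\<open>('v, 'e) pre_digraph\<close>: the vertex and the edge sets are arbitrary,
  and multiple edges and loops are allowed.  The sets of edges with source \<open>v\<close> and of edges with
  target \<open>v\<close> are \<^term>\<open>out_arcs E v\<close> and \<^term>\<open>in_arcs E v\<close>.
\<close>

definition reg :: "('v, 'e) pre_digraph \<Rightarrow> 'v set" where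
  "reg E = {v \<in> verts E. finite (out_arcs E v) \<and> out_arcs E v \<noteq> {}}"

text \<open>The edge \<open>xy\<close> of the unital reduction is \<open>Inr (x, y)\<close>; an edge \<open>e\<close> that is kept is \<open>Inl e\<close>.\<close>

definition unital_reduction :: "('v, 'e) pre_digraph \<Rightarrow> 'v \<Rightarrow> ('v, 'e + 'e \<times> 'e) pre_digraph" where
  "unital_reduction E w =
    \<lparr> verts = verts E,
      arcs = Inl ` (arcs E - in_arcs E w) \<union> Inr ` (in_arcs E w \<times> out_arcs E w),
      tail = case_sum (tail E) (\<lambda>(x, y). tail E x),
      head = case_sum (head E) (\<lambda>(x, y). head E y) \<rparr>"

text \<open>A graph homomorphism is a pair of maps, on vertices and on edges.\<close>

type_synonym ('v, 'e, 'v1, 'e1) graph_map = "('v \<Rightarrow> 'v1) \<times> ('e \<Rightarrow> 'e1)"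

definition graph_hom ::
  "('v, 'e) pre_digraph \<Rightarrow> ('v1, 'e1) pre_digraph \<Rightarrow> ('v, 'e, 'v1, 'e1) graph_map \<Rightarrow> bool" where
  "graph_hom H F g \<longleftrightarrow>
    (\<forall>u\<in>verts H. fst g u \<in> verts F) \<and>
    (\<forall>x\<in>arcs H. snd g x \<in> arcs F \<and>
       tail F (snd g x) = fst g (tail H x) \<and> head F (snd g x) = fst g (head H x))"

definition vfiber ::
  "('v, 'e) pre_digraph \<Rightarrow> ('v, 'e, 'v1, 'e1) graph_map \<Rightarrow> 'v1 \<Rightarrow> 'v set" where
  "vfiber H g v = {u \<in> verts H. fst g u = v}"

definition efiber ::
  "('v, 'e) pre_digraph \<Rightarrow> ('v, 'e, 'v1, 'e1) graph_map \<Rightarrow> 'e1 \<Rightarrow> 'e set" where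
  "efiber H g e = {x \<in> arcs H. snd g x = e}"

definition admissible ::
  "('v, 'e) pre_digraph \<Rightarrow> ('v1, 'e1) pre_digraph \<Rightarrow> ('v, 'e, 'v1, 'e1) graph_map \<Rightarrow> bool" where
  "admissible H F g \<longleftrightarrow>
    graph_hom H F g \<and>
    (\<forall>v\<in>verts F. finite (vfiber H g v)) \<and>
    (\<forall>e\<in>arcs F. finite (efiber H g e)) \<and>
    (\<forall>x\<in>arcs F. bij_betw (head H) (efiber H g x) (vfiber H g (head F x))) \<and>
    {u \<in> verts H. fst g u \<in> reg F} \<subseteq> reg H"


section \<open>The graph inverse semigroup and extended path homomorphisms\<close>

text \<open>
  A finite path is stored together with its source vertex: the vertex \<open>v\<close> is \<open>(v, [])\<close> and
  \<open>e\<^sub>1\<dots>e\<^sub>n\<close> is \<open>(u, [e\<^sub>1,\<dots>,e\<^sub>n])\<close> with \<open>u\<close> the source of \<open>e\<^sub>1\<close>.  Concatenation with a path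
  that starts at the target is therefore concatenation of the lists.
\<close>

type_synonym ('v, 'e) path = "'v \<times> 'e list"

definition fpaths :: "('v, 'e) pre_digraph \<Rightarrow> ('v, 'e) path set" where
  "fpaths E = {(u, p). \<exists>v. pre_digraph.awalk E u p v}"

definition path_target :: "('v, 'e) pre_digraph \<Rightarrow> ('v, 'e) path \<Rightarrow> 'v" where
  "path_target E \<alpha> = pre_digraph.awlast E (fst \<alpha>) (snd \<alpha>)"

definition vpath :: "'v \<Rightarrow> ('v, 'e) path" where
  "vpath v = (v, [])"

definition epath :: "('v, 'e) pre_digraph \<Rightarrow> 'e \<Rightarrow> ('v, 'e) path" where
  "epath E e = (tail E e, [e])"

text \<open>\<^const>\<open>None\<close> is the zero element of the semigroup.\<close>

type_synonym ('v, 'e) gis = "(('v, 'e) path \<times> ('v, 'e) path) option"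

definition gis_carrier :: "('v, 'e) pre_digraph \<Rightarrow> ('v, 'e) gis set" where
  "gis_carrier E = insert None
    (Some ` {(\<alpha>, \<beta>). \<alpha> \<in> fpaths E \<and> \<beta> \<in> fpaths E \<and> path_target E \<alpha> = path_target E \<beta>})"

text \<open>The first case is \<open>\<gamma> = \<beta>\<gamma>'\<close> with \<open>\<beta> = (b, q)\<close> and \<open>\<gamma> = (c, r)\<close>, the second \<open>\<beta> = \<gamma>\<beta>'\<close>.\<close>

fun gis_mult :: "('v, 'e) gis \<Rightarrow> ('v, 'e) gis \<Rightarrow> ('v, 'e) gis" where
  "gis_mult (Some ((a, p), (b, q))) (Some ((c, r), (d, s))) =
    (if b = c \<and> prefix q r then Some ((a, p @ drop (length q) r), (d, s))
     else if b = c \<and> prefix r q then Some ((a, p), (d, s @ drop (length r) q))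
     else None)"
| "gis_mult None t = None"
| "gis_mult s None = None"

fun gis_star :: "('v, 'e) gis \<Rightarrow> ('v, 'e) gis" where
  "gis_star (Some (\<alpha>, \<beta>)) = Some (\<beta>, \<alpha>)"
| "gis_star None = None"

definition gis_le :: "('v, 'e) gis \<Rightarrow> ('v, 'e) gis \<Rightarrow> bool" where
  "gis_le s t \<longleftrightarrow> gis_mult (gis_mult s (gis_star s)) t = s"

definition extended_path_hom ::
  "('v, 'e) pre_digraph \<Rightarrow> ('v1, 'e1) pre_digraph \<Rightarrow> (('v, 'e) gis \<Rightarrow> ('v1, 'e1) gis) \<Rightarrow> bool" where
  "extended_path_hom E F \<phi> \<longleftrightarrow>
    (\<forall>s\<in>gis_carrier E. \<phi> s \<in> gis_carrier F) \<and>
    (\<forall>s\<in>gis_carrier E. \<forall>t\<in>gis_carrier E. \<phi> (gis_mult s t) = gis_mult (\<phi> s) (\<phi> t)) \<and>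
    \<phi> None = None"

definition regular_hom ::
  "('v, 'e) pre_digraph \<Rightarrow> ('v1, 'e1) pre_digraph \<Rightarrow> (('v, 'e) gis \<Rightarrow> ('v1, 'e1) gis) \<Rightarrow> bool" where
  "regular_hom E F \<phi> \<longleftrightarrow>
    (\<forall>u\<in>reg E. \<forall>t\<in>gis_carrier F.
       t \<noteq> None \<longrightarrow> gis_le t (\<phi> (Some (vpath u, vpath u))) \<longrightarrow>
       (\<exists>e\<in>out_arcs E u. gis_mult t (\<phi> (Some (epath E e, epath E e))) \<noteq> None))"


section \<open>Free *-algebras\<close>

text \<open>
  Noncommutative *-polynomials in the generators \<open>'g\<close>: finitely supported functions on words in the
  letters \<open>(x, False)\<close>, standing for \<open>x\<close>, and \<open>(x, True)\<close>, standing for \<open>x\<^sup>*\<close>.  Words form a monoid,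
  written additively as \<^typ>\<open>'a \<Rightarrow>\<^sub>0 'b\<close> requires, so the multiplication of \<^typ>\<open>'a \<Rightarrow>\<^sub>0 'b\<close> is
  the concatenation product.
\<close>

datatype 'g word = Word (letters: "('g \<times> bool) list")

instantiation word :: (type) monoid_add
begin

definition zero_word :: "'g word" where
  "zero_word = Word []"

definition plus_word :: "'g word \<Rightarrow> 'g word \<Rightarrow> 'g word" where
  "plus_word u v = Word (letters u @ letters v)"

instance
  by standard (simp_all add: zero_word_def plus_word_def)

end

type_synonym 'g star_poly = "'g word \<Rightarrow>\<^sub>0 complex"

definition gen :: "'g \<Rightarrow> 'g star_poly" where
  "gen x = Poly_Mapping.single (Word [(x, False)]) 1"

definition poly_scale :: "complex \<Rightarrow> 'g star_poly \<Rightarrow> 'g star_poly" where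
  "poly_scale c a = Poly_Mapping.map ((*) c) a"

definition word_star :: "'g word \<Rightarrow> 'g word" where
  "word_star u = Word (rev (map (apsnd Not) (letters u)))"

definition poly_star :: "'g star_poly \<Rightarrow> 'g star_poly" where
  "poly_star a =
    (\<Sum>u\<in>Poly_Mapping.keys a. Poly_Mapping.single (word_star u) (cnj (Poly_Mapping.lookup a u)))"

text \<open>
  The free *-algebra on \<open>X\<close> has no unit: the empty word is excluded.  Otherwise the construction
  below would yield the unitization of a universal C*-algebra.
\<close>

definition free_star_algebra :: "'g set \<Rightarrow> 'g star_poly set" where
  "free_star_algebra X =
    {a. \<forall>u\<in>Poly_Mapping.keys a. letters u \<noteq> [] \<and> fst ` set (letters u) \<subseteq> X}"


section \<open>Universal C*-algebras\<close>

definition cstar_seminorm :: "'g set \<Rightarrow> ('g star_poly \<Rightarrow> real) \<Rightarrow> bool" where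
  "cstar_seminorm X p \<longleftrightarrow>
    (\<forall>a\<in>free_star_algebra X. 0 \<le> p a) \<and>
    (\<forall>a\<in>free_star_algebra X. \<forall>c. p (poly_scale c a) = cmod c * p a) \<and>
    (\<forall>a\<in>free_star_algebra X. \<forall>b\<in>free_star_algebra X. p (a + b) \<le> p a + p b) \<and>
    (\<forall>a\<in>free_star_algebra X. \<forall>b\<in>free_star_algebra X. p (a * b) \<le> p a * p b) \<and>
    (\<forall>a\<in>free_star_algebra X. p (poly_star a * a) = (p a)\<^sup>2)"

text \<open>
  The C*-algebra with generators \<open>X\<close> and relations \<open>r = 0\<close> for \<open>r \<in> R\<close> is universal among all
  C*-algebras with a family of elements that is indexed by \<open>X\<close> and satisfies the relations: it is the
  Hausdorff completion of the free *-algebra in the largest C*-seminorm that vanishes on \<open>R\<close>.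
  (The C*-seminorms vanishing on \<open>R\<close> are exactly the seminorms \<open>a \<mapsto> \<parallel>\<pi>(a)\<parallel>\<close> for \<open>\<pi>\<close> a
  *-homomorphism into a C*-algebra with \<open>\<pi>(r) = 0\<close> for \<open>r \<in> R\<close>.)  The supremum below is that of a
  bounded set whenever the relations bound the norm of every generator, as they do for graphs.
\<close>

definition universal_seminorm :: "'g set \<Rightarrow> 'g star_poly set \<Rightarrow> 'g star_poly \<Rightarrow> real" where
  "universal_seminorm X R a = (SUP p \<in> {p. cstar_seminorm X p \<and> (\<forall>r\<in>R. p r = 0)}. p a)"

definition cauchy_seqs :: "'g set \<Rightarrow> 'g star_poly set \<Rightarrow> (nat \<Rightarrow> 'g star_poly) set" where
  "cauchy_seqs X R =
    {x. range x \<subseteq> free_star_algebra X \<and>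
        (\<forall>\<epsilon>>0. \<exists>N. \<forall>m\<ge>N. \<forall>n\<ge>N. universal_seminorm X R (x m - x n) < \<epsilon>)}"

definition seq_equiv ::
  "'g set \<Rightarrow> 'g star_poly set \<Rightarrow> ((nat \<Rightarrow> 'g star_poly) \<times> (nat \<Rightarrow> 'g star_poly)) set" where
  "seq_equiv X R =
    {(x, y). x \<in> cauchy_seqs X R \<and> y \<in> cauchy_seqs X R \<and>
             (\<lambda>n. universal_seminorm X R (x n - y n)) \<longlonglongrightarrow> 0}"

record 'a cstar_algebra =
  carrier :: "'a set"
  add :: "'a \<Rightarrow> 'a \<Rightarrow> 'a"
  scale :: "complex \<Rightarrow> 'a \<Rightarrow> 'a"
  mult :: "'a \<Rightarrow> 'a \<Rightarrow> 'a"
  star :: "'a \<Rightarrow> 'a"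
  cnorm :: "'a \<Rightarrow> real"

text \<open>
  As usual for quotients, the operations on classes are unions over all representatives (each union
  is a union of equal classes).
\<close>

definition universal_cstar ::
  "'g set \<Rightarrow> 'g star_poly set \<Rightarrow> (nat \<Rightarrow> 'g star_poly) set cstar_algebra" where
  "universal_cstar X R =
    \<lparr> carrier = cauchy_seqs X R // seq_equiv X R,
      add = (\<lambda>A B. \<Union>x\<in>A. \<Union>y\<in>B. seq_equiv X R `` {\<lambda>n. x n + y n}),
      scale = (\<lambda>c A. \<Union>x\<in>A. seq_equiv X R `` {\<lambda>n. poly_scale c (x n)}),
      mult = (\<lambda>A B. \<Union>x\<in>A. \<Union>y\<in>B. seq_equiv X R `` {\<lambda>n. x n * y n}),
      star = (\<lambda>A. \<Union>x\<in>A. seq_equiv X R `` {\<lambda>n. poly_star (x n)}),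
      cnorm = (\<lambda>A. THE r. \<exists>x\<in>A. (\<lambda>n. universal_seminorm X R (x n)) \<longlonglongrightarrow> r) \<rparr>"

definition star_hom :: "'a cstar_algebra \<Rightarrow> 'b cstar_algebra \<Rightarrow> ('a \<Rightarrow> 'b) \<Rightarrow> bool" where
  "star_hom A B h \<longleftrightarrow>
    (\<forall>a\<in>carrier A. h a \<in> carrier B) \<and>
    (\<forall>a\<in>carrier A. \<forall>b\<in>carrier A. h (add A a b) = add B (h a) (h b)) \<and>
    (\<forall>a\<in>carrier A. \<forall>c. h (scale A c a) = scale B c (h a)) \<and>
    (\<forall>a\<in>carrier A. \<forall>b\<in>carrier A. h (mult A a b) = mult B (h a) (h b)) \<and>
    (\<forall>a\<in>carrier A. h (star A a) = star B (h a))"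

definition star_iso :: "'a cstar_algebra \<Rightarrow> 'b cstar_algebra \<Rightarrow> ('a \<Rightarrow> 'b) \<Rightarrow> bool" where
  "star_iso A B h \<longleftrightarrow> star_hom A B h \<and> bij_betw h (carrier A) (carrier B)"


section \<open>Graph C*-algebras\<close>

text \<open>\<open>Inl v\<close> is the generator of a vertex \<open>v\<close> and \<open>Inr e\<close> that of an edge \<open>e\<close>.\<close>

abbreviation V :: "'v \<Rightarrow> ('v + 'e) star_poly" where
  "V v \<equiv> gen (Inl v)"

abbreviation D :: "'e \<Rightarrow> ('v + 'e) star_poly" where
  "D e \<equiv> gen (Inr e)"

definition graph_gens :: "('v, 'e) pre_digraph \<Rightarrow> ('v + 'e) set" where
  "graph_gens E = Inl ` verts E \<union> Inr ` arcs E"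

definition graph_rels :: "('v, 'e) pre_digraph \<Rightarrow> ('v + 'e) star_poly set" where
  "graph_rels E =
    {V u * V v - (if u = v then V v else 0) | u v. u \<in> verts E \<and> v \<in> verts E} \<union>
    {poly_star (V v) - V v | v. v \<in> verts E} \<union>
    {poly_star (D e) * D e' - (if e = e' then V (head E e) else 0) | e e'.
       e \<in> arcs E \<and> e' \<in> arcs E} \<union>
    {V (tail E e) * D e - D e | e. e \<in> arcs E} \<union>
    {V v - (\<Sum>e\<in>out_arcs E v. D e * poly_star (D e)) | v. v \<in> reg E}"

type_synonym ('v, 'e) gcstar_elem = "(nat \<Rightarrow> ('v + 'e) star_poly) set"

definition graph_cstar :: "('v, 'e) pre_digraph \<Rightarrow> ('v, 'e) gcstar_elem cstar_algebra" where
  "graph_cstar E = universal_cstar (graph_gens E) (graph_rels E)"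

text \<open>
  The element of \<open>C\<^sup>*(E)\<close> given by a *-polynomial in the generators; \<open>S\<^sub>v\<close> and \<open>S\<^sub>e\<close> are
  \<open>poly_class E (V v)\<close> and \<open>poly_class E (D e)\<close>.
\<close>

definition poly_class :: "('v, 'e) pre_digraph \<Rightarrow> ('v + 'e) star_poly \<Rightarrow> ('v, 'e) gcstar_elem" where
  "poly_class E a = seq_equiv (graph_gens E) (graph_rels E) `` {\<lambda>n. a}"

text \<open>
  The *-homomorphism that the universal property of \<open>C\<^sup>*(E)\<close> provides for given images of the
  generators.  Every *-homomorphism between C*-algebras is bounded; the boundedness clause states
  this explicitly, which makes uniqueness immediate from the density of the *-polynomials.
\<close>

definition universal_hom ::
  "('v, 'e) pre_digraph \<Rightarrow> 'b cstar_algebra \<Rightarrow> ('v \<Rightarrow> 'b) \<Rightarrow> ('e \<Rightarrow> 'b) \<Rightarrow> ('v, 'e) gcstar_elem \<Rightarrow> 'b"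
  where
  "universal_hom E B \<rho> \<sigma> =
    (THE h. h \<in> extensional (carrier (graph_cstar E)) \<and>
       star_hom (graph_cstar E) B h \<and>
       (\<exists>K. \<forall>a\<in>carrier (graph_cstar E). cnorm B (h a) \<le> K * cnorm (graph_cstar E) a) \<and>
       (\<forall>v\<in>verts E. h (poly_class E (V v)) = \<rho> v) \<and>
       (\<forall>e\<in>arcs E. h (poly_class E (D e)) = \<sigma> e))"

definition graph_hom_pullback ::
  "('v, 'e) pre_digraph \<Rightarrow> ('v1, 'e1) pre_digraph \<Rightarrow> ('v, 'e, 'v1, 'e1) graph_map \<Rightarrow>
   ('v1, 'e1) gcstar_elem \<Rightarrow> ('v, 'e) gcstar_elem" where
  "graph_hom_pullback H F g =
    universal_hom F (graph_cstar H)
      (\<lambda>v. poly_class H (\<Sum>u\<in>vfiber H g v. V u))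
      (\<lambda>e. poly_class H (\<Sum>x\<in>efiber H g e. D x))"

fun path_poly :: "('v, 'e) path \<Rightarrow> ('v + 'e) star_poly" where
  "path_poly (u, []) = V u"
| "path_poly (u, e # es) = prod_list (map D (e # es))"

fun gis_poly :: "('v, 'e) gis \<Rightarrow> ('v + 'e) star_poly" where
  "gis_poly (Some (\<alpha>, \<beta>)) = path_poly \<alpha> * poly_star (path_poly \<beta>)"
| "gis_poly None = 0"

definition path_hom_pushforward ::
  "('v, 'e) pre_digraph \<Rightarrow> ('v1, 'e1) pre_digraph \<Rightarrow> (('v, 'e) gis \<Rightarrow> ('v1, 'e1) gis) \<Rightarrow>
   ('v, 'e) gcstar_elem \<Rightarrow> ('v1, 'e1) gcstar_elem" where
  "path_hom_pushforward E F \<phi> =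
    universal_hom E (graph_cstar F)
      (\<lambda>v. poly_class F (gis_poly (\<phi> (Some (vpath v, vpath v)))))
      (\<lambda>e. poly_class F (gis_poly (\<phi> (Some (epath E e, vpath (head E e))))))"

definition unital_reduction_hom ::
  "('v, 'e) pre_digraph \<Rightarrow> 'v \<Rightarrow> ('v, 'e + 'e \<times> 'e) gcstar_elem \<Rightarrow> ('v, 'e) gcstar_elem" where
  "unital_reduction_hom E w =
    universal_hom (unital_reduction E w) (graph_cstar E)
      (\<lambda>v. poly_class E (V v))
      (case_sum (\<lambda>e. poly_class E (D e)) (\<lambda>(x, y). poly_class E (D x * D y)))"

definition unital_reduction_inv ::
  "('v, 'e) pre_digraph \<Rightarrow> 'v \<Rightarrow> ('v, 'e) gcstar_elem \<Rightarrow> ('v, 'e + 'e \<times> 'e) gcstar_elem" where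
  "unital_reduction_inv E w =
    inv_into (carrier (graph_cstar (unital_reduction E w))) (unital_reduction_hom E w)"

text \<open>
  Pitfall: the inverse factors as \<open>C\<^sup>*(E) \<rightarrow> C\<^sup>*(H) \<rightarrow> C\<^sup>*(E\<^sub>R\<^sub>+)\<close>, a pullback along some
  \<open>g : H \<rightarrow> E\<close> followed by a pushforward along some \<open>\<phi> : S(H) \<rightarrow> S(E\<^sub>R\<^sub>+)\<close>.  In the opposite order, a
  pushforward along \<open>\<phi> : S(E) \<rightarrow> S(F)\<close> followed by a pullback along \<open>g : E\<^sub>R\<^sub>+ \<rightarrow> F\<close>, there is no
  factorization in general.  For example, let \<open>E\<close> have just the edges \<open>p : v \<rightarrow> w\<close>, \<open>y\<^sub>1 : w \<rightarrow> u\<^sub>1\<close>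
  and \<open>y\<^sub>2 : w \<rightarrow> u\<^sub>2\<close>, with distinct vertices.  The pullback of \<open>S\<^sub>\<alpha>S\<^sub>\<beta>\<^sup>*\<close> is the sum of the
  \<open>S\<^sub>\<alpha>\<^sub>'S\<^sub>\<beta>\<^sub>'\<^sup>*\<close> over the lifts of \<open>\<alpha>\<close> and \<open>\<beta>\<close> with a common target \<open>u\<close>, one for each \<open>u\<close> in a single
  fiber of \<open>g\<close>.  Since \<open>u\<^sub>i\<close> is a sink, \<open>S\<close> of \<open>u\<^sub>i\<close> is such a sum only if \<open>{u\<^sub>i}\<close> is a fiber.  But
  \<open>S\<^sub>p\<close> must go to a sum with one lift that ends at \<open>u\<^sub>1\<close> and one that ends at \<open>u\<^sub>2\<close>.
\<close>

end

theory Submission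
  imports Defs
begin

text \<open>
  A substitution of *-polynomials for the generators induces a *-homomorphism of universal
  C*-algebras as soon as it sends the relations to elements of seminorm \<open>0\<close>, so everything reduces to
  identities between *-polynomials.  Split \<open>w\<close> completely: in the graph \<open>H\<close> the vertex \<open>w\<close> is replaced
  by one vertex \<open>w\<^sub>y\<close> for each edge \<open>y\<close> that \<open>w\<close> emits, \<open>w\<^sub>y\<close> emits only \<open>y\<close>, and an edge \<open>p\<close> into \<open>w\<close> is
  replaced by edges \<open>p\<^sub>y\<close> into the \<open>w\<^sub>y\<close>.  Let \<open>g : H \<rightarrow> E\<close> collapse the \<open>w\<^sub>y\<close> to \<open>w\<close>, and let \<open>\<phi>\<close> map
  \<open>w\<^sub>y\<close> to \<open>(y, y)\<close>, the edge \<open>y\<close> to \<open>(y, t(y))\<close>, the edge \<open>p\<^sub>y\<close> to \<open>(py, y)\<close>, and be the identity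
  elsewhere.  Then the composition sends \<open>S\<^sub>p\<close> first to the sum of the \<open>S\<close> of the \<open>p\<^sub>y\<close>, and then to the
  sum of the \<open>S\<^sub>p\<^sub>y S\<^sub>y\<^sup>*\<close>.
\<close>


text \<open>An extended path homomorphism sends a generator to zero or to a single
  \<open>S_\<alpha> S_\<beta>^*\<close>, whereas the inverse sends \<open>S_p\<close> to a sum. The
  sum therefore comes from the fibers of \<open>g\<close>, one copy of \<open>w\<close> per summand.
  The summand \<open>S_{py} S_y^*\<close> has source projection \<open>S_y S_y^*\<close>, which is
  why the copy \<open>w_y\<close> goes to \<open>(y, y)\<close>; by the Cuntz-Krieger relation at
  \<open>w\<close> the images of the copies add up to \<open>S_w\<close> again. Absence of loops at
  \<open>w\<close> enters twice: each \<open>y\<close> survives as an edge of the reduction, and an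
  edge into \<open>w\<close> starts at a vertex that is not split.

  The formula for the inverse is never checked against the relations of \<open>C*(E)\<close>. It
  agrees with the composition on generators up to seminorm \<open>0\<close> and so inherits them.
  Bijectivity of the reduction homomorphism then follows by comparing both composites with the
  identity on generators. Calculations take place among *-polynomials modulo the universal seminorm.
  For this seminorm to be a finite supremum, every C*-seminorm that kills the relations must be
  bounded on the generators, here by \<open>1\<close>.\<close>

section \<open>Finitely supported functions as sums of monomials\<close>

text \<open>Only monomials that occur in \<open>a\<close> are considered; this keeps the letters
  inside \<open>X\<close> when the induction is carried over to
  \<open>free_star_algebra X\<close>.\<close>

lemma poly_mapping_single_induct [case_names zero single add]:
  fixes a :: "'a \<Rightarrow>\<^sub>0 'b::comm_monoid_add"
  assumes zero: "P 0" and single: "\<And>u c. u \<in> Poly_Mapping.keys a \<Longrightarrow> P (Poly_Mapping.single u c)"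
    and add: "\<And>a b. P a \<Longrightarrow> P b \<Longrightarrow> P (a + b)"
  shows "P a"
proof -
  have "P (\<Sum>u\<in>S. Poly_Mapping.single u (Poly_Mapping.lookup a u))"
    if "finite S" "S \<subseteq> Poly_Mapping.keys a" for S
    using that by (induction S rule: finite_induct) (auto intro!: zero single add)
  moreover have "(\<Sum>u\<in>Poly_Mapping.keys a. Poly_Mapping.single u (Poly_Mapping.lookup a u)) = a"
    by (rule poly_mapping_eqI)
      (auto simp: lookup_sum lookup_single when_def sum.delta in_keys_iff)
  ultimately show ?thesis by (metis finite_keys order_refl)
qed

lemma finite_sum_keys:
  assumes "finite S" "Poly_Mapping.keys a \<subseteq> S" "\<And>u. f u 0 = 0"
  shows "(\<Sum>u\<in>Poly_Mapping.keys a. f u (Poly_Mapping.lookup a u)) = (\<Sum>u\<in>S. f u (Poly_Mapping.lookup a u))"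
  using assms by (intro sum.mono_neutral_left) (auto simp: in_keys_iff)

text \<open>Keys may cancel in \<open>a + b\<close>, so all three sums are compared over the union
  of the key sets, where the additional terms vanish by \<open>f u 0 = 0\<close>. This is the
  additivity of any linear extension from words, such as \<open>poly_star\<close> and
  \<open>star_subst\<close>.\<close>

lemma sum_keys_add:
  fixes f :: "'a \<Rightarrow> 'b::comm_monoid_add \<Rightarrow> 'c::comm_monoid_add"
  assumes "\<And>u. f u 0 = 0" "\<And>u c d. f u (c + d) = f u c + f u d"
  shows "(\<Sum>u\<in>Poly_Mapping.keys (a + b). f u (Poly_Mapping.lookup (a + b) u)) =
    (\<Sum>u\<in>Poly_Mapping.keys a. f u (Poly_Mapping.lookup a u)) +
    (\<Sum>u\<in>Poly_Mapping.keys b. f u (Poly_Mapping.lookup b u))"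
proof -
  let ?S = "Poly_Mapping.keys a \<union> Poly_Mapping.keys b"
  have "finite ?S" "Poly_Mapping.keys (a + b) \<subseteq> ?S" by (auto simp: keys_add)
  then have "(\<Sum>u\<in>Poly_Mapping.keys (a + b). f u (Poly_Mapping.lookup (a + b) u)) =
      (\<Sum>u\<in>?S. f u (Poly_Mapping.lookup (a + b) u))"
    by (intro finite_sum_keys assms)
  also have "\<dots> = (\<Sum>u\<in>?S. f u (Poly_Mapping.lookup a u)) + (\<Sum>u\<in>?S. f u (Poly_Mapping.lookup b u))"
    by (simp add: lookup_add assms sum.distrib)
  also have "(\<Sum>u\<in>?S. f u (Poly_Mapping.lookup a u)) =
      (\<Sum>u\<in>Poly_Mapping.keys a. f u (Poly_Mapping.lookup a u))"
    by (intro finite_sum_keys[symmetric] assms) auto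
  also have "(\<Sum>u\<in>?S. f u (Poly_Mapping.lookup b u)) =
      (\<Sum>u\<in>Poly_Mapping.keys b. f u (Poly_Mapping.lookup b u))"
    by (intro finite_sum_keys[symmetric] assms) auto
  finally show ?thesis .
qed


section \<open>The free *-algebra\<close>

lemma letters_zero [simp]: "letters 0 = []"
  by (simp add: zero_word_def)

lemma letters_plus [simp]: "letters (u + v) = letters u @ letters v"
  by (simp add: plus_word_def)

lemma word_eq_iff: "u = v \<longleftrightarrow> letters u = letters v"
  by (metis word.expand)

lemma word_star_word_star [simp]: "word_star (word_star u) = u"
  by (simp add: word_star_def word_eq_iff rev_map comp_def apsnd_def map_prod_def case_prod_unfold)

lemma word_star_plus: "word_star (u + v) = word_star v + word_star u"
  by (simp add: word_star_def word_eq_iff)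

text \<open>Scalars become constant polynomials on the empty word. These lie outside the nonunital
  free *-algebra, but the ring laws of the ambient type then give all laws of scaling.\<close>

lemma poly_scale_conv_mult: "poly_scale c a = Poly_Mapping.single 0 c * a"
  by (simp add: poly_scale_def mult_map_scale_conv_mult)

lemma mult_single_zero_commute:
  fixes a :: "'g star_poly"
  shows "a * Poly_Mapping.single 0 c = Poly_Mapping.single 0 c * a"
  by (induction a rule: poly_mapping_single_induct)
    (simp_all add: mult_single mult.commute algebra_simps)

lemma poly_scale_add: "poly_scale c (a + b) = poly_scale c a + poly_scale c b"
  by (simp add: poly_scale_conv_mult distrib_left)

lemma poly_scale_add_left: "poly_scale (c + d) a = poly_scale c a + poly_scale d a"
  by (simp add: poly_scale_conv_mult distrib_right single_add)

lemma poly_scale_zero [simp]: "poly_scale c 0 = 0"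
  by (simp add: poly_scale_conv_mult)

lemma poly_scale_zero_left [simp]: "poly_scale 0 a = 0"
  by (simp add: poly_scale_conv_mult)

lemma poly_scale_one [simp]: "poly_scale 1 a = a"
  by (simp add: poly_scale_conv_mult)

lemma poly_scale_minus_one: "poly_scale (-1) a = - a"
  by (simp add: poly_scale_conv_mult single_uminus)

lemma poly_scale_diff: "poly_scale c (a - b) = poly_scale c a - poly_scale c b"
  by (simp add: poly_scale_conv_mult right_diff_distrib)

lemma poly_scale_mult_left: "poly_scale c a * b = poly_scale c (a * b)"
  by (simp add: poly_scale_conv_mult mult.assoc)

lemma poly_scale_mult_right: "a * poly_scale c b = poly_scale c (a * b)"
  by (metis poly_scale_conv_mult mult.assoc mult_single_zero_commute)

lemma poly_scale_scale: "poly_scale c (poly_scale d a) = poly_scale (c * d) a"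
  by (simp add: poly_scale_conv_mult mult_single flip: mult.assoc)

lemma poly_scale_single: "poly_scale c (Poly_Mapping.single u d) = Poly_Mapping.single u (c * d)"
  by (simp add: poly_scale_conv_mult mult_single)

lemma poly_star_single: "poly_star (Poly_Mapping.single u c) = Poly_Mapping.single (word_star u) (cnj c)"
  by (cases "c = 0") (simp_all add: poly_star_def)

lemma poly_star_zero [simp]: "poly_star 0 = 0"
  by (simp add: poly_star_def)

lemma poly_star_add: "poly_star (a + b) = poly_star a + poly_star b"
  unfolding poly_star_def
  by (rule sum_keys_add[where f = "\<lambda>u c. Poly_Mapping.single (word_star u) (cnj c)"])
    (simp_all add: single_add)

lemma poly_star_poly_star [simp]: "poly_star (poly_star a) = a"
  by (induction a rule: poly_mapping_single_induct) (simp_all add: poly_star_single poly_star_add)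

lemma poly_star_mult: "poly_star (a * b) = poly_star b * poly_star a"
proof (induction a rule: poly_mapping_single_induct)
  case (single u c)
  show ?case
    by (induction b rule: poly_mapping_single_induct)
      (simp_all add: poly_star_single poly_star_add mult_single word_star_plus mult.commute algebra_simps)
qed (simp_all add: poly_star_add algebra_simps)

lemma poly_star_one [simp]: "poly_star 1 = 1"
  by (simp add: poly_star_single word_star_def zero_word_def flip: single_one)

lemma poly_star_scale: "poly_star (poly_scale c a) = poly_scale (cnj c) (poly_star a)"
  by (induction a rule: poly_mapping_single_induct)
    (simp_all add: poly_star_single poly_scale_single poly_scale_add poly_star_add)

lemma poly_star_uminus: "poly_star (- a) = - poly_star a"
  by (simp add: poly_star_scale flip: poly_scale_minus_one)

lemma poly_star_diff: "poly_star (a - b) = poly_star a - poly_star b"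
  by (metis diff_conv_add_uminus poly_star_add poly_star_uminus)

lemma poly_star_sum: "poly_star (sum f S) = (\<Sum>i\<in>S. poly_star (f i))"
  by (induction S rule: infinite_finite_induct) (simp_all add: poly_star_add)

lemma gen_in_free: "x \<in> X \<Longrightarrow> gen x \<in> free_star_algebra X"
  by (simp add: gen_def free_star_algebra_def)

lemma zero_in_free [simp]: "0 \<in> free_star_algebra X"
  by (simp add: free_star_algebra_def)

lemma add_in_free [intro]:
  "a \<in> free_star_algebra X \<Longrightarrow> b \<in> free_star_algebra X \<Longrightarrow> a + b \<in> free_star_algebra X"
  using keys_add[of a b] unfolding free_star_algebra_def by blast

lemma single_in_free:
  "letters u \<noteq> [] \<Longrightarrow> fst ` set (letters u) \<subseteq> X \<Longrightarrow> Poly_Mapping.single u c \<in> free_star_algebra X"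
  by (auto simp: free_star_algebra_def)

lemma mult_in_free [intro]:
  assumes "a \<in> free_star_algebra X" "b \<in> free_star_algebra X"
  shows "a * b \<in> free_star_algebra X"
  unfolding free_star_algebra_def
proof (intro CollectI ballI)
  fix u assume "u \<in> Poly_Mapping.keys (a * b)"
  then obtain v v' where "u = v + v'" "v \<in> Poly_Mapping.keys a" "v' \<in> Poly_Mapping.keys b"
    using keys_mult[of a b] by blast
  then show "letters u \<noteq> [] \<and> fst ` set (letters u) \<subseteq> X"
    using assms by (auto simp: free_star_algebra_def)
qed

lemma free_star_algebra_induct [consumes 1, case_names zero single add]:
  assumes "a \<in> free_star_algebra X" and "P 0"
    and "\<And>u c. letters u \<noteq> [] \<Longrightarrow> fst ` set (letters u) \<subseteq> X \<Longrightarrow> P (Poly_Mapping.single u c)"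
    and "\<And>a b. a \<in> free_star_algebra X \<Longrightarrow> b \<in> free_star_algebra X \<Longrightarrow> P a \<Longrightarrow> P b \<Longrightarrow> P (a + b)"
  shows "P a"
proof -
  have "a \<in> free_star_algebra X \<and> P a"
  proof (induction a rule: poly_mapping_single_induct)
    case (single u c)
    then have "letters u \<noteq> []" "fst ` set (letters u) \<subseteq> X"
      using assms(1) by (auto simp: free_star_algebra_def)
    then show ?case by (auto intro: single_in_free assms(3))
  qed (use assms in auto)
  then show ?thesis ..
qed

lemma poly_star_in_free [intro]: "a \<in> free_star_algebra X \<Longrightarrow> poly_star a \<in> free_star_algebra X"
  by (induction a rule: free_star_algebra_induct)
    (fastforce simp: poly_star_single poly_star_add word_star_def intro!: single_in_free)+

lemma poly_scale_in_free [intro]: "a \<in> free_star_algebra X \<Longrightarrow> poly_scale c a \<in> free_star_algebra X"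
  by (induction a rule: free_star_algebra_induct)
    (auto simp: poly_scale_single poly_scale_add intro!: single_in_free)

lemma uminus_in_free [intro]: "a \<in> free_star_algebra X \<Longrightarrow> - a \<in> free_star_algebra X"
  by (metis poly_scale_in_free poly_scale_minus_one)

lemma diff_in_free [intro]:
  "a \<in> free_star_algebra X \<Longrightarrow> b \<in> free_star_algebra X \<Longrightarrow> a - b \<in> free_star_algebra X"
  by (metis add_in_free diff_conv_add_uminus uminus_in_free)

lemma sum_in_free [intro]:
  "(\<And>i. i \<in> S \<Longrightarrow> f i \<in> free_star_algebra X) \<Longrightarrow> sum f S \<in> free_star_algebra X"
  by (induction S rule: infinite_finite_induct) auto

text \<open>The empty product is the unit, which the nonunital free *-algebra does not
  contain.\<close>

lemma prod_list_in_free: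
  "xs \<noteq> [] \<Longrightarrow> set xs \<subseteq> free_star_algebra X \<Longrightarrow> prod_list xs \<in> free_star_algebra X"
proof (induction xs)
  case (Cons x xs)
  then show ?case by (cases xs) auto
qed simp


section \<open>Substitution of *-polynomials for generators\<close>

definition letter_eval :: "('g \<Rightarrow> 'h star_poly) \<Rightarrow> 'g \<times> bool \<Rightarrow> 'h star_poly" where
  "letter_eval \<rho> l = (if snd l then poly_star (\<rho> (fst l)) else \<rho> (fst l))"

definition word_eval :: "('g \<Rightarrow> 'h star_poly) \<Rightarrow> 'g word \<Rightarrow> 'h star_poly" where
  "word_eval \<rho> u = prod_list (map (letter_eval \<rho>) (letters u))"

text \<open>The *-homomorphism that extends \<open>\<rho>\<close> from generators to *-polynomials,
  that is, the universal property of the free *-algebra.\<close>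

definition star_subst :: "('g \<Rightarrow> 'h star_poly) \<Rightarrow> 'g star_poly \<Rightarrow> 'h star_poly" where
  "star_subst \<rho> a =
    (\<Sum>u\<in>Poly_Mapping.keys a. poly_scale (Poly_Mapping.lookup a u) (word_eval \<rho> u))"

lemma word_eval_plus: "word_eval \<rho> (u + v) = word_eval \<rho> u * word_eval \<rho> v"
  by (simp add: word_eval_def)

lemma word_eval_star: "word_eval \<rho> (word_star u) = poly_star (word_eval \<rho> u)"
proof -
  have "prod_list (map (letter_eval \<rho>) (rev (map (apsnd Not) ls))) =
      poly_star (prod_list (map (letter_eval \<rho>) ls))" for ls
    by (induction ls) (auto simp: poly_star_mult letter_eval_def)
  then show ?thesis by (simp add: word_eval_def word_star_def)
qed

lemma star_subst_single: "star_subst \<rho> (Poly_Mapping.single u c) = poly_scale c (word_eval \<rho> u)"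
  by (cases "c = 0") (simp_all add: star_subst_def)

lemma star_subst_zero [simp]: "star_subst \<rho> 0 = 0"
  by (simp add: star_subst_def)

lemma star_subst_add: "star_subst \<rho> (a + b) = star_subst \<rho> a + star_subst \<rho> b"
  unfolding star_subst_def
  by (rule sum_keys_add[where f = "\<lambda>u c. poly_scale c (word_eval \<rho> u)"])
    (simp_all add: poly_scale_add_left)

lemma star_subst_gen [simp]: "star_subst \<rho> (gen x) = \<rho> x"
  by (simp add: gen_def star_subst_single word_eval_def letter_eval_def)

lemma star_subst_scale: "star_subst \<rho> (poly_scale c a) = poly_scale c (star_subst \<rho> a)"
  by (induction a rule: poly_mapping_single_induct)
    (simp_all add: star_subst_single poly_scale_single poly_scale_add star_subst_add poly_scale_scale)

lemma star_subst_mult: "star_subst \<rho> (a * b) = star_subst \<rho> a * star_subst \<rho> b"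
proof (induction a rule: poly_mapping_single_induct)
  case (single u c)
  show ?case
    by (induction b rule: poly_mapping_single_induct)
      (simp_all add: star_subst_single star_subst_add mult_single word_eval_plus algebra_simps
        poly_scale_mult_left poly_scale_mult_right poly_scale_scale)
qed (simp_all add: star_subst_add algebra_simps)

lemma star_subst_star: "star_subst \<rho> (poly_star a) = poly_star (star_subst \<rho> a)"
  by (induction a rule: poly_mapping_single_induct)
    (simp_all add: star_subst_single poly_star_single poly_star_add star_subst_add poly_star_scale
      word_eval_star)

lemma star_subst_uminus: "star_subst \<rho> (- a) = - star_subst \<rho> a"
  by (simp add: star_subst_scale flip: poly_scale_minus_one)

lemma star_subst_diff: "star_subst \<rho> (a - b) = star_subst \<rho> a - star_subst \<rho> b"
  by (metis diff_conv_add_uminus star_subst_add star_subst_uminus)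

lemma star_subst_sum: "star_subst \<rho> (sum f S) = (\<Sum>i\<in>S. star_subst \<rho> (f i))"
  by (induction S rule: infinite_finite_induct) (simp_all add: star_subst_add)

lemma word_eval_in_free:
  assumes "letters u \<noteq> []" "\<rho> ` fst ` set (letters u) \<subseteq> free_star_algebra Y"
  shows "word_eval \<rho> u \<in> free_star_algebra Y"
  unfolding word_eval_def using assms by (intro prod_list_in_free) (auto simp: letter_eval_def)

lemma star_subst_in_free:
  assumes "a \<in> free_star_algebra X" "\<rho> ` X \<subseteq> free_star_algebra Y"
  shows "star_subst \<rho> a \<in> free_star_algebra Y"
  using assms
  by (induction a rule: free_star_algebra_induct)
    (auto simp: star_subst_single star_subst_add intro!: word_eval_in_free)

text \<open>Suited to properties that respect the algebra operations, such as having a bounded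
  seminorm. A word is built letter by letter starting from one letter, because the empty word is
  excluded.\<close>

lemma free_star_algebra_gen_induct [consumes 1, case_names zero gen star scale mult add]:
  assumes "a \<in> free_star_algebra X" and "P 0" and gen: "\<And>x. x \<in> X \<Longrightarrow> P (gen x)"
    and star: "\<And>x. x \<in> X \<Longrightarrow> P (poly_star (gen x))"
    and scale: "\<And>a c. a \<in> free_star_algebra X \<Longrightarrow> P a \<Longrightarrow> P (poly_scale c a)"
    and mult: "\<And>a b. a \<in> free_star_algebra X \<Longrightarrow> b \<in> free_star_algebra X \<Longrightarrow> P a \<Longrightarrow> P b \<Longrightarrow> P (a * b)"
    and add: "\<And>a b. a \<in> free_star_algebra X \<Longrightarrow> b \<in> free_star_algebra X \<Longrightarrow> P a \<Longrightarrow> P b \<Longrightarrow> P (a + b)"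
  shows "P a"
  using assms(1)
proof (induction a rule: free_star_algebra_induct)
  case (single u c)
  have letter: "P (Poly_Mapping.single (Word [l]) 1)" if "fst l \<in> X" for l
  proof (cases "snd l")
    case False
    then have "Word [l] = Word [(fst l, False)]" by (metis prod.collapse)
    then show ?thesis using gen[OF that] by (simp add: gen_def)
  next
    case True
    then have "Word [l] = Word [(fst l, True)]" by (metis prod.collapse)
    then show ?thesis using star[OF that] by (simp add: gen_def poly_star_single word_star_def)
  qed
  have "P (Poly_Mapping.single (Word ls) 1)" if "ls \<noteq> []" "fst ` set ls \<subseteq> X" for ls
    using that
  proof (induction ls rule: list_nonempty_induct)
    case (single l)
    then show ?case using letter by simp
  next
    case (cons l ls)
    have "Word (l # ls) = Word [l] + Word ls" by (simp add: plus_word_def)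
    then have "Poly_Mapping.single (Word (l # ls)) 1 =
        Poly_Mapping.single (Word [l]) 1 * Poly_Mapping.single (Word ls) (1::complex)"
      by (simp add: mult_single)
    moreover have "Poly_Mapping.single (Word [l]) 1 \<in> free_star_algebra X"
      "Poly_Mapping.single (Word ls) 1 \<in> free_star_algebra X"
      using cons.hyps cons.prems by (simp_all add: single_in_free)
    ultimately show ?case using cons letter by (simp add: mult)
  qed
  from this[of "letters u"] have "P (Poly_Mapping.single u 1)" using single by simp
  then show ?case
    using scale[of "Poly_Mapping.single u 1" c] single by (simp add: poly_scale_single single_in_free)
qed (use assms in auto)

lemma star_subst_one [simp]: "star_subst \<rho> 1 = 1"
  using star_subst_single[of \<rho> 0 1] by (simp add: word_eval_def)

lemma star_subst_prod_list: "star_subst \<rho> (prod_list as) = prod_list (map (star_subst \<rho>) as)"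
  by (induction as) (simp_all add: star_subst_mult)

lemma star_subst_comp:
  "star_subst \<sigma> (star_subst \<rho> a) = star_subst (\<lambda>x. star_subst \<sigma> (\<rho> x)) a"
proof (induction a rule: poly_mapping_single_induct)
  case (single u c)
  have "star_subst \<sigma> (letter_eval \<rho> l) = letter_eval (\<lambda>x. star_subst \<sigma> (\<rho> x)) l" for l
    by (simp add: letter_eval_def star_subst_star)
  then have "star_subst \<sigma> (word_eval \<rho> u) = word_eval (\<lambda>x. star_subst \<sigma> (\<rho> x)) u"
    by (simp add: word_eval_def star_subst_prod_list comp_def)
  then show ?case by (simp add: star_subst_single star_subst_scale)
qed (simp_all add: star_subst_add)

lemma star_subst_id:
  assumes "a \<in> free_star_algebra X"
  shows "star_subst gen a = a"
  using assms
  by (induction a rule: free_star_algebra_gen_induct)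
    (simp_all add: star_subst_star star_subst_scale star_subst_mult star_subst_add)

section \<open>C*-seminorms\<close>

context
  fixes X :: "'g set" and p :: "'g star_poly \<Rightarrow> real"
  assumes p: "cstar_seminorm X p"
begin

lemma cstar_seminorm_nonneg: "a \<in> free_star_algebra X \<Longrightarrow> 0 \<le> p a"
  and cstar_seminorm_scale: "a \<in> free_star_algebra X \<Longrightarrow> p (poly_scale c a) = cmod c * p a"
  and cstar_seminorm_add:
    "a \<in> free_star_algebra X \<Longrightarrow> b \<in> free_star_algebra X \<Longrightarrow> p (a + b) \<le> p a + p b"
  and cstar_seminorm_mult:
    "a \<in> free_star_algebra X \<Longrightarrow> b \<in> free_star_algebra X \<Longrightarrow> p (a * b) \<le> p a * p b"
  and cstar_seminorm_star_mult: "a \<in> free_star_algebra X \<Longrightarrow> p (poly_star a * a) = (p a)\<^sup>2"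
  using p by (auto simp: cstar_seminorm_def)

lemma cstar_seminorm_zero: "p 0 = 0"
  using cstar_seminorm_scale[of 0 0] by simp

lemma cstar_seminorm_uminus: "a \<in> free_star_algebra X \<Longrightarrow> p (- a) = p a"
  using cstar_seminorm_scale[of a "- 1"] by (simp add: poly_scale_minus_one)

lemma cstar_seminorm_minus_commute:
  "a \<in> free_star_algebra X \<Longrightarrow> b \<in> free_star_algebra X \<Longrightarrow> p (a - b) = p (b - a)"
  using cstar_seminorm_uminus[of "b - a"] by auto

text \<open>By the C*-identity, \<open>p b\<close> squared is \<open>p (poly_star b * b)\<close>,
  hence at most \<open>p (poly_star b) * p b\<close>; cancelling \<open>p b\<close> and exchanging
  \<open>b\<close> with its adjoint gives both inequalities.\<close>

lemma cstar_seminorm_star: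
  assumes "a \<in> free_star_algebra X"
  shows "p (poly_star a) = p a"
proof -
  have le: "p b \<le> p (poly_star b)" if b: "b \<in> free_star_algebra X" for b
  proof (cases "p b = 0")
    case False
    then have "p b > 0" using cstar_seminorm_nonneg[OF b] by simp
    moreover have "p b * p b \<le> p (poly_star b) * p b"
      using cstar_seminorm_mult[of "poly_star b" b] cstar_seminorm_star_mult[OF b] b
      by (auto simp: power2_eq_square)
    ultimately show ?thesis by simp
  qed (use b in \<open>auto intro: cstar_seminorm_nonneg\<close>)
  from le[OF assms] le[of "poly_star a"] assms show ?thesis by auto
qed

end

lemma cstar_seminorm_triangle:
  assumes "cstar_seminorm X p"
    and "a \<in> free_star_algebra X" "b \<in> free_star_algebra X" "c \<in> free_star_algebra X"
  shows "p (a - c) \<le> p (a - b) + p (b - c)"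
  using cstar_seminorm_add[OF assms(1), of "a - b" "b - c"] assms by auto

text \<open>Pulling back a seminorm plays the part of composing a representation with a
  *-homomorphism.\<close>

lemma cstar_seminorm_star_subst:
  assumes "cstar_seminorm Y p" "\<rho> ` X \<subseteq> free_star_algebra Y"
  shows "cstar_seminorm X (\<lambda>a. p (star_subst \<rho> a))"
  using assms star_subst_in_free[OF _ assms(2)] unfolding cstar_seminorm_def
  by (auto simp: star_subst_scale star_subst_add star_subst_mult star_subst_star)

definition presentation_seminorms :: "'g set \<Rightarrow> 'g star_poly set \<Rightarrow> ('g star_poly \<Rightarrow> real) set" where
  "presentation_seminorms X R = {p. cstar_seminorm X p \<and> (\<forall>r\<in>R. p r = 0)}"

text \<open>Ensures that the universal seminorm is a supremum over a nonempty set, and that it is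
  nonnegative.\<close>

lemma zero_in_presentation_seminorms: "(\<lambda>_. 0) \<in> presentation_seminorms X R"
  by (simp add: presentation_seminorms_def cstar_seminorm_def)

text \<open>Equality of the classes in the universal C*-algebra. Membership of both sides in the
  free *-algebra is included, since the seminorm laws hold only there and chains of equalities would
  otherwise need it at every step.\<close>

definition cstar_eq :: "'g set \<Rightarrow> 'g star_poly set \<Rightarrow> 'g star_poly \<Rightarrow> 'g star_poly \<Rightarrow> bool" where
  "cstar_eq X R a b \<longleftrightarrow>
    a \<in> free_star_algebra X \<and> b \<in> free_star_algebra X \<and> universal_seminorm X R (a - b) = 0"

text \<open>A real supremum is meaningful only for bounded sets. A bound on each generator that is
  uniform in the seminorm spreads to all *-polynomials.\<close>

locale bounded_presentation =
  fixes X :: "'g set" and R :: "'g star_poly set"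
  assumes gen_bounded: "x \<in> X \<Longrightarrow> \<exists>K. \<forall>p\<in>presentation_seminorms X R. p (gen x) \<le> K"
begin

abbreviation N :: "'g star_poly \<Rightarrow> real" where
  "N \<equiv> universal_seminorm X R"

abbreviation Fr :: "'g star_poly set" where
  "Fr \<equiv> free_star_algebra X"

abbreviation cls :: "(nat \<Rightarrow> 'g star_poly) \<Rightarrow> (nat \<Rightarrow> 'g star_poly) set" where
  "cls x \<equiv> seq_equiv X R `` {x}"

lemma universal_seminorm_conv: "N a = (SUP p\<in>presentation_seminorms X R. p a)"
  by (simp add: universal_seminorm_def presentation_seminorms_def)

lemma seminorm_bounded:
  assumes "a \<in> Fr"
  shows "\<exists>K. \<forall>p\<in>presentation_seminorms X R. p a \<le> K"
  using assms
proof (induction a rule: free_star_algebra_gen_induct)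
  case zero
  then show ?case by (auto simp: presentation_seminorms_def cstar_seminorm_zero)
next
  case (gen x)
  then show ?case by (rule gen_bounded)
next
  case (star x)
  then show ?case
    using gen_bounded by (fastforce simp: presentation_seminorms_def cstar_seminorm_star gen_in_free)
next
  case (scale a c)
  then obtain K where K: "\<And>p. p \<in> presentation_seminorms X R \<Longrightarrow> p a \<le> K" by blast
  show ?case
    using K scale(1) by (intro exI[of _ "cmod c * K"])
      (auto simp: presentation_seminorms_def cstar_seminorm_scale mult_left_mono)
next
  case (mult a b)
  then obtain K L where K: "\<And>p. p \<in> presentation_seminorms X R \<Longrightarrow> p a \<le> K"
    and L: "\<And>p. p \<in> presentation_seminorms X R \<Longrightarrow> p b \<le> L" by blast
  have "p (a * b) \<le> K * L" if p: "p \<in> presentation_seminorms X R" for p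
  proof -
    have c: "cstar_seminorm X p" using p by (simp add: presentation_seminorms_def)
    have "p (a * b) \<le> p a * p b" using cstar_seminorm_mult[OF c] mult by blast
    also have "\<dots> \<le> K * L"
      using K[OF p] L[OF p] cstar_seminorm_nonneg[OF c] mult(1,2)
      by (intro mult_mono) (auto intro: order_trans)
    finally show ?thesis .
  qed
  then show ?case by blast
next
  case (add a b)
  then obtain K L where K: "\<And>p. p \<in> presentation_seminorms X R \<Longrightarrow> p a \<le> K"
    and L: "\<And>p. p \<in> presentation_seminorms X R \<Longrightarrow> p b \<le> L" by blast
  have "p (a + b) \<le> K + L" if p: "p \<in> presentation_seminorms X R" for p
    using cstar_seminorm_add[of X p a b] K[OF p] L[OF p] add p
    by (auto simp: presentation_seminorms_def)
  then show ?case by blast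
qed

lemma seminorm_le_universal:
  assumes "a \<in> Fr" "p \<in> presentation_seminorms X R"
  shows "p a \<le> N a"
  using seminorm_bounded[OF assms(1)] assms(2) unfolding universal_seminorm_conv
  by (intro cSUP_upper) (auto simp: bdd_above_def)

lemma universal_seminorm_le:
  assumes "\<And>p. p \<in> presentation_seminorms X R \<Longrightarrow> p a \<le> K"
  shows "N a \<le> K"
  using assms zero_in_presentation_seminorms[of X R] unfolding universal_seminorm_conv
  by (intro cSUP_least) auto

lemma universal_seminorm_rel: "r \<in> R \<Longrightarrow> N r = 0"
proof -
  assume "r \<in> R"
  then have "(\<lambda>p. p r) ` presentation_seminorms X R = {0}"
    using zero_in_presentation_seminorms[of X R] by (force simp: presentation_seminorms_def)
  then show ?thesis by (simp add: universal_seminorm_conv)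
qed

lemma universal_seminorm_nonneg: "a \<in> Fr \<Longrightarrow> 0 \<le> N a"
  using seminorm_le_universal[OF _ zero_in_presentation_seminorms] by simp

lemma universal_seminorm_scale:
  assumes a: "a \<in> Fr"
  shows "N (poly_scale c a) = cmod c * N a"
proof -
  have le: "N (poly_scale d b) \<le> cmod d * N b" if "b \<in> Fr" for d b
    using that seminorm_le_universal[OF that]
    by (intro universal_seminorm_le)
      (auto simp: presentation_seminorms_def cstar_seminorm_scale mult_left_mono)
  show ?thesis
  proof (cases "c = 0")
    case True
    then show ?thesis using le[of 0 0] universal_seminorm_nonneg[of 0] by simp
  next
    case False
    \<comment> \<open>The reverse inequality is the first one applied to the scalar
      \<open>1 / c\<close>.\<close>
    then have "N a \<le> cmod (1 / c) * N (poly_scale c a)"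
      using le[of "poly_scale c a" "1 / c"] a by (auto simp: poly_scale_scale)
    then have "cmod c * N a \<le> N (poly_scale c a)"
      using False by (simp add: norm_divide field_simps)
    then show ?thesis using le[OF a, of c] by simp
  qed
qed

text \<open>The supremum of C*-seminorms is again a C*-seminorm. For the C*-identity, the bound on
  the square of each \<open>p a\<close> is turned into a bound on \<open>p a\<close> by a square
  root before passing to the supremum.\<close>

lemma cstar_seminorm_universal: "cstar_seminorm X N"
  unfolding cstar_seminorm_def
proof (intro conjI ballI allI)
  fix a b assume a: "a \<in> Fr" and b: "b \<in> Fr"
  show "N (a + b) \<le> N a + N b"
    using a b by (intro universal_seminorm_le)
      (auto simp: presentation_seminorms_def
        intro!: order_trans[OF cstar_seminorm_add] add_mono seminorm_le_universal)
  show "N (a * b) \<le> N a * N b"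
    using a b by (intro universal_seminorm_le)
      (auto simp: presentation_seminorms_def
        intro!: order_trans[OF cstar_seminorm_mult] mult_mono seminorm_le_universal
          universal_seminorm_nonneg cstar_seminorm_nonneg)
next
  fix a assume a: "a \<in> Fr"
  show "N (poly_star a * a) = (N a)\<^sup>2"
  proof (rule antisym)
    show "N (poly_star a * a) \<le> (N a)\<^sup>2"
      using a by (intro universal_seminorm_le)
        (auto simp: presentation_seminorms_def cstar_seminorm_star_mult cstar_seminorm_nonneg
          intro!: power_mono seminorm_le_universal)
    have "N a \<le> sqrt (N (poly_star a * a))"
    proof (rule universal_seminorm_le)
      fix p assume p: "p \<in> presentation_seminorms X R"
      then have "(p a)\<^sup>2 \<le> N (poly_star a * a)"
        using seminorm_le_universal[OF _ p, of "poly_star a * a"] cstar_seminorm_star_mult[of X p a]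
          mult_in_free[OF poly_star_in_free[OF a] a] a
        by (simp add: presentation_seminorms_def)
      then show "p a \<le> sqrt (N (poly_star a * a))" by (rule real_le_rsqrt)
    qed
    then show "(N a)\<^sup>2 \<le> N (poly_star a * a)"
      using a universal_seminorm_nonneg by (intro sqrt_ge_absD) (auto simp: abs_of_nonneg)
  qed
qed (simp_all add: universal_seminorm_nonneg universal_seminorm_scale)

lemmas N_zero = cstar_seminorm_zero[OF cstar_seminorm_universal]
  and N_add = cstar_seminorm_add[OF cstar_seminorm_universal]
  and N_mult = cstar_seminorm_mult[OF cstar_seminorm_universal]
  and N_star = cstar_seminorm_star[OF cstar_seminorm_universal]
  and N_star_mult = cstar_seminorm_star_mult[OF cstar_seminorm_universal]
  and N_minus_commute = cstar_seminorm_minus_commute[OF cstar_seminorm_universal]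
  and N_triangle = cstar_seminorm_triangle[OF cstar_seminorm_universal]

lemma N_mult_diff:
  assumes "a \<in> Fr" "b \<in> Fr" "c \<in> Fr" "d \<in> Fr"
  shows "N (a * b - c * d) \<le> N (a - c) * N b + N c * N (b - d)"
proof -
  have "a * b - c * d = (a - c) * b + c * (b - d)" by (simp add: algebra_simps)
  then have "N (a * b - c * d) \<le> N ((a - c) * b) + N (c * (b - d))"
    using N_add[of "(a - c) * b" "c * (b - d)"] assms by auto
  also have "\<dots> \<le> N (a - c) * N b + N c * N (b - d)"
    using assms by (intro add_mono N_mult) auto
  finally show ?thesis .
qed

abbreviation eq :: "'g star_poly \<Rightarrow> 'g star_poly \<Rightarrow> bool" where
  "eq \<equiv> cstar_eq X R"

lemma eq_refl: "a \<in> Fr \<Longrightarrow> eq a a"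
  by (simp add: cstar_eq_def N_zero)

lemma eq_sym: "eq a b \<Longrightarrow> eq b a"
  by (auto simp: cstar_eq_def N_minus_commute)

lemma eq_trans [trans]: "eq a b \<Longrightarrow> eq b c \<Longrightarrow> eq a c"
  using N_triangle[of a b c] universal_seminorm_nonneg[of "a - c"] by (auto simp: cstar_eq_def)

lemma eq_scale: "eq a b \<Longrightarrow> eq (poly_scale c a) (poly_scale c b)"
  by (auto simp: cstar_eq_def universal_seminorm_scale diff_in_free simp flip: poly_scale_diff)

lemma eq_star: "eq a b \<Longrightarrow> eq (poly_star a) (poly_star b)"
  by (auto simp: cstar_eq_def N_star diff_in_free simp flip: poly_star_diff)

lemma eq_add: "eq a b \<Longrightarrow> eq c d \<Longrightarrow> eq (a + c) (b + d)"
  using N_add[of "a - b" "c - d"] universal_seminorm_nonneg[of "(a + c) - (b + d)"]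
  by (auto simp: cstar_eq_def add_diff_add diff_in_free)

lemma eq_uminus: "eq a b \<Longrightarrow> eq (- a) (- b)"
  using eq_scale[of a b "- 1"] by (simp add: poly_scale_minus_one)

lemma eq_diff: "eq a b \<Longrightarrow> eq c d \<Longrightarrow> eq (a - c) (b - d)"
  using eq_add[OF _ eq_uminus, of a b c d] by simp

lemma eq_mult: "eq a b \<Longrightarrow> eq c d \<Longrightarrow> eq (a * c) (b * d)"
  using N_mult_diff[of a c b d] universal_seminorm_nonneg[of "a * c - b * d"]
  by (auto simp: cstar_eq_def)

lemma eq_sum: "(\<And>i. i \<in> S \<Longrightarrow> eq (f i) (g i)) \<Longrightarrow> eq (sum f S) (sum g S)"
  by (induction S rule: infinite_finite_induct) (auto intro: eq_add eq_refl)

lemma eq_zero_iff: "eq a b \<longleftrightarrow> a \<in> Fr \<and> b \<in> Fr \<and> eq (a - b) 0"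
  by (auto simp: cstar_eq_def)

text \<open>The C*-identity used as a source of equations that do not follow from the relations by
  algebra alone; it yields \<open>S_e S_{t(e)} = S_e\<close>.\<close>

lemma eq_star_mult_zero:
  assumes "a \<in> Fr" "eq (poly_star a * a) 0"
  shows "eq a 0"
  using assms N_star_mult[of a] by (simp add: cstar_eq_def)


section \<open>The Hausdorff completion\<close>

text \<open>As a limit along a product filter, the Cauchy condition becomes accessible to the limit
  rules, so closure under each operation needs just a majorant that tends to
  \<open>0\<close>.\<close>

lemma cauchy_seqs_iff:
  "x \<in> cauchy_seqs X R \<longleftrightarrow> range x \<subseteq> Fr \<and>
    ((\<lambda>(m, n). N (x m - x n)) \<longlongrightarrow> 0) (sequentially \<times>\<^sub>F sequentially)"
proof -
  have "(\<forall>\<epsilon>>0. \<exists>M. \<forall>m\<ge>M. \<forall>n\<ge>M. N (x m - x n) < \<epsilon>) \<longleftrightarrow>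
      ((\<lambda>(m, n). N (x m - x n)) \<longlongrightarrow> 0) (sequentially \<times>\<^sub>F sequentially)"
    if "range x \<subseteq> Fr"
  proof -
    have "\<bar>N (x m - x n)\<bar> = N (x m - x n)" for m n
      using that by (intro abs_of_nonneg universal_seminorm_nonneg) auto
    then show ?thesis
      by (simp add: tendsto_iff eventually_prod_sequentially dist_real_def) blast
  qed
  then show ?thesis by (auto simp: cauchy_seqs_def)
qed

lemma cauchy_seqs_in_free: "x \<in> cauchy_seqs X R \<Longrightarrow> x n \<in> Fr"
  by (auto simp: cauchy_seqs_iff)

lemma cauchy_seqs_tendsto:
  "x \<in> cauchy_seqs X R \<Longrightarrow>
    ((\<lambda>z. N (x (fst z) - x (snd z))) \<longlongrightarrow> 0) (sequentially \<times>\<^sub>F sequentially)"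
  by (auto simp: cauchy_seqs_iff case_prod_unfold)

lemma cauchy_seqsI:
  assumes "\<And>n. x n \<in> Fr" "\<And>m n. N (x m - x n) \<le> f (m, n)"
    and "(f \<longlongrightarrow> 0) (sequentially \<times>\<^sub>F sequentially)"
  shows "x \<in> cauchy_seqs X R"
  unfolding cauchy_seqs_iff
proof (intro conjI tendsto_sandwich[OF _ _ tendsto_const assms(3)])
  show "range x \<subseteq> Fr" using assms(1) by auto
qed (use assms in \<open>auto intro!: always_eventually universal_seminorm_nonneg\<close>)

lemma const_in_cauchy_seqs: "a \<in> Fr \<Longrightarrow> (\<lambda>_. a) \<in> cauchy_seqs X R"
  by (rule cauchy_seqsI[where f = "\<lambda>_. 0"]) (auto simp: N_zero)

lemma convergent_N:
  assumes x: "x \<in> cauchy_seqs X R"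
  shows "convergent (\<lambda>n. N (x n))"
proof -
  have "\<bar>N (x m) - N (x n)\<bar> \<le> N (x m - x n)" for m n
    using N_triangle[of "x m" "x n" 0] N_triangle[of "x n" "x m" 0] cauchy_seqs_in_free[OF x]
      N_minus_commute[of "x m" "x n"]
    by fastforce
  moreover have "\<forall>\<epsilon>>0. \<exists>M. \<forall>m\<ge>M. \<forall>n\<ge>M. N (x m - x n) < \<epsilon>"
    using x by (simp add: cauchy_seqs_def)
  ultimately have "Cauchy (\<lambda>n. N (x n))"
    unfolding Cauchy_def dist_real_def by (meson order_le_less_trans)
  then show ?thesis by (simp add: Cauchy_convergent_iff)
qed

lemma N_bounded_seq:
  assumes "x \<in> cauchy_seqs X R"
  obtains K where "K \<ge> 0" "\<And>n. N (x n) \<le> K"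
proof -
  have "Bseq (\<lambda>n. N (x n))"
    by (rule convergent_imp_Bseq) (rule convergent_N[OF assms])
  then obtain K where "K > 0" "\<And>n. norm (N (x n)) \<le> K" by (auto elim: BseqE)
  then show thesis by (intro that[of K]) (simp_all add: abs_le_iff)
qed

lemma add_in_cauchy_seqs:
  assumes x: "x \<in> cauchy_seqs X R" and y: "y \<in> cauchy_seqs X R"
  shows "(\<lambda>n. x n + y n) \<in> cauchy_seqs X R"
proof (rule cauchy_seqsI)
  show "N ((x m + y m) - (x n + y n)) \<le> (\<lambda>z. N (x (fst z) - x (snd z)) + N (y (fst z) - y (snd z))) (m, n)" for m n
    using N_add[of "x m - x n" "y m - y n"] cauchy_seqs_in_free[OF x] cauchy_seqs_in_free[OF y]
    by (simp add: add_diff_add diff_in_free)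
  show "((\<lambda>z. N (x (fst z) - x (snd z)) + N (y (fst z) - y (snd z))) \<longlongrightarrow> 0) (sequentially \<times>\<^sub>F sequentially)"
    by (intro tendsto_add_zero cauchy_seqs_tendsto x y)
qed (use cauchy_seqs_in_free x y in blast)

lemma scale_in_cauchy_seqs:
  assumes x: "x \<in> cauchy_seqs X R"
  shows "(\<lambda>n. poly_scale c (x n)) \<in> cauchy_seqs X R"
proof (rule cauchy_seqsI)
  show "N (poly_scale c (x m) - poly_scale c (x n)) \<le> (\<lambda>z. cmod c * N (x (fst z) - x (snd z))) (m, n)" for m n
    using cauchy_seqs_in_free[OF x] by (simp add: universal_seminorm_scale diff_in_free flip: poly_scale_diff)
  show "((\<lambda>z. cmod c * N (x (fst z) - x (snd z))) \<longlongrightarrow> 0) (sequentially \<times>\<^sub>F sequentially)"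
    by (intro tendsto_mult_right_zero cauchy_seqs_tendsto x)
qed (use cauchy_seqs_in_free x in blast)

lemma star_in_cauchy_seqs:
  assumes x: "x \<in> cauchy_seqs X R"
  shows "(\<lambda>n. poly_star (x n)) \<in> cauchy_seqs X R"
proof (rule cauchy_seqsI)
  show "N (poly_star (x m) - poly_star (x n)) \<le> (\<lambda>z. N (x (fst z) - x (snd z))) (m, n)" for m n
    using cauchy_seqs_in_free[OF x] by (simp add: N_star diff_in_free flip: poly_star_diff)
qed (use cauchy_seqs_in_free cauchy_seqs_tendsto x in blast)+

lemma mult_in_cauchy_seqs:
  assumes x: "x \<in> cauchy_seqs X R" and y: "y \<in> cauchy_seqs X R"
  shows "(\<lambda>n. x n * y n) \<in> cauchy_seqs X R"
proof -
  obtain K where K: "K \<ge> 0" "\<And>n. N (x n) \<le> K" using N_bounded_seq[OF x] by metis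
  obtain L where L: "L \<ge> 0" "\<And>n. N (y n) \<le> L" using N_bounded_seq[OF y] by metis
  note fr = cauchy_seqs_in_free[OF x] cauchy_seqs_in_free[OF y]
  show ?thesis
  proof (rule cauchy_seqsI)
    show "N (x m * y m - x n * y n) \<le>
        (\<lambda>z. N (x (fst z) - x (snd z)) * L + K * N (y (fst z) - y (snd z))) (m, n)" for m n
      using fr K L
      by (auto intro!: order_trans[OF N_mult_diff] add_mono mult_left_mono mult_right_mono
          universal_seminorm_nonneg)
    show "((\<lambda>z. N (x (fst z) - x (snd z)) * L + K * N (y (fst z) - y (snd z))) \<longlongrightarrow> 0)
        (sequentially \<times>\<^sub>F sequentially)"
      by (intro tendsto_add_zero tendsto_mult_right_zero tendsto_mult_left_zero cauchy_seqs_tendsto x y)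
  qed (use fr in blast)
qed

lemma seq_equivI:
  assumes "x \<in> cauchy_seqs X R" "y \<in> cauchy_seqs X R"
    and "\<And>n. N (x n - y n) \<le> f n" "f \<longlonglongrightarrow> 0"
  shows "(x, y) \<in> seq_equiv X R"
proof -
  have "(\<lambda>n. N (x n - y n)) \<longlonglongrightarrow> 0"
    using assms cauchy_seqs_in_free
    by (intro tendsto_sandwich[OF _ _ tendsto_const assms(4)])
      (auto intro!: always_eventually universal_seminorm_nonneg)
  then show ?thesis using assms by (simp add: seq_equiv_def)
qed

lemma seq_equivD:
  assumes "(x, y) \<in> seq_equiv X R"
  shows "x \<in> cauchy_seqs X R" "y \<in> cauchy_seqs X R" "(\<lambda>n. N (x n - y n)) \<longlonglongrightarrow> 0"
    "x n \<in> Fr" "y n \<in> Fr"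
  using assms by (auto simp: seq_equiv_def cauchy_seqs_in_free)

lemma equiv_seq_equiv: "equiv (cauchy_seqs X R) (seq_equiv X R)"
proof (rule equivI)
  show "seq_equiv X R \<subseteq> cauchy_seqs X R \<times> cauchy_seqs X R"
    by (auto simp: seq_equiv_def)
  show "refl_on (cauchy_seqs X R) (seq_equiv X R)"
    by (auto simp: refl_on_def seq_equiv_def N_zero)
  show "sym (seq_equiv X R)"
  proof (rule symI)
    fix x y assume xy: "(x, y) \<in> seq_equiv X R"
    then have "N (x n - y n) = N (y n - x n)" for n
      using seq_equivD by (intro N_minus_commute) auto
    then show "(y, x) \<in> seq_equiv X R" using xy by (simp add: seq_equiv_def)
  qed
  show "trans (seq_equiv X R)"
  proof (rule transI)
    fix x y z assume xy: "(x, y) \<in> seq_equiv X R" and yz: "(y, z) \<in> seq_equiv X R"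
    show "(x, z) \<in> seq_equiv X R"
    proof (rule seq_equivI)
      show "N (x n - z n) \<le> N (x n - y n) + N (y n - z n)" for n
        using seq_equivD[OF xy] seq_equivD[OF yz] by (intro N_triangle) auto
      show "(\<lambda>n. N (x n - y n) + N (y n - z n)) \<longlonglongrightarrow> 0"
        by (intro tendsto_add_zero seq_equivD xy yz)
    qed (rule seq_equivD(1)[OF xy] seq_equivD(2)[OF yz])+
  qed
qed

lemma cls_eqI: "(x, y) \<in> seq_equiv X R \<Longrightarrow> cls x = cls y"
  by (rule equiv_class_eq[OF equiv_seq_equiv])

lemma cls_const_eqI: "eq a b \<Longrightarrow> cls (\<lambda>_. a) = cls (\<lambda>_. b)"
  by (intro cls_eqI) (simp add: seq_equiv_def cstar_eq_def const_in_cauchy_seqs)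

lemma cls_self: "x \<in> cauchy_seqs X R \<Longrightarrow> x \<in> cls x"
  by (rule equiv_class_self[OF equiv_seq_equiv])

lemma carrier_universal_cstar: "carrier (universal_cstar X R) = cls ` cauchy_seqs X R"
  by (auto simp: universal_cstar_def quotient_def)

lemma cls_in_carrier: "x \<in> cauchy_seqs X R \<Longrightarrow> cls x \<in> carrier (universal_cstar X R)"
  by (auto simp: carrier_universal_cstar)

lemma add_cls:
  assumes "x \<in> cauchy_seqs X R" "y \<in> cauchy_seqs X R"
  shows "add (universal_cstar X R) (cls x) (cls y) = cls (\<lambda>n. x n + y n)"
proof -
  have "congruent2 (seq_equiv X R) (seq_equiv X R) (\<lambda>x y. cls (\<lambda>n. x n + y n))"
  proof (rule congruent2I')
    fix x x' y y' assume xx: "(x, x') \<in> seq_equiv X R" and yy: "(y, y') \<in> seq_equiv X R"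
    show "cls (\<lambda>n. x n + y n) = cls (\<lambda>n. x' n + y' n)"
    proof (intro cls_eqI seq_equivI add_in_cauchy_seqs)
      show "N ((x n + y n) - (x' n + y' n)) \<le> N (x n - x' n) + N (y n - y' n)" for n
        using N_add[of "x n - x' n" "y n - y' n"] seq_equivD[OF xx] seq_equivD[OF yy]
        by (simp add: add_diff_add diff_in_free)
      show "(\<lambda>n. N (x n - x' n) + N (y n - y' n)) \<longlonglongrightarrow> 0"
        by (intro tendsto_add_zero seq_equivD xx yy)
    qed (rule seq_equivD(1,2)[OF xx] seq_equivD(1,2)[OF yy])+
  qed
  from UN_equiv_class2[OF equiv_seq_equiv equiv_seq_equiv this assms]
  show ?thesis by (simp add: universal_cstar_def)
qed

lemma mult_cls:
  assumes "x \<in> cauchy_seqs X R" "y \<in> cauchy_seqs X R"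
  shows "mult (universal_cstar X R) (cls x) (cls y) = cls (\<lambda>n. x n * y n)"
proof -
  have "congruent2 (seq_equiv X R) (seq_equiv X R) (\<lambda>x y. cls (\<lambda>n. x n * y n))"
  proof (rule congruent2I')
    fix x x' y y' assume xx: "(x, x') \<in> seq_equiv X R" and yy: "(y, y') \<in> seq_equiv X R"
    obtain K where K: "K \<ge> 0" "\<And>n. N (x' n) \<le> K" using N_bounded_seq[OF seq_equivD(2)[OF xx]] by metis
    obtain L where L: "L \<ge> 0" "\<And>n. N (y n) \<le> L" using N_bounded_seq[OF seq_equivD(1)[OF yy]] by metis
    show "cls (\<lambda>n. x n * y n) = cls (\<lambda>n. x' n * y' n)"
    proof (intro cls_eqI seq_equivI mult_in_cauchy_seqs)
      show "N (x n * y n - x' n * y' n) \<le> N (x n - x' n) * L + K * N (y n - y' n)" for n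
        using seq_equivD[OF xx] seq_equivD[OF yy] K L
        by (auto intro!: order_trans[OF N_mult_diff] add_mono mult_left_mono mult_right_mono
            universal_seminorm_nonneg)
      show "(\<lambda>n. N (x n - x' n) * L + K * N (y n - y' n)) \<longlonglongrightarrow> 0"
        by (intro tendsto_add_zero tendsto_mult_right_zero tendsto_mult_left_zero seq_equivD xx yy)
    qed (rule seq_equivD(1,2)[OF xx] seq_equivD(1,2)[OF yy])+
  qed
  from UN_equiv_class2[OF equiv_seq_equiv equiv_seq_equiv this assms]
  show ?thesis by (simp add: universal_cstar_def)
qed

lemma scale_cls:
  assumes "x \<in> cauchy_seqs X R"
  shows "scale (universal_cstar X R) c (cls x) = cls (\<lambda>n. poly_scale c (x n))"
proof -
  have "congruent (seq_equiv X R) (\<lambda>x. cls (\<lambda>n. poly_scale c (x n)))"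
  proof (rule congruentI)
    fix x x' assume xx: "(x, x') \<in> seq_equiv X R"
    show "cls (\<lambda>n. poly_scale c (x n)) = cls (\<lambda>n. poly_scale c (x' n))"
    proof (intro cls_eqI seq_equivI scale_in_cauchy_seqs)
      show "N (poly_scale c (x n) - poly_scale c (x' n)) \<le> cmod c * N (x n - x' n)" for n
        using seq_equivD[OF xx] by (simp add: universal_seminorm_scale diff_in_free flip: poly_scale_diff)
      show "(\<lambda>n. cmod c * N (x n - x' n)) \<longlonglongrightarrow> 0"
        by (intro tendsto_mult_right_zero seq_equivD xx)
    qed (rule seq_equivD(1,2)[OF xx])+
  qed
  from UN_equiv_class[OF equiv_seq_equiv this assms]
  show ?thesis by (simp add: universal_cstar_def)
qed

lemma star_cls:
  assumes "x \<in> cauchy_seqs X R"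
  shows "star (universal_cstar X R) (cls x) = cls (\<lambda>n. poly_star (x n))"
proof -
  have "congruent (seq_equiv X R) (\<lambda>x. cls (\<lambda>n. poly_star (x n)))"
  proof (rule congruentI)
    fix x x' assume xx: "(x, x') \<in> seq_equiv X R"
    show "cls (\<lambda>n. poly_star (x n)) = cls (\<lambda>n. poly_star (x' n))"
    proof (intro cls_eqI seq_equivI star_in_cauchy_seqs)
      show "N (poly_star (x n) - poly_star (x' n)) \<le> N (x n - x' n)" for n
        using seq_equivD[OF xx] by (simp add: N_star diff_in_free flip: poly_star_diff)
    qed (rule seq_equivD(1,2,3)[OF xx])+
  qed
  from UN_equiv_class[OF equiv_seq_equiv this assms]
  show ?thesis by (simp add: universal_cstar_def)
qed

text \<open>The norm is a definite description over all representatives. Equivalent sequences have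
  the same limit of seminorms by the reverse triangle inequality, so the description is
  unique.\<close>

lemma cnorm_cls:
  assumes x: "x \<in> cauchy_seqs X R"
  shows "(\<lambda>n. N (x n)) \<longlonglongrightarrow> cnorm (universal_cstar X R) (cls x)"
proof -
  obtain r where r: "(\<lambda>n. N (x n)) \<longlonglongrightarrow> r" using convergent_N[OF x] by (auto simp: convergent_def)
  have unique: "s = r" if "y \<in> cls x" "(\<lambda>n. N (y n)) \<longlonglongrightarrow> s" for y s
  proof -
    have xy: "(x, y) \<in> seq_equiv X R" using that by simp
    have "norm (N (x n) - N (y n)) \<le> N (x n - y n)" for n
      using N_triangle[of "x n" "y n" 0] N_triangle[of "y n" "x n" 0]
        N_minus_commute[of "x n" "y n"] seq_equivD[OF xy] by fastforce
    then have "(\<lambda>n. N (x n) - N (y n)) \<longlonglongrightarrow> 0"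
      by (intro tendsto_norm_zero_cancel[OF tendsto_sandwich[OF _ _ tendsto_const seq_equivD(3)[OF xy]]])
        auto
    moreover have "(\<lambda>n. N (x n) - N (y n)) \<longlonglongrightarrow> r - s"
      by (intro tendsto_diff r that)
    ultimately show "s = r" using LIMSEQ_unique by fastforce
  qed
  have "cnorm (universal_cstar X R) (cls x) =
      (THE r. \<exists>y\<in>cls x. (\<lambda>n. N (y n)) \<longlonglongrightarrow> r)"
    by (simp add: universal_cstar_def)
  also have "\<dots> = r"
    by (rule the_equality) (use r cls_self[OF x] unique in blast)+
  finally have cnorm: "cnorm (universal_cstar X R) (cls x) = r" .
  show ?thesis unfolding cnorm by (rule r)
qed

end


lemma (in bounded_presentation) star_subst_cong:
  assumes "a \<in> free_star_algebra Z" and gen: "\<And>x. x \<in> Z \<Longrightarrow> eq (\<rho> x) (\<sigma> x)"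
  shows "eq (star_subst \<rho> a) (star_subst \<sigma> a)"
  using assms(1)
  by (induction a rule: free_star_algebra_gen_induct)
    (auto simp: star_subst_star star_subst_scale star_subst_mult star_subst_add
      intro: gen eq_refl eq_star eq_scale eq_mult eq_add)


section \<open>Homomorphisms between universal C*-algebras\<close>

text \<open>Restricted to the carrier to meet the extensionality clause of
  \<open>universal_hom\<close>, so that equalities between functions can be obtained.\<close>

definition induced_hom :: "'g set \<Rightarrow> 'g star_poly set \<Rightarrow> 'h set \<Rightarrow> 'h star_poly set \<Rightarrow>
    ('g \<Rightarrow> 'h star_poly) \<Rightarrow> (nat \<Rightarrow> 'g star_poly) set \<Rightarrow> (nat \<Rightarrow> 'h star_poly) set" where
  "induced_hom X R Y T \<rho> =
    restrict (\<lambda>A. \<Union>x\<in>A. seq_equiv Y T `` {\<lambda>n. star_subst \<rho> (x n)}) (carrier (universal_cstar X R))"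

locale presentation_hom =
  dom: bounded_presentation X R + cod: bounded_presentation Y T
  for X :: "'g set" and R and Y :: "'h set" and T +
  fixes \<rho> :: "'g \<Rightarrow> 'h star_poly"
  assumes gen_in: "\<rho> ` X \<subseteq> free_star_algebra Y"
    and rel_zero: "r \<in> R \<Longrightarrow> universal_seminorm Y T (star_subst \<rho> r) = 0"
begin

abbreviation ind where
  "ind \<equiv> induced_hom X R Y T \<rho>"

lemma subst_in_free: "a \<in> dom.Fr \<Longrightarrow> star_subst \<rho> a \<in> cod.Fr"
  by (rule star_subst_in_free[OF _ gen_in])

text \<open>The seminorm of the codomain, pulled back along \<open>\<rho>\<close>, is a C*-seminorm
  that vanishes on \<open>R\<close>, hence lies below the largest one. So substitution is
  contractive and extends to the completions.\<close>

lemma N_subst_le: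
  assumes "a \<in> dom.Fr"
  shows "cod.N (star_subst \<rho> a) \<le> dom.N a"
  by (rule dom.seminorm_le_universal[OF assms])
    (auto simp: presentation_seminorms_def rel_zero
      intro: cstar_seminorm_star_subst[OF cod.cstar_seminorm_universal gen_in])

lemma subst_diff_le:
  "a \<in> dom.Fr \<Longrightarrow> b \<in> dom.Fr \<Longrightarrow> cod.N (star_subst \<rho> a - star_subst \<rho> b) \<le> dom.N (a - b)"
  using N_subst_le[of "a - b"] by (auto simp: star_subst_diff)

lemma subst_in_cauchy_seqs:
  assumes x: "x \<in> cauchy_seqs X R"
  shows "(\<lambda>n. star_subst \<rho> (x n)) \<in> cauchy_seqs Y T"
proof (rule cod.cauchy_seqsI)
  show "cod.N (star_subst \<rho> (x m) - star_subst \<rho> (x n)) \<le> (\<lambda>z. dom.N (x (fst z) - x (snd z))) (m, n)" for m n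
    using subst_diff_le dom.cauchy_seqs_in_free[OF x] by simp
qed (use subst_in_free dom.cauchy_seqs_in_free dom.cauchy_seqs_tendsto x in blast)+

lemma ind_cls:
  assumes x: "x \<in> cauchy_seqs X R"
  shows "ind (dom.cls x) = cod.cls (\<lambda>n. star_subst \<rho> (x n))"
proof -
  have "congruent (seq_equiv X R) (\<lambda>x. cod.cls (\<lambda>n. star_subst \<rho> (x n)))"
  proof (rule congruentI)
    fix x x' assume xx: "(x, x') \<in> seq_equiv X R"
    show "cod.cls (\<lambda>n. star_subst \<rho> (x n)) = cod.cls (\<lambda>n. star_subst \<rho> (x' n))"
    proof (intro cod.cls_eqI cod.seq_equivI subst_in_cauchy_seqs)
      show "cod.N (star_subst \<rho> (x n) - star_subst \<rho> (x' n)) \<le> dom.N (x n - x' n)" for n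
        using dom.seq_equivD[OF xx] by (intro subst_diff_le)
    qed (rule dom.seq_equivD(1,2,3)[OF xx])+
  qed
  from UN_equiv_class[OF dom.equiv_seq_equiv this assms]
  show ?thesis by (simp add: induced_hom_def dom.cls_in_carrier[OF x])
qed

lemma ind_cls_const: "a \<in> dom.Fr \<Longrightarrow> ind (dom.cls (\<lambda>_. a)) = cod.cls (\<lambda>_. star_subst \<rho> a)"
  by (simp add: ind_cls dom.const_in_cauchy_seqs)

lemma ind_in_carrier:
  "A \<in> carrier (universal_cstar X R) \<Longrightarrow> ind A \<in> carrier (universal_cstar Y T)"
  by (auto simp: dom.carrier_universal_cstar ind_cls intro!: cod.cls_in_carrier subst_in_cauchy_seqs)

lemma star_hom_ind: "star_hom (universal_cstar X R) (universal_cstar Y T) ind"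
proof -
  have "ind (add (universal_cstar X R) (dom.cls x) (dom.cls y)) =
        add (universal_cstar Y T) (ind (dom.cls x)) (ind (dom.cls y))"
      "ind (mult (universal_cstar X R) (dom.cls x) (dom.cls y)) =
        mult (universal_cstar Y T) (ind (dom.cls x)) (ind (dom.cls y))"
    if "x \<in> cauchy_seqs X R" "y \<in> cauchy_seqs X R" for x y
    using that
    by (simp_all add: dom.add_cls dom.mult_cls ind_cls dom.add_in_cauchy_seqs dom.mult_in_cauchy_seqs
        cod.add_cls cod.mult_cls subst_in_cauchy_seqs star_subst_add star_subst_mult)
  moreover have "ind (scale (universal_cstar X R) c (dom.cls x)) =
        scale (universal_cstar Y T) c (ind (dom.cls x))"
      "ind (star (universal_cstar X R) (dom.cls x)) = star (universal_cstar Y T) (ind (dom.cls x))"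
    if "x \<in> cauchy_seqs X R" for c x
    using that
    by (simp_all add: dom.scale_cls dom.star_cls ind_cls dom.scale_in_cauchy_seqs
        dom.star_in_cauchy_seqs cod.scale_cls cod.star_cls subst_in_cauchy_seqs star_subst_scale
        star_subst_star)
  ultimately show ?thesis
    unfolding star_hom_def using ind_in_carrier by (auto simp: dom.carrier_universal_cstar)
qed

lemma cnorm_ind_le:
  assumes "A \<in> carrier (universal_cstar X R)"
  shows "cnorm (universal_cstar Y T) (ind A) \<le> cnorm (universal_cstar X R) A"
proof -
  obtain x where x: "x \<in> cauchy_seqs X R" "A = dom.cls x"
    using assms by (auto simp: dom.carrier_universal_cstar)
  show ?thesis
    unfolding x(2) ind_cls[OF x(1)]
    by (rule LIMSEQ_le[OF cod.cnorm_cls[OF subst_in_cauchy_seqs[OF x(1)]] dom.cnorm_cls[OF x(1)]])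
      (auto intro!: N_subst_le dom.cauchy_seqs_in_free x(1))
qed

lemma ind_extensional: "ind \<in> extensional (carrier (universal_cstar X R))"
  by (simp add: induced_hom_def)

text \<open>A bounded *-homomorphism is determined on the dense *-subalgebra of *-polynomials.\<close>

lemma ind_unique:
  assumes h: "star_hom (universal_cstar X R) (universal_cstar Y T) h"
    and ext: "h \<in> extensional (carrier (universal_cstar X R))"
    and bound: "\<And>A. A \<in> carrier (universal_cstar X R) \<Longrightarrow>
      cnorm (universal_cstar Y T) (h A) \<le> K * cnorm (universal_cstar X R) A"
    and gen: "\<And>x. x \<in> X \<Longrightarrow> h (dom.cls (\<lambda>_. gen x)) = cod.cls (\<lambda>_. \<rho> x)"
  shows "h = ind"
proof (rule extensionalityI[OF ext ind_extensional])
  let ?A = "universal_cstar X R" and ?B = "universal_cstar Y T"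
  note hom = h[unfolded star_hom_def]
  have poly: "h (dom.cls (\<lambda>_. a)) = cod.cls (\<lambda>_. star_subst \<rho> a)" if "a \<in> dom.Fr" for a
    using that
  proof (induction a rule: free_star_algebra_gen_induct)
    case zero
    note z = dom.const_in_cauchy_seqs[OF zero_in_free]
    have "h (dom.cls (\<lambda>_. 0)) \<in> carrier ?B" using hom dom.cls_in_carrier[OF z] by blast
    then obtain y where y: "y \<in> cauchy_seqs Y T" "h (dom.cls (\<lambda>_. 0)) = cod.cls y"
      by (auto simp: cod.carrier_universal_cstar)
    \<comment> \<open>\<open>star_hom\<close> has no clause for zero; \<open>h\<close> preserves
      zero because it commutes with the scalar \<open>0\<close>.\<close>
    have "h (dom.cls (\<lambda>_. 0)) = h (scale ?A 0 (dom.cls (\<lambda>_. 0)))"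
      by (simp add: dom.scale_cls[OF z])
    also have "\<dots> = scale ?B 0 (cod.cls y)"
      using hom dom.cls_in_carrier[OF z] y by simp
    also have "\<dots> = cod.cls (\<lambda>_. 0)" by (simp add: cod.scale_cls[OF y(1)])
    finally show ?case by simp
  next
    case (gen x)
    then show ?case by (simp add: assms(4))
  next
    case (star x)
    have c: "(\<lambda>_. gen x) \<in> cauchy_seqs X R" "(\<lambda>_. \<rho> x) \<in> cauchy_seqs Y T"
      using star gen_in by (auto intro!: dom.const_in_cauchy_seqs cod.const_in_cauchy_seqs gen_in_free)
    have "h (dom.cls (\<lambda>_. poly_star (gen x))) = h (star ?A (dom.cls (\<lambda>_. gen x)))"
      by (simp add: dom.star_cls[OF c(1)])
    also have "\<dots> = star ?B (cod.cls (\<lambda>_. \<rho> x))"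
      using hom dom.cls_in_carrier[OF c(1)] star assms(4) by simp
    finally show ?case by (simp add: cod.star_cls[OF c(2)] star_subst_star)
  next
    case (scale a c)
    have c: "(\<lambda>_. a) \<in> cauchy_seqs X R" "(\<lambda>_. star_subst \<rho> a) \<in> cauchy_seqs Y T"
      using scale by (auto intro!: dom.const_in_cauchy_seqs cod.const_in_cauchy_seqs subst_in_free)
    have "h (dom.cls (\<lambda>_. poly_scale c a)) = h (cstar_algebra.scale ?A c (dom.cls (\<lambda>_. a)))"
      by (simp add: dom.scale_cls[OF c(1)])
    also have "\<dots> = cstar_algebra.scale ?B c (cod.cls (\<lambda>_. star_subst \<rho> a))"
      using hom dom.cls_in_carrier[OF c(1)] scale by simp
    finally show ?case by (simp add: cod.scale_cls[OF c(2)] star_subst_scale)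
  next
    case (mult a b)
    have c: "(\<lambda>_. a) \<in> cauchy_seqs X R" "(\<lambda>_. star_subst \<rho> a) \<in> cauchy_seqs Y T"
      "(\<lambda>_. b) \<in> cauchy_seqs X R" "(\<lambda>_. star_subst \<rho> b) \<in> cauchy_seqs Y T"
      using mult by (auto intro!: dom.const_in_cauchy_seqs cod.const_in_cauchy_seqs subst_in_free)
    have "h (dom.cls (\<lambda>_. a * b)) = h (cstar_algebra.mult ?A (dom.cls (\<lambda>_. a)) (dom.cls (\<lambda>_. b)))"
      by (simp add: dom.mult_cls c)
    also have "\<dots> = cstar_algebra.mult ?B (h (dom.cls (\<lambda>_. a))) (h (dom.cls (\<lambda>_. b)))"
      using hom dom.cls_in_carrier c by blast
    finally show ?case by (simp add: cod.mult_cls c star_subst_mult mult)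
  next
    case (add a b)
    have c: "(\<lambda>_. a) \<in> cauchy_seqs X R" "(\<lambda>_. star_subst \<rho> a) \<in> cauchy_seqs Y T"
      "(\<lambda>_. b) \<in> cauchy_seqs X R" "(\<lambda>_. star_subst \<rho> b) \<in> cauchy_seqs Y T"
      using add by (auto intro!: dom.const_in_cauchy_seqs cod.const_in_cauchy_seqs subst_in_free)
    have "h (dom.cls (\<lambda>_. a + b)) = h (cstar_algebra.add ?A (dom.cls (\<lambda>_. a)) (dom.cls (\<lambda>_. b)))"
      by (simp add: dom.add_cls c)
    also have "\<dots> = cstar_algebra.add ?B (h (dom.cls (\<lambda>_. a))) (h (dom.cls (\<lambda>_. b)))"
      using hom dom.cls_in_carrier c by blast
    finally show ?case by (simp add: cod.add_cls c star_subst_add add)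
  qed
  fix A assume A: "A \<in> carrier ?A"
  then obtain x where x: "x \<in> cauchy_seqs X R" and Ax: "A = dom.cls x"
    by (auto simp: dom.carrier_universal_cstar)
  have "h A \<in> carrier ?B" using hom A by blast
  then obtain y where y: "y \<in> cauchy_seqs Y T" and hy: "h A = cod.cls y"
    by (auto simp: cod.carrier_universal_cstar)
  let ?s = "star_subst \<rho>"
  note fx = dom.cauchy_seqs_in_free[OF x] and fy = cod.cauchy_seqs_in_free[OF y]
  note sfx = subst_in_free[OF fx]
  \<comment> \<open>The bound \<open>K\<close> may be negative, and monotonicity of multiplication
    needs a nonnegative factor.\<close>
  let ?K = "max K 0"
  \<comment> \<open>For large \<open>n\<close> the class \<open>A\<close> is within
    \<open>\<epsilon>\<close> of the constant class of \<open>x n\<close>, so by boundedness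
    \<open>h A\<close> is within \<open>?K * \<epsilon>\<close> of the class of
    \<open>?s (x n)\<close>. The other \<open>\<epsilon>\<close> pays for replacing
    \<open>h A\<close>, the class of \<open>y\<close>, by its term \<open>y n\<close>.\<close>
  have key: "eventually (\<lambda>n. cod.N (y n - ?s (x n)) \<le> \<epsilon> + ?K * \<epsilon>) sequentially" if "\<epsilon> > 0" for \<epsilon>
  proof -
    have "\<exists>M. \<forall>m\<ge>M. \<forall>n\<ge>M. dom.N (x m - x n) < \<epsilon>"
      "\<exists>M. \<forall>m\<ge>M. \<forall>n\<ge>M. cod.N (y m - y n) < \<epsilon>"
      using x y that by (simp_all add: cauchy_seqs_def)
    then obtain M1 M2 where M1: "\<And>m n. m \<ge> M1 \<Longrightarrow> n \<ge> M1 \<Longrightarrow> dom.N (x m - x n) < \<epsilon>"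
      and M2: "\<And>m n. m \<ge> M2 \<Longrightarrow> n \<ge> M2 \<Longrightarrow> cod.N (y m - y n) < \<epsilon>"
      by metis
    have "cod.N (y n - ?s (x n)) \<le> \<epsilon> + ?K * \<epsilon>" if n: "n \<ge> max M1 M2" for n
    proof -
      have cm: "(\<lambda>_. - x n) \<in> cauchy_seqs X R" "(\<lambda>_. - ?s (x n)) \<in> cauchy_seqs Y T"
        using fx sfx by (auto intro!: dom.const_in_cauchy_seqs cod.const_in_cauchy_seqs)
      have dx: "(\<lambda>m. x m - x n) \<in> cauchy_seqs X R" and dy: "(\<lambda>m. y m - ?s (x n)) \<in> cauchy_seqs Y T"
        using dom.add_in_cauchy_seqs[OF x cm(1)] cod.add_in_cauchy_seqs[OF y cm(2)] by simp_all
      have "h (dom.cls (\<lambda>m. x m - x n)) = h (add ?A (dom.cls x) (dom.cls (\<lambda>_. - x n)))"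
        using dom.add_cls[OF x cm(1)] by simp
      also have "\<dots> = add ?B (h (dom.cls x)) (h (dom.cls (\<lambda>_. - x n)))"
        using hom dom.cls_in_carrier[OF x] dom.cls_in_carrier[OF cm(1)] by blast
      also have "h (dom.cls x) = cod.cls y" using hy Ax by simp
      also have "h (dom.cls (\<lambda>_. - x n)) = cod.cls (\<lambda>_. - ?s (x n))"
        using poly[of "- x n"] fx by (simp add: star_subst_uminus uminus_in_free)
      also have "add ?B (cod.cls y) \<dots> = cod.cls (\<lambda>m. y m - ?s (x n))"
        using cod.add_cls[OF y cm(2)] by simp
      finally have hd: "h (dom.cls (\<lambda>m. x m - x n)) = cod.cls (\<lambda>m. y m - ?s (x n))" .
      have d: "cnorm ?A (dom.cls (\<lambda>m. x m - x n)) \<le> \<epsilon>"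
        by (rule LIMSEQ_le_const2[OF dom.cnorm_cls[OF dx]])
          (use M1 n in \<open>auto intro!: exI[of _ M1] less_imp_le\<close>)
      have d0: "0 \<le> cnorm ?A (dom.cls (\<lambda>m. x m - x n))"
        by (rule LIMSEQ_le_const[OF dom.cnorm_cls[OF dx]])
          (use fx in \<open>auto intro!: dom.universal_seminorm_nonneg\<close>)
      have "cnorm ?B (cod.cls (\<lambda>m. y m - ?s (x n))) \<le> K * cnorm ?A (dom.cls (\<lambda>m. x m - x n))"
        using bound[OF dom.cls_in_carrier[OF dx]] hd by simp
      also have "\<dots> \<le> ?K * \<epsilon>" using d d0 by (intro mult_mono) auto
      finally have e: "cnorm ?B (cod.cls (\<lambda>m. y m - ?s (x n))) \<le> ?K * \<epsilon>" .
      have "cod.N (y n - ?s (x n)) \<le> \<epsilon> + cnorm ?B (cod.cls (\<lambda>m. y m - ?s (x n)))"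
      proof (rule LIMSEQ_le_const[OF tendsto_add[OF tendsto_const cod.cnorm_cls[OF dy]]])
        have "cod.N (y n - ?s (x n)) \<le> \<epsilon> + cod.N (y m - ?s (x n))" if "m \<ge> M2" for m
          using cod.N_triangle[of "y n" "y m" "?s (x n)"] M2[of n m] that n fy sfx by fastforce
        then show "\<exists>M. \<forall>m\<ge>M. cod.N (y n - ?s (x n)) \<le> \<epsilon> + cod.N (y m - ?s (x n))" by blast
      qed
      then show ?thesis using e by simp
    qed
    then show ?thesis unfolding eventually_sequentially by blast
  qed
  have "(\<lambda>n. cod.N (y n - ?s (x n))) \<longlonglongrightarrow> 0"
  proof (rule tendstoI)
    fix \<epsilon> :: real assume \<epsilon>: "\<epsilon> > 0"
    \<comment> \<open>Chosen such that \<open>(1 + ?K) * \<delta>\<close> is half of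
      \<open>\<epsilon>\<close>, which makes the bound of \<open>key\<close> strict.\<close>
    define \<delta> where "\<delta> = \<epsilon> / (2 * (1 + ?K))"
    have \<delta>: "\<delta> > 0" "\<delta> + ?K * \<delta> < \<epsilon>"
    proof -
      have "1 + ?K > 0" by simp
      then show "\<delta> > 0" using \<epsilon> by (simp add: \<delta>_def)
      have "c * (\<epsilon> / (2 * c)) = \<epsilon> / 2" if "c > 0" for c
        using that by simp
      from this[OF \<open>1 + ?K > 0\<close>] have "(1 + ?K) * \<delta> = \<epsilon> / 2"
        unfolding \<delta>_def .
      moreover have "\<delta> + ?K * \<delta> = (1 + ?K) * \<delta>" by (simp add: algebra_simps)
      ultimately show "\<delta> + ?K * \<delta> < \<epsilon>" using \<epsilon> by linarith
    qed
    from key[OF \<delta>(1)] show "\<forall>\<^sub>F n in sequentially. dist (cod.N (y n - ?s (x n))) 0 < \<epsilon>"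
    proof (rule eventually_mono)
      fix n assume "cod.N (y n - ?s (x n)) \<le> \<delta> + ?K * \<delta>"
      moreover have "0 \<le> cod.N (y n - ?s (x n))"
        using fy sfx by (intro cod.universal_seminorm_nonneg) auto
      ultimately show "dist (cod.N (y n - ?s (x n))) 0 < \<epsilon>" using \<delta> by simp
    qed
  qed
  then have "cod.cls y = cod.cls (\<lambda>n. ?s (x n))"
    using y subst_in_cauchy_seqs[OF x] by (intro cod.cls_eqI) (simp add: seq_equiv_def)
  then show "h A = ind A" using hy Ax ind_cls[OF x] by simp
qed

end

text \<open>Allows the relations to be verified for convenient images of the generators and
  transferred to others that agree with them in the C*-algebra.\<close>

lemma presentation_hom_cong:
  assumes hom: "presentation_hom X R Y T \<sigma>"
    and eq: "\<And>x. x \<in> X \<Longrightarrow> cstar_eq Y T (\<rho> x) (\<sigma> x)"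
    and R: "R \<subseteq> free_star_algebra X"
  shows "presentation_hom X R Y T \<rho>"
proof -
  interpret \<sigma>: presentation_hom X R Y T \<sigma> by fact
  show ?thesis
  proof
    show "\<rho> ` X \<subseteq> free_star_algebra Y" using eq by (auto simp: cstar_eq_def)
    fix r assume r: "r \<in> R"
    have eqr: "\<sigma>.cod.eq (star_subst \<rho> r) (star_subst \<sigma> r)"
      using \<sigma>.cod.star_subst_cong[of r X \<rho> \<sigma>] R r eq by blast
    moreover have "\<sigma>.cod.eq (star_subst \<sigma> r) 0"
      using eqr \<sigma>.rel_zero[OF r] by (simp add: cstar_eq_def)
    ultimately have "\<sigma>.cod.eq (star_subst \<rho> r) 0" by (rule \<sigma>.cod.eq_trans)
    then show "\<sigma>.cod.N (star_subst \<rho> r) = 0" by (simp add: cstar_eq_def)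
  qed
qed

lemma induced_hom_cong:
  assumes "presentation_hom X R Y T \<rho>" "presentation_hom X R Y T \<sigma>"
    and eq: "\<And>x. x \<in> X \<Longrightarrow> cstar_eq Y T (\<rho> x) (\<sigma> x)"
  shows "induced_hom X R Y T \<rho> = induced_hom X R Y T \<sigma>"
proof -
  interpret \<rho>: presentation_hom X R Y T \<rho> by fact
  interpret \<sigma>: presentation_hom X R Y T \<sigma> by fact
  show ?thesis
  proof (rule \<sigma>.ind_unique[OF \<rho>.star_hom_ind \<rho>.ind_extensional, where K = 1])
    fix x assume "x \<in> X"
    then show "\<rho>.ind (\<rho>.dom.cls (\<lambda>_. gen x)) = \<rho>.cod.cls (\<lambda>_. \<sigma> x)"
      using \<rho>.cod.cls_const_eqI[OF eq] by (simp add: \<rho>.ind_cls_const gen_in_free)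
  qed (simp add: \<rho>.cnorm_ind_le)
qed

lemma presentation_hom_comp:
  assumes "presentation_hom X R Y T \<rho>" "presentation_hom Y T Z W \<sigma>"
    and R: "R \<subseteq> free_star_algebra X"
  shows "presentation_hom X R Z W (\<lambda>x. star_subst \<sigma> (\<rho> x))"
proof -
  interpret \<rho>: presentation_hom X R Y T \<rho> by fact
  interpret \<sigma>: presentation_hom Y T Z W \<sigma> by fact
  show ?thesis
  proof
    show "(\<lambda>x. star_subst \<sigma> (\<rho> x)) ` X \<subseteq> free_star_algebra Z"
      using \<rho>.gen_in \<sigma>.subst_in_free by blast
    fix r assume r: "r \<in> R"
    then have fr: "star_subst \<rho> r \<in> free_star_algebra Y" using R \<rho>.subst_in_free by blast
    show "\<sigma>.cod.N (star_subst (\<lambda>x. star_subst \<sigma> (\<rho> x)) r) = 0"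
      using \<sigma>.N_subst_le[OF fr] \<rho>.rel_zero[OF r]
        \<sigma>.cod.universal_seminorm_nonneg[OF \<sigma>.subst_in_free[OF fr]]
      by (simp add: star_subst_comp)
  qed
qed

lemma induced_hom_comp:
  assumes "presentation_hom X R Y T \<rho>" "presentation_hom Y T Z W \<sigma>"
    and R: "R \<subseteq> free_star_algebra X" and A: "A \<in> carrier (universal_cstar X R)"
  shows "induced_hom Y T Z W \<sigma> (induced_hom X R Y T \<rho> A) =
    induced_hom X R Z W (\<lambda>x. star_subst \<sigma> (\<rho> x)) A"
proof -
  interpret \<rho>: presentation_hom X R Y T \<rho> by fact
  interpret \<sigma>: presentation_hom Y T Z W \<sigma> by fact
  interpret \<tau>: presentation_hom X R Z W "\<lambda>x. star_subst \<sigma> (\<rho> x)"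
    by (rule presentation_hom_comp) fact+
  obtain x where "x \<in> cauchy_seqs X R" "A = \<rho>.dom.cls x"
    using A by (auto simp: \<rho>.dom.carrier_universal_cstar)
  then show ?thesis
    by (simp add: \<rho>.ind_cls \<sigma>.ind_cls \<tau>.ind_cls \<rho>.subst_in_cauchy_seqs star_subst_comp)
qed

text \<open>Agreement with the identity on generators passes to every term of a representing
  sequence up to seminorm \<open>0\<close>, so the class is unchanged.\<close>

lemma induced_hom_inverse:
  assumes "presentation_hom X R Y T \<rho>" "presentation_hom Y T X R \<sigma>"
    and eq: "\<And>x. x \<in> X \<Longrightarrow> cstar_eq X R (star_subst \<sigma> (\<rho> x)) (gen x)"
    and A: "A \<in> carrier (universal_cstar X R)"
  shows "induced_hom Y T X R \<sigma> (induced_hom X R Y T \<rho> A) = A"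
proof -
  interpret \<rho>: presentation_hom X R Y T \<rho> by fact
  interpret \<sigma>: presentation_hom Y T X R \<sigma> by fact
  obtain x where x: "x \<in> cauchy_seqs X R" "A = \<rho>.dom.cls x"
    using A by (auto simp: \<rho>.dom.carrier_universal_cstar)
  note fx = \<rho>.dom.cauchy_seqs_in_free[OF x(1)]
  have "\<rho>.dom.eq (star_subst \<sigma> (star_subst \<rho> (x n))) (x n)" for n
    using \<rho>.dom.star_subst_cong[OF fx, where \<rho> = "\<lambda>x. star_subst \<sigma> (\<rho> x)" and \<sigma> = gen] eq
    by (simp add: star_subst_comp star_subst_id[OF fx])
  then have "(\<lambda>n. star_subst \<sigma> (star_subst \<rho> (x n)), x) \<in> seq_equiv X R"
    using \<sigma>.subst_in_cauchy_seqs[OF \<rho>.subst_in_cauchy_seqs[OF x(1)]] x(1)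
    by (simp add: seq_equiv_def cstar_eq_def)
  then have "\<rho>.dom.cls (\<lambda>n. star_subst \<sigma> (star_subst \<rho> (x n))) = A"
    using \<rho>.dom.cls_eqI x(2) by blast
  then show ?thesis
    using x by (simp add: \<rho>.ind_cls \<sigma>.ind_cls \<rho>.subst_in_cauchy_seqs)
qed


section \<open>Relations in graph C*-algebras\<close>

locale graph_algebra =
  fixes E :: "('v, 'e) pre_digraph"
  assumes wf: "wf_digraph E"
begin

lemma tail_in_verts: "e \<in> arcs E \<Longrightarrow> tail E e \<in> verts E"
  and head_in_verts: "e \<in> arcs E \<Longrightarrow> head E e \<in> verts E"
  using wf by (auto simp: wf_digraph_def)

lemma V_in_free: "v \<in> verts E \<Longrightarrow> V v \<in> free_star_algebra (graph_gens E)"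
  and D_in_free: "e \<in> arcs E \<Longrightarrow> D e \<in> free_star_algebra (graph_gens E)"
  by (auto simp: graph_gens_def intro: gen_in_free)

lemma reg_in_verts: "v \<in> reg E \<Longrightarrow> v \<in> verts E"
  by (simp add: reg_def)

lemma graph_rels_cases:
  assumes "r \<in> graph_rels E"
  obtains (VV) u v where "u \<in> verts E" "v \<in> verts E" "r = V u * V v - (if u = v then V v else 0)"
    | (VS) v where "v \<in> verts E" "r = poly_star (V v) - V v"
    | (DD) e e' where "e \<in> arcs E" "e' \<in> arcs E"
        "r = poly_star (D e) * D e' - (if e = e' then V (head E e) else 0)"
    | (VD) e where "e \<in> arcs E" "r = V (tail E e) * D e - D e"
    | (CK) v where "v \<in> reg E" "r = V v - (\<Sum>e\<in>out_arcs E v. D e * poly_star (D e))"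
  using assms unfolding graph_rels_def by blast

lemma
  shows VV_in_rels: "u \<in> verts E \<Longrightarrow> v \<in> verts E \<Longrightarrow>
      V u * V v - (if u = v then V v else 0) \<in> graph_rels E"
    and VS_in_rels: "v \<in> verts E \<Longrightarrow> poly_star (V v) - V v \<in> graph_rels E"
    and DD_in_rels: "e \<in> arcs E \<Longrightarrow> e' \<in> arcs E \<Longrightarrow>
      poly_star (D e) * D e' - (if e = e' then V (head E e) else 0) \<in> graph_rels E"
    and VD_in_rels: "e \<in> arcs E \<Longrightarrow> V (tail E e) * D e - D e \<in> graph_rels E"
    and CK_in_rels: "v \<in> reg E \<Longrightarrow>
      V v - (\<Sum>e\<in>out_arcs E v. D e * poly_star (D e)) \<in> graph_rels E"
  unfolding graph_rels_def by blast+

lemma graph_rels_in_free: "graph_rels E \<subseteq> free_star_algebra (graph_gens E)"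
proof
  fix r assume "r \<in> graph_rels E"
  then show "r \<in> free_star_algebra (graph_gens E)"
    by (cases rule: graph_rels_cases)
      (auto intro!: diff_in_free sum_in_free mult_in_free poly_star_in_free V_in_free D_in_free
        tail_in_verts head_in_verts simp: reg_in_verts)
qed

text \<open>Modulo relations \<open>S_v^* S_v\<close> is \<open>S_v\<close> and
  \<open>S_e^* S_e\<close> is the projection of the target, so the C*-identity bounds the square of
  \<open>p (V v)\<close> by \<open>p (V v)\<close> and that of \<open>p (D e)\<close> by
  \<open>1\<close>. The argument treats one seminorm \<open>p\<close> at a time, as finiteness of
  their supremum is what it is meant to establish.\<close>

lemma
  assumes "p \<in> presentation_seminorms (graph_gens E) (graph_rels E)"
  shows seminorm_V_le: "v \<in> verts E \<Longrightarrow> p (V v) \<le> 1"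
    and seminorm_D_le: "e \<in> arcs E \<Longrightarrow> p (D e) \<le> 1"
proof -
  from assms have p: "cstar_seminorm (graph_gens E) p" and rel: "\<And>r. r \<in> graph_rels E \<Longrightarrow> p r = 0"
    by (auto simp: presentation_seminorms_def)
  show V: "p (V v) \<le> 1" if v: "v \<in> verts E" for v
  proof -
    note fv = V_in_free[OF v]
    have zero: "p (poly_star (V v) - V v) = 0" "p (V v * V v - V v) = 0"
      using rel[OF VS_in_rels[OF v]] rel[OF VV_in_rels[OF v v]] by simp_all
    \<comment> \<open>The two relators are isolated as summands, where \<open>p\<close> vanishes,
      leaving just \<open>V v\<close>.\<close>
    have "poly_star (V v) * V v = (poly_star (V v) - V v) * V v + ((V v * V v - V v) + V v)"
      by (simp add: algebra_simps)
    then have "p (poly_star (V v) * V v) = p ((poly_star (V v) - V v) * V v + ((V v * V v - V v) + V v))"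
      by (rule arg_cong)
    also have "\<dots> \<le> p ((poly_star (V v) - V v) * V v) + p ((V v * V v - V v) + V v)"
      using fv by (intro cstar_seminorm_add[OF p]) (auto intro!: add_in_free diff_in_free mult_in_free)
    also have "\<dots> \<le> p (poly_star (V v) - V v) * p (V v) + (p (V v * V v - V v) + p (V v))"
      using fv by (intro add_mono cstar_seminorm_add[OF p] cstar_seminorm_mult[OF p])
        (simp_all add: add_in_free diff_in_free mult_in_free poly_star_in_free)
    finally have "(p (V v))\<^sup>2 \<le> p (V v)"
      using zero cstar_seminorm_star_mult[OF p fv] by simp
    then have "p (V v) * p (V v) \<le> 1 * p (V v)" by (simp add: power2_eq_square)
    then show ?thesis using cstar_seminorm_nonneg[OF p fv] by (cases "p (V v) = 0") auto
  qed
  assume e: "e \<in> arcs E"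
  note fe = D_in_free[OF e] V_in_free[OF head_in_verts[OF e]]
  have zero: "p (poly_star (D e) * D e - V (head E e)) = 0"
    using rel[OF DD_in_rels[OF e e]] by simp
  have "(p (D e))\<^sup>2 = p ((poly_star (D e) * D e - V (head E e)) + V (head E e))"
    using cstar_seminorm_star_mult[OF p fe(1)] by simp
  also have "\<dots> \<le> p (poly_star (D e) * D e - V (head E e)) + p (V (head E e))"
    using fe by (intro cstar_seminorm_add[OF p]) (simp_all add: diff_in_free mult_in_free poly_star_in_free)
  also have "\<dots> \<le> 1" using zero V[OF head_in_verts[OF e]] by simp
  finally show "p (D e) \<le> 1" using power2_le_imp_le[of "p (D e)" 1] by simp
qed

end

sublocale graph_algebra \<subseteq> bounded_presentation "graph_gens E" "graph_rels E"
proof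
  fix x assume "x \<in> graph_gens E"
  then have "(\<exists>v\<in>verts E. x = Inl v) \<or> (\<exists>e\<in>arcs E. x = Inr e)"
    by (auto simp: graph_gens_def)
  then show "\<exists>K. \<forall>p\<in>presentation_seminorms (graph_gens E) (graph_rels E). p (gen x) \<le> K"
    using seminorm_V_le seminorm_D_le by blast
qed

context graph_algebra
begin

lemmas free_intros = add_in_free diff_in_free mult_in_free poly_star_in_free sum_in_free
  V_in_free D_in_free head_in_verts tail_in_verts

lemma eq_mult_left: "eq b c \<Longrightarrow> a \<in> Fr \<Longrightarrow> eq (a * b) (a * c)"
  by (intro eq_mult eq_refl)

lemma eq_mult_right: "eq b c \<Longrightarrow> a \<in> Fr \<Longrightarrow> eq (b * a) (c * a)"
  by (intro eq_mult eq_refl)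

lemma eq_rel_diff:
  assumes "a - b \<in> graph_rels E" "a \<in> Fr" "b \<in> Fr"
  shows "eq a b"
  using assms universal_seminorm_rel[OF assms(1)] by (simp add: cstar_eq_def)

lemma V_mult_V:
  assumes "u \<in> verts E" "v \<in> verts E"
  shows "eq (V u * V v) (if u = v then V v else 0)"
  by (rule eq_rel_diff[OF VV_in_rels]) (use assms in \<open>auto intro!: free_intros\<close>)

lemma star_V: "v \<in> verts E \<Longrightarrow> eq (poly_star (V v)) (V v)"
  by (rule eq_rel_diff[OF VS_in_rels]) (auto intro!: free_intros)

lemma star_D_mult_D:
  assumes "e \<in> arcs E" "e' \<in> arcs E"
  shows "eq (poly_star (D e) * D e') (if e = e' then V (head E e) else 0)"
  by (rule eq_rel_diff[OF DD_in_rels]) (use assms in \<open>auto intro!: free_intros\<close>)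

lemma V_tail_mult_D: "e \<in> arcs E \<Longrightarrow> eq (V (tail E e) * D e) (D e)"
  by (rule eq_rel_diff[OF VD_in_rels]) (auto intro!: free_intros)

lemma Cuntz_Krieger:
  "v \<in> reg E \<Longrightarrow> eq (V v) (\<Sum>e\<in>out_arcs E v. D e * poly_star (D e))"
  by (rule eq_rel_diff[OF CK_in_rels]) (auto simp: reg_in_verts intro!: free_intros)

lemma V_mult_D:
  assumes u: "u \<in> verts E" and e: "e \<in> arcs E"
  shows "eq (V u * D e) (if u = tail E e then D e else 0)"
proof -
  note fr = V_in_free[OF u] D_in_free[OF e] V_in_free[OF tail_in_verts[OF e]]
  have "eq (V u * D e) (V u * (V (tail E e) * D e))"
    by (intro eq_mult_left eq_sym[OF V_tail_mult_D] e fr)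
  also have "V u * (V (tail E e) * D e) = V u * V (tail E e) * D e" by (simp add: mult.assoc)
  also have "eq \<dots> ((if u = tail E e then V (tail E e) else 0) * D e)"
    by (intro eq_mult_right V_mult_V u tail_in_verts e fr)
  also have "eq \<dots> (if u = tail E e then D e else 0)"
    using V_tail_mult_D[OF e] by (simp add: eq_refl)
  finally show ?thesis .
qed

text \<open>This is not among the defining relations: it holds because \<open>a = S\<^sub>e S\<^sub>v - S\<^sub>e\<close>, with \<open>v\<close> the
  target of \<open>e\<close>, satisfies \<open>a\<^sup>*a = 0\<close>.\<close>

lemma D_mult_V_head:
  assumes e: "e \<in> arcs E"
  shows "eq (D e * V (head E e)) (D e)"
proof -
  let ?v = "V (head E e)"
  let ?a = "D e * ?v - D e"
  note fv = V_in_free[OF head_in_verts[OF e]] and fe = D_in_free[OF e]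
  note fr = fv fe poly_star_in_free[OF fv] poly_star_in_free[OF fe]
  have fa: "?a \<in> Fr" using fr by blast
  have sDD: "eq (poly_star (D e) * D e) ?v" using star_D_mult_D[OF e e] by simp
  have vv: "eq (?v * ?v) ?v" using V_mult_V[OF head_in_verts[OF e] head_in_verts[OF e]] by simp
  have sv: "eq (poly_star ?v) ?v" by (rule star_V[OF head_in_verts[OF e]])
  have "eq (poly_star (D e) * ?a) (?v * ?v - ?v)"
    using eq_diff[OF eq_mult_right[OF sDD fv] sDD] by (simp add: algebra_simps)
  also have "eq (?v * ?v - ?v) (?v - ?v)" by (intro eq_diff vv eq_refl fv)
  finally have "eq (poly_star (D e) * ?a) 0" by simp
  \<comment> \<open>\<open>poly_star ?a\<close> is
    \<open>(poly_star ?v - 1) * poly_star (D e)\<close>. The unit is not in the free *-algebra and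
    only abbreviates a difference of two products.\<close>
  then have "eq ((poly_star ?v - 1) * (poly_star (D e) * ?a)) 0"
    using eq_diff[OF eq_mult_left[OF _ fr(3)]] by (fastforce simp: left_diff_distrib)
  then have "eq (poly_star ?a * ?a) 0"
    by (simp add: poly_star_diff poly_star_mult left_diff_distrib mult.assoc)
  from eq_star_mult_zero[OF fa this] show ?thesis
    using fr by (subst eq_zero_iff) blast
qed

lemma D_mult_V:
  assumes u: "u \<in> verts E" and e: "e \<in> arcs E"
  shows "eq (D e * V u) (if u = head E e then D e else 0)"
proof -
  note fr = V_in_free[OF u] D_in_free[OF e] V_in_free[OF head_in_verts[OF e]]
  have "eq (D e * V u) (D e * V (head E e) * V u)"
    by (intro eq_mult_right eq_sym[OF D_mult_V_head] e fr)
  also have "\<dots> = D e * (V (head E e) * V u)" by (simp add: mult.assoc)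
  also have "eq \<dots> (D e * (if head E e = u then V u else 0))"
    by (intro eq_mult_left V_mult_V u head_in_verts e fr)
  also have "eq \<dots> (if u = head E e then D e else 0)"
    using D_mult_V_head[OF e] by (auto simp: eq_refl)
  finally show ?thesis .
qed

lemma star_D_mult_V:
  assumes u: "u \<in> verts E" and e: "e \<in> arcs E"
  shows "eq (poly_star (D e) * V u) (if u = tail E e then poly_star (D e) else 0)"
proof -
  have "eq (poly_star (D e) * V u) (poly_star (D e) * poly_star (V u))"
    by (intro eq_mult_left eq_sym[OF star_V] u poly_star_in_free D_in_free e)
  also have "eq \<dots> (if u = tail E e then poly_star (D e) else 0)"
    using eq_star[OF V_mult_D[OF u e]] by (simp add: poly_star_mult split: if_splits)
  finally show ?thesis .
qed

lemma V_mult_star_D: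
  assumes u: "u \<in> verts E" and e: "e \<in> arcs E"
  shows "eq (V u * poly_star (D e)) (if u = head E e then poly_star (D e) else 0)"
proof -
  have "eq (V u * poly_star (D e)) (poly_star (V u) * poly_star (D e))"
    by (intro eq_mult_right eq_sym[OF star_V] u poly_star_in_free D_in_free e)
  also have "eq \<dots> (if u = head E e then poly_star (D e) else 0)"
    using eq_star[OF D_mult_V[OF u e]] by (simp add: poly_star_mult split: if_splits)
  finally show ?thesis .
qed

lemma D_mult_star_D_zero:
  assumes e: "e \<in> arcs E" "e' \<in> arcs E" and ne: "head E e \<noteq> head E e'"
  shows "eq (D e * poly_star (D e')) 0"
proof -
  note fr = D_in_free[OF e(1)] poly_star_in_free[OF D_in_free[OF e(2)]]
  have "eq (D e * poly_star (D e')) (D e * V (head E e) * poly_star (D e'))"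
    by (intro eq_mult_right eq_sym[OF D_mult_V_head] e fr)
  also have "\<dots> = D e * (V (head E e) * poly_star (D e'))" by (simp add: mult.assoc)
  also have "eq \<dots> (D e * 0)"
    using V_mult_star_D[OF head_in_verts[OF e(1)] e(2)] ne by (intro eq_mult_left fr) simp
  finally show ?thesis by simp
qed

end

section \<open>The universal property of graph C*-algebras\<close>

lemma graph_presentation_homI:
  assumes E: "graph_algebra E" and F: "graph_algebra F"
    and fr: "\<And>x. x \<in> graph_gens E \<Longrightarrow> \<rho> x \<in> free_star_algebra (graph_gens F)"
    and VV: "\<And>u v. u \<in> verts E \<Longrightarrow> v \<in> verts E \<Longrightarrow>
      cstar_eq (graph_gens F) (graph_rels F) (\<rho> (Inl u) * \<rho> (Inl v)) (if u = v then \<rho> (Inl v) else 0)"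
    and VS: "\<And>v. v \<in> verts E \<Longrightarrow>
      cstar_eq (graph_gens F) (graph_rels F) (poly_star (\<rho> (Inl v))) (\<rho> (Inl v))"
    and DD: "\<And>e e'. e \<in> arcs E \<Longrightarrow> e' \<in> arcs E \<Longrightarrow> cstar_eq (graph_gens F) (graph_rels F)
      (poly_star (\<rho> (Inr e)) * \<rho> (Inr e')) (if e = e' then \<rho> (Inl (head E e)) else 0)"
    and VD: "\<And>e. e \<in> arcs E \<Longrightarrow>
      cstar_eq (graph_gens F) (graph_rels F) (\<rho> (Inl (tail E e)) * \<rho> (Inr e)) (\<rho> (Inr e))"
    and CK: "\<And>v. v \<in> reg E \<Longrightarrow> cstar_eq (graph_gens F) (graph_rels F)
      (\<rho> (Inl v)) (\<Sum>e\<in>out_arcs E v. \<rho> (Inr e) * poly_star (\<rho> (Inr e)))"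
  shows "presentation_hom (graph_gens E) (graph_rels E) (graph_gens F) (graph_rels F) \<rho>"
proof -
  interpret E: graph_algebra E by fact
  interpret F: graph_algebra F by fact
  show ?thesis
  proof
    show "\<rho> ` graph_gens E \<subseteq> free_star_algebra (graph_gens F)" using fr by blast
    fix r assume "r \<in> graph_rels E"
    then show "F.N (star_subst \<rho> r) = 0"
    proof (cases rule: E.graph_rels_cases)
      case (VV u v)
      then show ?thesis using assms(4)[of u v]
        by (auto simp: star_subst_diff star_subst_mult cstar_eq_def split: if_splits)
    next
      case (VS v)
      then show ?thesis using assms(5)[of v]
        by (auto simp: star_subst_diff star_subst_star cstar_eq_def)
    next
      case (DD e e')
      then show ?thesis using assms(6)[of e e']
        by (auto simp: star_subst_diff star_subst_mult star_subst_star cstar_eq_def split: if_splits)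
    next
      case (VD e)
      then show ?thesis using assms(7)[of e]
        by (auto simp: star_subst_diff star_subst_mult cstar_eq_def)
    next
      case (CK v)
      then show ?thesis using assms(8)[of v]
        by (auto simp: star_subst_diff star_subst_mult star_subst_star star_subst_sum cstar_eq_def)
    qed
  qed
qed

text \<open>Replaces the definite description by a concrete map: existence holds with norm bound
  \<open>1\<close>, and uniqueness is \<open>ind_unique\<close>.\<close>

lemma universal_hom_eq_induced_hom:
  assumes "presentation_hom (graph_gens E) (graph_rels E) (graph_gens F) (graph_rels F) \<rho>"
    and "\<And>v. v \<in> verts E \<Longrightarrow> P v = poly_class F (\<rho> (Inl v))"
    and "\<And>e. e \<in> arcs E \<Longrightarrow> Q e = poly_class F (\<rho> (Inr e))"
  shows "universal_hom E (graph_cstar F) P Q =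
    induced_hom (graph_gens E) (graph_rels E) (graph_gens F) (graph_rels F) \<rho>"
proof -
  interpret presentation_hom "graph_gens E" "graph_rels E" "graph_gens F" "graph_rels F" \<rho> by fact
  have ind_gen: "ind (poly_class E (gen x)) = poly_class F (\<rho> x)" if "x \<in> graph_gens E" for x
    using ind_cls_const[OF gen_in_free[OF that]] by (simp add: poly_class_def)
  have gens: "v \<in> verts E \<Longrightarrow> Inl v \<in> graph_gens E" "e \<in> arcs E \<Longrightarrow> Inr e \<in> graph_gens E" for v e
    by (auto simp: graph_gens_def)
  show ?thesis
    unfolding universal_hom_def
  proof (rule the_equality)
    show "ind \<in> extensional (carrier (graph_cstar E)) \<and> star_hom (graph_cstar E) (graph_cstar F) ind \<and>
        (\<exists>K. \<forall>a\<in>carrier (graph_cstar E). cnorm (graph_cstar F) (ind a) \<le> K * cnorm (graph_cstar E) a) \<and>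
        (\<forall>v\<in>verts E. ind (poly_class E (V v)) = P v) \<and> (\<forall>e\<in>arcs E. ind (poly_class E (D e)) = Q e)"
      using ind_extensional star_hom_ind cnorm_ind_le assms(2,3)
      by (auto simp: graph_cstar_def ind_gen gens intro!: exI[of _ 1])
  next
    fix h
    assume h: "h \<in> extensional (carrier (graph_cstar E)) \<and> star_hom (graph_cstar E) (graph_cstar F) h \<and>
        (\<exists>K. \<forall>a\<in>carrier (graph_cstar E). cnorm (graph_cstar F) (h a) \<le> K * cnorm (graph_cstar E) a) \<and>
        (\<forall>v\<in>verts E. h (poly_class E (V v)) = P v) \<and> (\<forall>e\<in>arcs E. h (poly_class E (D e)) = Q e)"
    then obtain K where K: "\<And>a. a \<in> carrier (graph_cstar E) \<Longrightarrow>
        cnorm (graph_cstar F) (h a) \<le> K * cnorm (graph_cstar E) a" by blast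
    have "h (poly_class E (gen x)) = poly_class F (\<rho> x)" if "x \<in> graph_gens E" for x
      using that h assms(2,3) by (auto simp: graph_gens_def)
    then show "h = ind"
      using h K by (intro ind_unique[where K = K]) (auto simp: graph_cstar_def poly_class_def)
  qed
qed


section \<open>Pullback along admissible graph homomorphisms\<close>

definition pullback_gen ::
  "('v, 'e) pre_digraph \<Rightarrow> ('v, 'e, 'v1, 'e1) graph_map \<Rightarrow> 'v1 + 'e1 \<Rightarrow> ('v + 'e) star_poly" where
  "pullback_gen H g =
    case_sum (\<lambda>v. \<Sum>u\<in>vfiber H g v. V u) (\<lambda>e. \<Sum>x\<in>efiber H g e. D x)"

lemma (in graph_algebra) eq_sum_single:
  assumes "finite S" "\<And>i. i \<in> S \<Longrightarrow> eq (f i) (if i = j then c else 0)" "c \<in> Fr"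
  shows "eq (sum f S) (if j \<in> S then c else 0)"
proof -
  have "eq (sum f S) (\<Sum>i\<in>S. if i = j then c else 0)" by (intro eq_sum assms)
  then show ?thesis using assms(1) by simp
qed

text \<open>Finite fibers make the sums meaningful. Bijectivity of the target map on the fiber of
  \<open>e\<close> turns \<open>S_e^* S_e\<close> into the sum over the fiber of the target, and its
  injectivity kills the mixed terms of \<open>S_e S_e^*\<close>, whose edges have different targets.
  The condition on regular vertices supplies a Cuntz-Krieger relation at each vertex above a regular
  one.\<close>

lemma presentation_hom_pullback:
  assumes H: "graph_algebra H" and F: "graph_algebra F" and g: "admissible H F g"
  shows "presentation_hom (graph_gens F) (graph_rels F) (graph_gens H) (graph_rels H) (pullback_gen H g)"
proof -
  interpret H: graph_algebra H by fact
  interpret F: graph_algebra F by fact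
  let ?P = "\<lambda>v. \<Sum>u\<in>vfiber H g v. V u" and ?Q = "\<lambda>e. \<Sum>x\<in>efiber H g e. D x"
  have hom: "graph_hom H F g"
    and fv: "\<And>v. v \<in> verts F \<Longrightarrow> finite (vfiber H g v)"
    and fe: "\<And>e. e \<in> arcs F \<Longrightarrow> finite (efiber H g e)"
    and bij: "\<And>x. x \<in> arcs F \<Longrightarrow> bij_betw (head H) (efiber H g x) (vfiber H g (head F x))"
    and regular: "\<And>u. u \<in> verts H \<Longrightarrow> fst g u \<in> reg F \<Longrightarrow> u \<in> reg H"
    using g by (auto simp: admissible_def)
  have vf: "u \<in> verts H" "fst g u = v" if "u \<in> vfiber H g v" for u v
    using that by (auto simp: vfiber_def)
  have ef: "x \<in> arcs H" "snd g x = e" if "x \<in> efiber H g e" for x e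
    using that by (auto simp: efiber_def)
  have Pfr: "?P v \<in> H.Fr" for v by (intro sum_in_free H.V_in_free vf)
  have Qfr: "?Q e \<in> H.Fr" for e by (intro sum_in_free H.D_in_free ef)
  have star_P: "poly_star (?P v) = (\<Sum>u\<in>vfiber H g v. poly_star (V u))"
    and star_Q: "poly_star (?Q e) = (\<Sum>x\<in>efiber H g e. poly_star (D x))" for v e
    by (simp_all add: poly_star_sum)
  have mult_P: "H.eq (V u * ?P v) (if u \<in> vfiber H g v then V u else 0)"
    if u: "u \<in> verts H" and v: "v \<in> verts F" for u v
  proof -
    have "H.eq (V u * V u') (if u' = u then V u else 0)" if "u' \<in> vfiber H g v" for u'
      using H.V_mult_V[OF u vf(1)[OF that]] by (cases "u' = u") auto
    then have "H.eq (\<Sum>u'\<in>vfiber H g v. V u * V u') (if u \<in> vfiber H g v then V u else 0)"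
      by (intro H.eq_sum_single fv v H.V_in_free u)
    then show ?thesis by (simp add: sum_distrib_left)
  qed
  have PP: "H.eq (?P u * ?P v) (if u = v then ?P v else 0)" if u: "u \<in> verts F" and v: "v \<in> verts F" for u v
  proof -
    have "H.eq (\<Sum>a\<in>vfiber H g u. V a * ?P v) (\<Sum>a\<in>vfiber H g u. if a \<in> vfiber H g v then V a else 0)"
      using vf by (intro H.eq_sum mult_P v)
    also have "(\<Sum>a\<in>vfiber H g u. if a \<in> vfiber H g v then V a else 0) = (if u = v then ?P v else 0)"
      by (cases "u = v") (auto simp: vfiber_def intro!: sum.neutral)
    finally show ?thesis by (simp add: sum_distrib_right)
  qed
  have PS: "H.eq (poly_star (?P v)) (?P v)" for v
    unfolding star_P by (intro H.eq_sum H.star_V vf)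
  have QQ: "H.eq (poly_star (?Q e) * ?Q e') (if e = e' then ?P (head F e) else 0)"
    if e: "e \<in> arcs F" and e': "e' \<in> arcs F" for e e'
  proof -
    have "H.eq (poly_star (D x) * ?Q e') (if x \<in> efiber H g e' then V (head H x) else 0)"
      if x: "x \<in> efiber H g e" for x
    proof -
      have "H.eq (poly_star (D x) * D x') (if x' = x then V (head H x) else 0)"
        if "x' \<in> efiber H g e'" for x'
        using H.star_D_mult_D[OF ef(1)[OF x] ef(1)[OF that]] by (cases "x' = x") auto
      then have "H.eq (\<Sum>x'\<in>efiber H g e'. poly_star (D x) * D x')
          (if x \<in> efiber H g e' then V (head H x) else 0)"
        by (intro H.eq_sum_single fe e' H.V_in_free H.head_in_verts ef(1)[OF x])
      then show ?thesis by (simp add: sum_distrib_left)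
    qed
    then have "H.eq (\<Sum>x\<in>efiber H g e. poly_star (D x) * ?Q e')
        (\<Sum>x\<in>efiber H g e. if x \<in> efiber H g e' then V (head H x) else 0)"
      by (rule H.eq_sum)
    also have "(\<Sum>x\<in>efiber H g e. if x \<in> efiber H g e' then V (head H x) else 0) =
        (if e = e' then \<Sum>x\<in>efiber H g e. V (head H x) else 0)"
      by (cases "e = e'") (auto simp: efiber_def intro!: sum.neutral)
    also have "(\<Sum>x\<in>efiber H g e. V (head H x)) = ?P (head F e)"
      using sum.reindex_bij_betw[OF bij[OF e], of V] .
    finally show ?thesis unfolding star_Q by (simp add: sum_distrib_right)
  qed
  have PQ: "H.eq (?P (tail F e) * ?Q e) (?Q e)" if e: "e \<in> arcs F" for e
  proof -
    have "H.eq (?P (tail F e) * D x) (D x)" if x: "x \<in> efiber H g e" for x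
    proof -
      have "tail H x \<in> vfiber H g (tail F e)"
        using hom ef[OF x] H.tail_in_verts by (auto simp: graph_hom_def vfiber_def)
      moreover have "H.eq (\<Sum>u\<in>vfiber H g (tail F e). V u * D x)
          (if tail H x \<in> vfiber H g (tail F e) then D x else 0)"
        by (intro H.eq_sum_single H.V_mult_D fv F.tail_in_verts e H.D_in_free ef(1)[OF x] vf(1))
      ultimately show ?thesis by (simp add: sum_distrib_right)
    qed
    then have "H.eq (\<Sum>x\<in>efiber H g e. ?P (tail F e) * D x) (?Q e)"
      by (rule H.eq_sum)
    then show ?thesis by (simp add: sum_distrib_left)
  qed
  have CK: "H.eq (?P v) (\<Sum>e\<in>out_arcs F v. ?Q e * poly_star (?Q e))" if v: "v \<in> reg F" for v
  proof -
    have QS: "H.eq (?Q e * poly_star (?Q e)) (\<Sum>x\<in>efiber H g e. D x * poly_star (D x))"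
      if e: "e \<in> arcs F" for e
    proof -
      have "H.eq (D x * poly_star (?Q e)) (D x * poly_star (D x))" if x: "x \<in> efiber H g e" for x
      proof -
        have "H.eq (D x * poly_star (D x')) (if x' = x then D x * poly_star (D x) else 0)"
          if x': "x' \<in> efiber H g e" for x'
        proof (cases "x' = x")
          case True
          then show ?thesis using ef(1)[OF x] by (auto intro!: H.eq_refl H.free_intros)
        next
          case False
          then have "head H x \<noteq> head H x'"
            using bij[OF e] x x' by (auto simp: bij_betw_def dest: inj_onD)
          then show ?thesis using False H.D_mult_star_D_zero ef(1) x x' by simp
        qed
        then have "H.eq (\<Sum>x'\<in>efiber H g e. D x * poly_star (D x'))
            (if x \<in> efiber H g e then D x * poly_star (D x) else 0)"
          using ef(1)[OF x] by (intro H.eq_sum_single fe e H.free_intros) auto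
        then show ?thesis using x unfolding star_Q by (simp add: sum_distrib_left)
      qed
      then have "H.eq (\<Sum>x\<in>efiber H g e. D x * poly_star (?Q e)) (\<Sum>x\<in>efiber H g e. D x * poly_star (D x))"
        by (rule H.eq_sum)
      then show ?thesis by (simp add: sum_distrib_right)
    qed
    have regH: "u \<in> reg H" if "u \<in> vfiber H g v" for u
      using that regular v by (auto simp: vfiber_def)
    have "H.eq (?P v) (\<Sum>u\<in>vfiber H g v. \<Sum>x\<in>out_arcs H u. D x * poly_star (D x))"
      by (intro H.eq_sum H.Cuntz_Krieger regH)
    also have "\<dots> = (\<Sum>x\<in>(\<Union>u\<in>vfiber H g v. out_arcs H u). D x * poly_star (D x))"
      using v regH by (intro sum.UNION_disjoint[symmetric]) (auto simp: reg_def fv)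
    \<comment> \<open>Both sides collect the edges of \<open>H\<close> whose image starts at
      \<open>v\<close>, grouped once by source and once by image.\<close>
    also have "(\<Union>u\<in>vfiber H g v. out_arcs H u) = (\<Union>e\<in>out_arcs F v. efiber H g e)"
      using hom H.tail_in_verts by (auto simp: graph_hom_def vfiber_def efiber_def)
    also have "(\<Sum>x\<in>\<dots>. D x * poly_star (D x)) =
        (\<Sum>e\<in>out_arcs F v. \<Sum>x\<in>efiber H g e. D x * poly_star (D x))"
    proof (rule sum.UNION_disjoint)
      show "\<forall>i\<in>out_arcs F v. \<forall>j\<in>out_arcs F v. i \<noteq> j \<longrightarrow> efiber H g i \<inter> efiber H g j = {}"
        by (auto simp: efiber_def)
    qed (use v in \<open>auto simp: reg_def fe\<close>)
    also have "H.eq \<dots> (\<Sum>e\<in>out_arcs F v. ?Q e * poly_star (?Q e))"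
      by (intro H.eq_sum, rule H.eq_sym) (simp add: QS)
    finally show ?thesis .
  qed
  show ?thesis
  proof (rule graph_presentation_homI[OF F H])
    fix x show "pullback_gen H g x \<in> H.Fr"
      using Pfr Qfr by (cases x) (simp_all add: pullback_gen_def)
  qed (simp_all only: pullback_gen_def sum.case PP PS QQ PQ CK)
qed

lemma graph_hom_pullback_eq:
  assumes "graph_algebra H" "graph_algebra F" "admissible H F g"
  shows "graph_hom_pullback H F g =
    induced_hom (graph_gens F) (graph_rels F) (graph_gens H) (graph_rels H) (pullback_gen H g)"
  unfolding graph_hom_pullback_def
  by (rule universal_hom_eq_induced_hom[OF presentation_hom_pullback[OF assms]])
    (simp_all add: pullback_gen_def)

context graph_algebra
begin

lemma eq_star_D_mult_D_mid:
  assumes "e \<in> arcs E" "e' \<in> arcs E" "a \<in> Fr" "b \<in> Fr"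
  shows "eq ((a * poly_star (D e)) * (D e' * b)) (if e = e' then a * V (head E e) * b else 0)"
proof -
  have "(a * poly_star (D e)) * (D e' * b) = a * (poly_star (D e) * D e') * b" by (simp add: mult.assoc)
  also have "eq \<dots> (a * (if e = e' then V (head E e) else 0) * b)"
    using assms by (intro eq_mult_right eq_mult_left star_D_mult_D)
  also have "\<dots> = (if e = e' then a * V (head E e) * b else 0)" by simp
  finally show ?thesis .
qed

lemma D_mult_V_mult_star_D:
  assumes "e \<in> arcs E" "e' \<in> arcs E"
  shows "eq (D e * V (head E e) * poly_star (D e')) (D e * poly_star (D e'))"
  using assms by (intro eq_mult_right D_mult_V_head) (auto intro!: free_intros)

end


section \<open>The out-split graph\<close>

text \<open>The edges have the same names as those of \<open>unital_reduction E w\<close>: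
  \<open>Inr (p, y)\<close> is now the edge \<open>p_y\<close> into the copy \<open>Inr y\<close> of
  \<open>w\<close>, and at an unsplit vertex both graphs emit the same edges.\<close>

definition out_split :: "('v, 'e) pre_digraph \<Rightarrow> 'v \<Rightarrow> ('v + 'e, 'e + 'e \<times> 'e) pre_digraph" where
  "out_split E w =
    \<lparr> verts = Inl ` (verts E - {w}) \<union> Inr ` out_arcs E w,
      arcs = Inl ` (arcs E - in_arcs E w) \<union> Inr ` (in_arcs E w \<times> out_arcs E w),
      tail = case_sum (\<lambda>e. if tail E e = w then Inr e else Inl (tail E e)) (\<lambda>(p, y). Inl (tail E p)),
      head = case_sum (\<lambda>e. Inl (head E e)) (\<lambda>(p, y). Inr y) \<rparr>"

definition out_split_map :: "'v \<Rightarrow> ('v + 'e, 'e + 'e \<times> 'e, 'v, 'e) graph_map" where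
  "out_split_map w = (case_sum id (\<lambda>_. w), case_sum id fst)"

text \<open>
  The path \<open>\<alpha>\<close> of \<open>H\<close> stands for the path \<open>\<alpha>\<close> or \<open>\<alpha>y\<close> of \<open>E\<close>, the latter if \<open>\<alpha>\<close> ends at \<open>Inr y\<close>, in
  which each \<open>p\<close> into \<open>w\<close> is combined with the following \<open>y\<close> into the edge \<open>Inr (p, y)\<close>.  So an edge
  out of \<open>w\<close> survives only at the beginning, where it is determined by the source of \<open>\<alpha>\<close>.
\<close>

definition start_edges :: "'v + 'e \<Rightarrow> ('e + 'e \<times> 'e) list" where
  "start_edges = case_sum (\<lambda>_. []) (\<lambda>y. [Inl y])"

definition contract_path ::
  "('v, 'e) pre_digraph \<Rightarrow> 'v \<Rightarrow> ('v + 'e, 'e + 'e \<times> 'e) path \<Rightarrow> ('v, 'e + 'e \<times> 'e) path" where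
  "contract_path E w \<alpha> =
    (case_sum id (\<lambda>_. w) (fst \<alpha>),
     start_edges (fst \<alpha>) @ filter (case_sum (\<lambda>e. tail E e \<noteq> w) (\<lambda>_. True)) (snd \<alpha>))"

definition contract :: "('v, 'e) pre_digraph \<Rightarrow> 'v \<Rightarrow>
    ('v + 'e, 'e + 'e \<times> 'e) gis \<Rightarrow> ('v, 'e + 'e \<times> 'e) gis" where
  "contract E w = map_option (map_prod (contract_path E w) (contract_path E w))"

text \<open>Breaks an edge \<open>py\<close> of the reduction into the path \<open>p_y\<close>,
  \<open>y\<close> of the out-split graph, in order to recover a path from its contraction.\<close>

definition expand_edge :: "'e + 'e \<times> 'e \<Rightarrow> ('e + 'e \<times> 'e) list" where
  "expand_edge = case_sum (\<lambda>e. [Inl e]) (\<lambda>(p, y). [Inr (p, y), Inl y])"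

definition reduction_gen :: "'v + ('e + 'e \<times> 'e) \<Rightarrow> ('v + 'e) star_poly" where
  "reduction_gen = case_sum V (case_sum D (\<lambda>(x, y). D x * D y))"

definition reduction_inv_gen ::
  "('v, 'e) pre_digraph \<Rightarrow> 'v \<Rightarrow> 'v + 'e \<Rightarrow> ('v + ('e + 'e \<times> 'e)) star_poly" where
  "reduction_inv_gen E w =
    case_sum V (\<lambda>e. if e \<in> in_arcs E w
      then \<Sum>y\<in>out_arcs E w. D (Inr (e, y)) * poly_star (D (Inl y)) else D (Inl e))"

definition pushforward_gen :: "('v, 'e) pre_digraph \<Rightarrow> (('v, 'e) gis \<Rightarrow> ('v1, 'e1) gis) \<Rightarrow>
    'v + 'e \<Rightarrow> ('v1 + 'e1) star_poly" where
  "pushforward_gen H \<phi> =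
    case_sum (\<lambda>v. gis_poly (\<phi> (Some (vpath v, vpath v))))
      (\<lambda>e. gis_poly (\<phi> (Some (epath H e, vpath (head H e)))))"

section \<open>Products and order in the graph inverse semigroup\<close>

lemma gis_mult_neq_None_iff:
  "gis_mult (Some (\<alpha>, \<beta>)) (Some (\<gamma>, \<delta>)) \<noteq> None \<longleftrightarrow>
    fst \<beta> = fst \<gamma> \<and> (prefix (snd \<beta>) (snd \<gamma>) \<or> prefix (snd \<gamma>) (snd \<beta>))"
  by (cases \<alpha>; cases \<beta>; cases \<gamma>; cases \<delta>) auto

text \<open>Consequently regularity need only be tested on elements
  \<open>(\<alpha>, \<alpha>)\<close> with \<open>\<alpha>\<close> an extension of
  \<open>\<gamma>\<close>, which makes it a question about paths.\<close>

lemma gis_le_idempotent: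
  assumes "gis_le (Some (\<alpha>, \<beta>)) (Some (\<gamma>, \<gamma>))"
  shows "\<beta> = \<alpha>" "fst \<alpha> = fst \<gamma>" "prefix (snd \<gamma>) (snd \<alpha>)"
proof -
  obtain a p b q c r where [simp]: "\<alpha> = (a, p)" "\<beta> = (b, q)" "\<gamma> = (c, r)"
    by (metis surj_pair)
  have "gis_mult (Some ((a, p), (a, p))) (Some ((c, r), (c, r))) = Some ((a, p), (b, q))"
    using assms by (simp add: gis_le_def)
  then have "b = a \<and> q = p \<and> a = c \<and> prefix r p"
    by (auto split: if_splits elim!: prefixE)
  then show "\<beta> = \<alpha>" "fst \<alpha> = fst \<gamma>" "prefix (snd \<gamma>) (snd \<alpha>)" by auto
qed

section \<open>The reduction and the out-split graph at a regular vertex that emits no loop\<close>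

locale regular_loopless_vertex =
  fixes E :: "('v, 'e) pre_digraph" and w :: 'v
  assumes wf: "wf_digraph E" and w: "w \<in> reg E"
    and no_loop: "\<And>e. e \<in> out_arcs E w \<Longrightarrow> head E e \<noteq> w"
begin

abbreviation F :: "('v, 'e + 'e \<times> 'e) pre_digraph" where
  "F \<equiv> unital_reduction E w"

abbreviation H :: "('v + 'e, 'e + 'e \<times> 'e) pre_digraph" where
  "H \<equiv> out_split E w"

abbreviation g :: "('v + 'e, 'e + 'e \<times> 'e, 'v, 'e) graph_map" where
  "g \<equiv> out_split_map w"

abbreviation \<phi> :: "('v + 'e, 'e + 'e \<times> 'e) gis \<Rightarrow> ('v, 'e + 'e \<times> 'e) gis" where
  "\<phi> \<equiv> contract E w"

lemma F_simps [simp]: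
  "verts F = verts E" "arcs F = Inl ` (arcs E - in_arcs E w) \<union> Inr ` (in_arcs E w \<times> out_arcs E w)"
  "tail F (Inl e) = tail E e" "tail F (Inr b) = tail E (fst b)"
  "head F (Inl e) = head E e" "head F (Inr b) = head E (snd b)"
  by (simp_all add: unital_reduction_def case_prod_unfold)

lemma H_simps [simp]:
  "verts H = Inl ` (verts E - {w}) \<union> Inr ` out_arcs E w"
  "arcs H = Inl ` (arcs E - in_arcs E w) \<union> Inr ` (in_arcs E w \<times> out_arcs E w)"
  "tail H (Inl e) = (if tail E e = w then Inr e else Inl (tail E e))" "tail H (Inr b) = Inl (tail E (fst b))"
  "head H (Inl e) = Inl (head E e)" "head H (Inr b) = Inr (snd b)"
  by (simp_all add: out_split_def case_prod_unfold)

lemma verts_E: "e \<in> arcs E \<Longrightarrow> tail E e \<in> verts E" "e \<in> arcs E \<Longrightarrow> head E e \<in> verts E"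
  using wf by (auto simp: wf_digraph_def)

lemma tail_in_arc: "p \<in> in_arcs E w \<Longrightarrow> tail E p \<noteq> w"
  using no_loop by auto

lemma wf_F: "wf_digraph F"
  using verts_E by (unfold_locales) (auto simp: split_beta)

lemma wf_H: "wf_digraph H"
  using verts_E tail_in_arc by (unfold_locales) (auto simp: split_beta)

sublocale E: graph_algebra E by (rule graph_algebra.intro[OF wf])
sublocale F: graph_algebra F by (rule graph_algebra.intro[OF wf_F])
sublocale H: graph_algebra H by (rule graph_algebra.intro[OF wf_H])

lemma out_w_arcs: "y \<in> out_arcs E w \<Longrightarrow> Inl y \<in> arcs F"
  using no_loop by auto

lemma finite_out_w: "finite (out_arcs E w)" and w_in_verts: "w \<in> verts E"
  using w by (auto simp: reg_def)

lemma out_arcs_F: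
  "out_arcs F v = Inl ` (out_arcs E v - in_arcs E w) \<union> Inr ` ((out_arcs E v \<inter> in_arcs E w) \<times> out_arcs E w)"
  by auto

lemma out_arcs_F_w: "out_arcs F w = Inl ` out_arcs E w"
  using no_loop by (auto simp: out_arcs_F)

lemma out_arcs_H_Inl: "v \<noteq> w \<Longrightarrow> out_arcs H (Inl v) = out_arcs F v"
  by (auto split: if_splits)

lemma out_arcs_H_Inr:
  assumes y: "y \<in> out_arcs E w"
  shows "out_arcs H (Inr y) = {Inl y}"
proof (rule set_eqI)
  fix x
  show "x \<in> out_arcs H (Inr y) \<longleftrightarrow> x \<in> {Inl y}"
    using y no_loop[OF y] by (cases x) (simp_all, auto)
qed

lemma out_w_nonempty: "out_arcs E w \<noteq> {}"
  using w by (simp add: reg_def)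

text \<open>An edge is either kept or replaced by its pairs with the edges \<open>y\<close>. Since
  \<open>w\<close> emits at least one and only finitely many edges, each edge leaves a nonempty
  finite set behind; hence the reduction also preserves regularity.\<close>

lemma finite_out_arcs_F: "finite (out_arcs F v) \<longleftrightarrow> finite (out_arcs E v)"
proof
  assume fin: "finite (out_arcs F v)"
  have "out_arcs E v \<subseteq> case_sum id fst ` out_arcs F v"
  proof
    fix e assume e: "e \<in> out_arcs E v"
    obtain y where y: "y \<in> out_arcs E w" using out_w_nonempty by blast
    have "Inl e \<in> out_arcs F v \<or> Inr (e, y) \<in> out_arcs F v" using e y by (auto simp: out_arcs_F)
    moreover have "case_sum id fst (Inl e) = e" "case_sum id fst (Inr (e, y)) = e" by simp_all
    ultimately show "e \<in> case_sum id fst ` out_arcs F v" by (metis imageI)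
  qed
  then show "finite (out_arcs E v)" using fin finite_surj by blast
next
  assume "finite (out_arcs E v)"
  then show "finite (out_arcs F v)" using finite_out_w by (auto simp: out_arcs_F)
qed

lemma reg_F: "reg F = reg E"
proof -
  have "out_arcs F v = {} \<longleftrightarrow> out_arcs E v = {}" for v
    using w unfolding out_arcs_F reg_def by blast
  then show ?thesis by (auto simp: reg_def finite_out_arcs_F)
qed

text \<open>The fibers of \<open>w\<close> and of an edge into \<open>w\<close> are both indexed by
  the edges \<open>y\<close> out of \<open>w\<close>, and the target map respects the index. A copy
  of \<open>w\<close> is regular as it emits exactly one edge; other vertices emit the same edges as
  in the reduction, where regularity is that of \<open>E\<close>.\<close>

lemma admissible_g: "admissible H E g"
  unfolding admissible_def
proof (intro conjI ballI)
  show "graph_hom H E g"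
    using verts_E by (auto simp: graph_hom_def out_split_map_def w_in_verts)
  have vf: "vfiber H g v = (if v = w then Inr ` out_arcs E w else {Inl v} \<inter> verts H)" for v
    by (auto simp: vfiber_def out_split_map_def)
  have ef: "efiber H g e = (if e \<in> in_arcs E w then (\<lambda>y. Inr (e, y)) ` out_arcs E w else {Inl e} \<inter> arcs H)" for e
    by (auto simp: efiber_def out_split_map_def)
  show "finite (vfiber H g v)" for v by (auto simp: vf finite_out_w)
  show "finite (efiber H g e)" for e by (auto simp: ef finite_out_w)
  show "bij_betw (head H) (efiber H g x) (vfiber H g (head E x))" if x: "x \<in> arcs E" for x
  proof (cases "x \<in> in_arcs E w")
    case True
    then show ?thesis by (auto simp: vf ef bij_betw_def inj_on_def image_image)
  next
    case False
    then show ?thesis using x verts_E by (auto simp: vf ef)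
  qed
  show "{u \<in> verts H. fst g u \<in> reg E} \<subseteq> reg H"
  proof
    fix u assume u: "u \<in> {u \<in> verts H. fst g u \<in> reg E}"
    show "u \<in> reg H"
    proof (cases u)
      case (Inl v)
      then have v: "v \<noteq> w" "v \<in> reg F" using u by (auto simp: out_split_map_def reg_F)
      then show ?thesis using u Inl out_arcs_H_Inl[OF v(1)] by (simp add: reg_def)
    next
      case (Inr y)
      then have "y \<in> out_arcs E w" using u by auto
      then show ?thesis using u Inr out_arcs_H_Inr by (simp add: reg_def)
    qed
  qed
qed

lemma vfiber_Inl: "v \<in> verts E \<Longrightarrow> v \<noteq> w \<Longrightarrow> vfiber H g v = {Inl v}"
  and vfiber_w: "vfiber H g w = Inr ` out_arcs E w"
  and efiber_Inl: "e \<in> arcs E \<Longrightarrow> e \<notin> in_arcs E w \<Longrightarrow> efiber H g e = {Inl e}"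
  and efiber_in: "e \<in> in_arcs E w \<Longrightarrow> efiber H g e = (\<lambda>y. Inr (e, y)) ` out_arcs E w"
  by (auto simp: vfiber_def efiber_def out_split_map_def)


section \<open>The extended path homomorphism\<close>

abbreviation cp :: "('v + 'e, 'e + 'e \<times> 'e) path \<Rightarrow> ('v, 'e + 'e \<times> 'e) path" where
  "cp \<equiv> contract_path E w"

abbreviation kept :: "'e + 'e \<times> 'e \<Rightarrow> bool" where
  "kept \<equiv> case_sum (\<lambda>e. tail E e \<noteq> w) (\<lambda>_. True)"

lemma cp_append: "cp (u, p @ r) = (fst (cp (u, p)), snd (cp (u, p)) @ filter kept r)"
  by (simp add: contract_path_def)

text \<open>The contraction of a path ending at the copy \<open>Inr y\<close> already includes
  \<open>y\<close>, so it ends at the target of \<open>y\<close>.\<close>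

lemma awalk_cp:
  assumes "pre_digraph.awalk H u p v"
  shows "pre_digraph.awalk F (fst (cp (u, p))) (snd (cp (u, p))) (case_sum id (head E) v)"
  using assms
proof (induction p arbitrary: u)
  case Nil
  interpret HG: wf_digraph H by (rule wf_H)
  interpret FG: wf_digraph F by (rule wf_F)
  from Nil show ?case using no_loop verts_E
    by (auto simp: HG.awalk_simps FG.awalk_simps contract_path_def start_edges_def)
next
  case (Cons e p)
  interpret HG: wf_digraph H by (rule wf_H)
  interpret FG: wf_digraph F by (rule wf_F)
  from Cons.prems have e: "e \<in> arcs H" "u = tail H e" "HG.awalk (head H e) p v"
    by (auto simp: HG.awalk_simps)
  note IH = Cons.IH[OF e(3)]
  show ?case
  proof (cases e)
    case (Inl f)
    then show ?thesis using IH e(1,2)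
      by (cases "tail E f = w") (auto simp: FG.awalk_Cons_iff contract_path_def start_edges_def image_iff)
  next
    \<comment> \<open>The induction hypothesis gives a path that starts at \<open>w\<close> with
      \<open>Inl y\<close>; that edge is absorbed into the combined edge \<open>Inr (p, y)\<close>,
      which has the same target.\<close>
    case (Inr b)
    then have "fst b \<in> in_arcs E w" "snd b \<in> out_arcs E w" using e(1) by (auto simp del: in_in_arcs_conv in_out_arcs_conv)
    then show ?thesis using IH e(2) Inr
      by (simp add: FG.awalk_Cons_iff contract_path_def start_edges_def mem_Times_iff)
  qed
qed

text \<open>Expansion undoes contraction apart from a trailing \<open>y\<close> for paths that end
  at a copy \<open>w_y\<close>, so contraction is almost injective.\<close>

lemma expand_cp:
  assumes "pre_digraph.awalk H u p v"
  shows "concat (map expand_edge (snd (cp (u, p)))) = p @ start_edges v"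
  using assms
proof (induction p arbitrary: u)
  case Nil
  interpret HG: wf_digraph H by (rule wf_H)
  from Nil show ?case
    by (auto simp: HG.awalk_simps contract_path_def start_edges_def expand_edge_def)
next
  case (Cons e p)
  interpret HG: wf_digraph H by (rule wf_H)
  from Cons.prems have e: "e \<in> arcs H" "u = tail H e" "HG.awalk (head H e) p v"
    by (auto simp: HG.awalk_simps)
  from Cons.IH[OF e(3)] show ?case using e(1,2) tail_in_arc
    by (auto simp: contract_path_def start_edges_def expand_edge_def)
qed

text \<open>Only comparability can be concluded: if \<open>r\<close> ends at \<open>w_y\<close>,
  then \<open>r\<close> and its extension by \<open>y\<close> have the same contraction, so the
  prefix order may be reversed.\<close>

lemma cp_reflects_prefix:
  assumes q: "pre_digraph.awalk H b q v" and r: "pre_digraph.awalk H c r v'"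
    and eq: "fst (cp (b, q)) = fst (cp (c, r))" and pre: "prefix (snd (cp (b, q))) (snd (cp (c, r)))"
  shows "b = c" "prefix q r \<or> prefix r q"
proof -
  interpret HG: wf_digraph H by (rule wf_H)
  have "b \<in> verts H" "c \<in> verts H" using q r by (auto dest: HG.awalk_hd_in_verts)
  \<comment> \<open>Over \<open>w\<close> the first edge of the contraction reveals at which copy
    the path starts.\<close>
  then show "b = c" using eq pre by (auto simp: contract_path_def start_edges_def)
  obtain x where "snd (cp (c, r)) = snd (cp (b, q)) @ x" using pre by (auto elim: prefixE)
  then have "r @ start_edges v' = q @ start_edges v @ concat (map expand_edge x)"
    using expand_cp[OF q] expand_cp[OF r] by simp
  then have "prefix q (r @ start_edges v')" by simp
  then show "prefix q r \<or> prefix r q" by (rule prefix_same_cases) simp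
qed

lemma fpaths_H: "(u, p) \<in> fpaths H \<Longrightarrow> pre_digraph.awalk H u p (path_target H (u, p))"
proof -
  interpret HG: wf_digraph H by (rule wf_H)
  assume "(u, p) \<in> fpaths H"
  then obtain v where v: "HG.awalk u p v" by (auto simp: fpaths_def)
  then have "path_target H (u, p) = v" by (auto simp: path_target_def elim!: HG.awalkE)
  then show ?thesis using v by simp
qed

lemma cp_in_fpaths:
  assumes "\<alpha> \<in> fpaths H"
  shows "cp \<alpha> \<in> fpaths F" "path_target F (cp \<alpha>) = case_sum id (head E) (path_target H \<alpha>)"
proof -
  interpret FG: wf_digraph F by (rule wf_F)
  have a: "FG.awalk (fst (cp \<alpha>)) (snd (cp \<alpha>)) (case_sum id (head E) (path_target H \<alpha>))"
    using awalk_cp[OF fpaths_H, of "fst \<alpha>" "snd \<alpha>"] assms by simp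
  then show "cp \<alpha> \<in> fpaths F" by (auto simp: fpaths_def split_beta)
  show "path_target F (cp \<alpha>) = case_sum id (head E) (path_target H \<alpha>)"
    using a by (auto simp: path_target_def elim!: FG.awalkE)
qed

lemma \<phi>_mult:
  assumes "\<beta> \<in> fpaths H" "\<gamma> \<in> fpaths H"
  shows "\<phi> (gis_mult (Some (\<alpha>, \<beta>)) (Some (\<gamma>, \<delta>))) =
    gis_mult (Some (cp \<alpha>, cp \<beta>)) (Some (cp \<gamma>, cp \<delta>))"
proof -
  obtain a p b q c r d s where [simp]: "\<alpha> = (a, p)" "\<beta> = (b, q)" "\<gamma> = (c, r)" "\<delta> = (d, s)"
    by (metis surj_pair)
  consider (left) x where "b = c" "r = q @ x"
    | (right) x where "b = c" "\<not> prefix q r" "q = r @ x"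
    | (none) "\<not> (b = c \<and> (prefix q r \<or> prefix r q))"
    by (blast elim: prefixE)
  then show ?thesis
  proof cases
    case left
    obtain t B t' A t'' C where "cp (b, q) = (t, B)" "cp (a, p) = (t', A)" "cp (d, s) = (t'', C)" by fastforce
    then show ?thesis using left by (simp add: contract_def cp_append)
  next
    \<comment> \<open>If contraction deletes all of \<open>x\<close>, the product of the images
      falls into the first branch of \<open>gis_mult\<close>; both branches then append nothing and
      agree.\<close>
    case right
    obtain t B t' A t'' C where "cp (b, r) = (t, B)" "cp (a, p) = (t', A)" "cp (d, s) = (t'', C)" by fastforce
    then show ?thesis using right by (auto simp: contract_def cp_append)
  next
    case none
    note walks = fpaths_H[OF assms(1)[simplified]] fpaths_H[OF assms(2)[simplified]]
    have "gis_mult (Some (\<alpha>, \<beta>)) (Some (\<gamma>, \<delta>)) = None" using none by auto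
    moreover have "gis_mult (Some (cp \<alpha>, cp \<beta>)) (Some (cp \<gamma>, cp \<delta>)) = None"
    proof (rule ccontr)
      assume "gis_mult (Some (cp \<alpha>, cp \<beta>)) (Some (cp \<gamma>, cp \<delta>)) \<noteq> None"
      then have "fst (cp (b, q)) = fst (cp (c, r))"
        "prefix (snd (cp (b, q))) (snd (cp (c, r))) \<or> prefix (snd (cp (c, r))) (snd (cp (b, q)))"
        unfolding gis_mult_neq_None_iff by simp_all
      then show False
        using none cp_reflects_prefix[OF walks] cp_reflects_prefix[OF walks(2,1)] by metis
    qed
    ultimately show ?thesis by (simp add: contract_def del: gis_mult.simps)
  qed
qed

lemma extended_path_hom_\<phi>: "extended_path_hom H F \<phi>"
  unfolding extended_path_hom_def
proof (intro conjI ballI)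
  show "\<phi> None = None" by (simp add: contract_def)
  show "\<phi> s \<in> gis_carrier F" if "s \<in> gis_carrier H" for s
    using that by (auto simp: gis_carrier_def contract_def cp_in_fpaths simp del: F_simps H_simps)
  fix s t assume "s \<in> gis_carrier H" "t \<in> gis_carrier H"
  then show "\<phi> (gis_mult s t) = gis_mult (\<phi> s) (\<phi> t)"
  proof (cases "s = None \<or> t = None")
    case True
    then show ?thesis by (cases s; cases t) (auto simp: contract_def)
  next
    case False
    then obtain \<alpha> \<beta> \<gamma> \<delta> where st: "s = Some (\<alpha>, \<beta>)" "t = Some (\<gamma>, \<delta>)" "\<beta> \<in> fpaths H" "\<gamma> \<in> fpaths H"
      using \<open>s \<in> gis_carrier H\<close> \<open>t \<in> gis_carrier H\<close> by (auto simp: gis_carrier_def simp del: F_simps H_simps)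
    have "\<phi> s = Some (cp \<alpha>, cp \<beta>)" "\<phi> t = Some (cp \<gamma>, cp \<delta>)" using st by (simp_all add: contract_def)
    then show ?thesis using \<phi>_mult[OF st(3,4)] st by simp
  qed
qed

text \<open>It suffices that each path \<open>\<alpha>\<close> extending the contraction of
  \<open>u\<close> is comparable with the contraction of some edge out of \<open>u\<close>. At a
  copy \<open>w_y\<close> the only edge has the same contraction as the vertex. At an unsplit vertex
  the first edge of \<open>\<alpha>\<close> works, or any edge if \<open>\<alpha>\<close> has length
  \<open>0\<close>.\<close>

lemma regular_hom_\<phi>: "regular_hom H F \<phi>"
  unfolding regular_hom_def
proof (intro ballI impI)
  fix u t
  assume u: "u \<in> reg H" and t: "t \<in> gis_carrier F" "t \<noteq> None" "gis_le t (\<phi> (Some (vpath u, vpath u)))"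
  have \<phi>_idem: "\<phi> (Some (\<gamma>, \<gamma>)) = Some (cp \<gamma>, cp \<gamma>)" for \<gamma> by (simp add: contract_def)
  obtain \<alpha> \<beta> where t': "t = Some (\<alpha>, \<beta>)" "\<alpha> \<in> fpaths F"
    using t(1,2) by (auto simp: gis_carrier_def simp del: F_simps H_simps)
  have \<alpha>: "\<beta> = \<alpha>" "fst \<alpha> = fst (cp (vpath u))" "prefix (snd (cp (vpath u))) (snd \<alpha>)"
    using gis_le_idempotent[of \<alpha> \<beta> "cp (vpath u)"] t(3) t'(1) by (simp_all add: \<phi>_idem)
  have "\<exists>e\<in>out_arcs H u. fst \<alpha> = fst (cp (epath H e)) \<and>
      (prefix (snd \<alpha>) (snd (cp (epath H e))) \<or> prefix (snd (cp (epath H e))) (snd \<alpha>))"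
  proof (cases u)
    case (Inr y)
    then have y: "y \<in> out_arcs E w" using u by (auto simp: reg_def)
    then have "cp (epath H (Inl y)) = cp (vpath u)"
      using Inr by (simp add: epath_def vpath_def contract_path_def)
    then show ?thesis using \<alpha> out_arcs_H_Inr[OF y] Inr by simp
  next
    case (Inl v)
    then have v: "v \<noteq> w" using u by (auto simp: reg_def)
    have fst: "fst \<alpha> = v" using \<alpha>(2) Inl by (simp add: vpath_def contract_path_def)
    have cpe: "cp (epath H e) = (v, [e])" if "e \<in> out_arcs F v" for e
      using that v by (auto simp: epath_def contract_path_def start_edges_def)
    obtain e where e: "e \<in> out_arcs H u" "snd \<alpha> = [] \<or> e = hd (snd \<alpha>)"
    proof (cases "snd \<alpha>")
      case Nil
      have "out_arcs H u \<noteq> {}" using u by (simp add: reg_def)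
      then show thesis using that Nil by blast
    next
      case (Cons f p)
      interpret FG: wf_digraph F by (rule wf_F)
      have "f \<in> out_arcs F v"
        using t'(2) fst Cons by (auto simp: fpaths_def FG.awalk_simps simp del: F_simps)
      then show thesis using that[of f] Cons Inl out_arcs_H_Inl[OF v] by simp
    qed
    then have "cp (epath H e) = (v, [e])" using Inl out_arcs_H_Inl[OF v] cpe by simp
    moreover have "snd \<alpha> = [] \<or> prefix [e] (snd \<alpha>)" using e(2) by (cases "snd \<alpha>") auto
    ultimately show ?thesis using fst by (intro bexI[OF _ e(1)]) auto
  qed
  then show "\<exists>e\<in>out_arcs H u. gis_mult t (\<phi> (Some (epath H e, epath H e))) \<noteq> None"
    unfolding t'(1) \<phi>_idem gis_mult_neq_None_iff \<alpha>(1) .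
qed

end

context regular_loopless_vertex
begin

text \<open>The images of the generators under the pushforward along \<open>\<phi>\<close>, after simplification in
  \<open>C\<^sup>*(E\<^sub>R\<^sub>+)\<close>.\<close>

definition contract_gen :: "('v + 'e) + ('e + 'e \<times> 'e) \<Rightarrow> ('v + ('e + 'e \<times> 'e)) star_poly" where
  "contract_gen =
    case_sum (case_sum V (\<lambda>y. D (Inl y) * poly_star (D (Inl y))))
      (case_sum (\<lambda>e. D (Inl e)) (\<lambda>(p, y). D (Inr (p, y)) * poly_star (D (Inl y))))"

lemma contract_gen_simps [simp]:
  "contract_gen (Inl (Inl v)) = V v"
  "contract_gen (Inl (Inr y)) = D (Inl y) * poly_star (D (Inl y))"
  "contract_gen (Inr (Inl e)) = D (Inl e)"
  "contract_gen (Inr (Inr (p, y))) = D (Inr (p, y)) * poly_star (D (Inl y))"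
  by (simp_all add: contract_gen_def)

lemma in_arcs_F:
  "Inl e \<in> arcs F \<longleftrightarrow> e \<in> arcs E \<and> head E e \<noteq> w"
  "Inr (p, y) \<in> arcs F \<longleftrightarrow> p \<in> in_arcs E w \<and> y \<in> out_arcs E w"
  by auto

lemma arcs_H: "arcs H = arcs F"
  by simp

lemma arcs_F_cases:
  assumes "a \<in> arcs F"
  obtains (kept) e where "a = Inl e" "Inl e \<in> arcs F" "e \<in> arcs E" "head E e \<noteq> w"
    | (pair) p y where "a = Inr (p, y)" "Inr (p, y) \<in> arcs F" "Inl y \<in> arcs F"
        "p \<in> in_arcs E w" "y \<in> out_arcs E w"
proof (cases a)
  case (Inl e)
  then show thesis using kept[of e] assms in_arcs_F(1)[of e] by simp
next
  case (Inr b)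
  obtain p y where "b = (p, y)" by (cases b)
  then show thesis using pair[of p y] Inr assms in_arcs_F(2)[of p y] out_w_arcs[of y] by blast
qed

lemma verts_H_cases:
  assumes "u \<in> verts H"
  obtains (old) v where "u = Inl v" "v \<in> verts F" "v \<noteq> w"
    | (split) y where "u = Inr y" "y \<in> out_arcs E w" "Inl y \<in> arcs F" "tail E y = w"
  using assms no_loop by auto

lemma F_eq_pair:
  assumes "Inr (p, y) \<in> arcs F" "y \<in> out_arcs E w"
  shows "F.eq ((D (Inr (p, y)) * poly_star (D (Inl y))) * poly_star (D (Inr (p, y)) * poly_star (D (Inl y))))
    (D (Inr (p, y)) * poly_star (D (Inr (p, y))))"
proof -
  note y = out_w_arcs[OF assms(2)]
  have "F.eq ((D (Inr (p, y)) * poly_star (D (Inl y))) * (D (Inl y) * poly_star (D (Inr (p, y)))))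
      (D (Inr (p, y)) * V (head F (Inr (p, y))) * poly_star (D (Inr (p, y))))"
    using F.eq_star_D_mult_D_mid[OF y y F.D_in_free[OF assms(1)] poly_star_in_free[OF F.D_in_free[OF assms(1)]]]
    by simp
  also have "F.eq \<dots> (D (Inr (p, y)) * poly_star (D (Inr (p, y))))"
    by (rule F.D_mult_V_mult_star_D) fact+
  finally show ?thesis by (simp add: poly_star_mult)
qed

lemma contract_gen_in_free:
  assumes "x \<in> graph_gens H"
  shows "contract_gen x \<in> F.Fr"
proof -
  from assms consider u where "x = Inl u" "u \<in> verts H" | a where "x = Inr a" "a \<in> arcs F"
    unfolding graph_gens_def arcs_H by blast
  then show ?thesis
  proof cases
    case 1
    show ?thesis
      using 1(2)
    proof (cases rule: verts_H_cases)
      case (old v)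
      show ?thesis unfolding 1(1) old(1) contract_gen_simps by (rule F.V_in_free[OF old(2)])
    next
      case (split y)
      show ?thesis unfolding 1(1) split(1) contract_gen_simps by (intro F.free_intros split(3))
    qed
  next
    case 2
    show ?thesis
      using 2(2)
    proof (cases rule: arcs_F_cases)
      case (kept e)
      show ?thesis unfolding 2(1) kept(1) contract_gen_simps by (rule F.D_in_free[OF kept(2)])
    next
      case (pair p y)
      show ?thesis unfolding 2(1) pair(1) contract_gen_simps by (intro F.free_intros pair(2,3))
    qed
  qed
qed

lemma star_D_mult_proj:
  assumes "y \<in> out_arcs E w"
  shows "F.eq (poly_star (D (Inl y)) * (D (Inl y) * poly_star (D (Inl y)))) (poly_star (D (Inl y)))"
    "F.eq (D (Inl y) * poly_star (D (Inl y)) * D (Inl y)) (D (Inl y))"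
proof -
  note y = out_w_arcs[OF assms]
  note fy = F.D_in_free[OF y]
  have s: "F.eq (poly_star (D (Inl y)) * D (Inl y)) (V (head F (Inl y)))"
    using F.star_D_mult_D[OF y y] by simp
  have "F.eq (poly_star (D (Inl y)) * D (Inl y) * poly_star (D (Inl y))) (V (head F (Inl y)) * poly_star (D (Inl y)))"
    by (intro F.eq_mult_right s poly_star_in_free fy)
  also have "F.eq \<dots> (poly_star (D (Inl y)))"
    using F.V_mult_star_D[OF F.head_in_verts[OF y] y] by simp
  finally show "F.eq (poly_star (D (Inl y)) * (D (Inl y) * poly_star (D (Inl y)))) (poly_star (D (Inl y)))"
    by (simp add: mult.assoc)
  have "F.eq (D (Inl y) * (poly_star (D (Inl y)) * D (Inl y))) (D (Inl y) * V (head F (Inl y)))"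
    by (intro F.eq_mult_left s fy)
  also have "F.eq \<dots> (D (Inl y))" by (rule F.D_mult_V_head[OF y])
  finally show "F.eq (D (Inl y) * poly_star (D (Inl y)) * D (Inl y)) (D (Inl y))"
    by (simp add: mult.assoc)
qed

text \<open>The projections \<open>S_y S_y^*\<close> of the copies are orthogonal to each other and
  to \<open>S_v\<close> for \<open>v\<close> other than \<open>w\<close>. The Cuntz-Krieger relation
  at \<open>w_y\<close> is trivial, its only edge being sent to \<open>S_y\<close>. At an unsplit
  vertex it is the one of the reduction, because \<open>S_{py} S_y^*\<close> and
  \<open>S_{py}\<close> have the same range projection by \<open>F_eq_pair\<close>.\<close>

lemma presentation_hom_contract_gen:
  "presentation_hom (graph_gens H) (graph_rels H) (graph_gens F) (graph_rels F) contract_gen"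
proof (rule graph_presentation_homI[OF H.graph_algebra_axioms F.graph_algebra_axioms contract_gen_in_free])
  fix u v assume u: "u \<in> verts H" and v: "v \<in> verts H"
  show "F.eq (contract_gen (Inl u) * contract_gen (Inl v)) (if u = v then contract_gen (Inl v) else 0)"
    using u
  proof (cases rule: verts_H_cases)
    case u': (old a)
    show ?thesis
      using v
    proof (cases rule: verts_H_cases)
      case (old b)
      then show ?thesis using F.V_mult_V[OF u'(2) old(2)] u' by (cases "a = b") simp_all
    next
      case (split y)
      have "F.eq (V a * D (Inl y)) 0"
        using F.V_mult_D[OF u'(2) split(3)] split(4) u'(3) by simp
      then have "F.eq (V a * D (Inl y) * poly_star (D (Inl y))) (0 * poly_star (D (Inl y)))"
        by (rule F.eq_mult_right[OF _ poly_star_in_free[OF F.D_in_free[OF split(3)]]])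
      then show ?thesis using u' split by (simp add: mult.assoc)
    qed
  next
    case u': (split y)
    show ?thesis
      using v
    proof (cases rule: verts_H_cases)
      case (old b)
      have "F.eq (poly_star (D (Inl y)) * V b) 0"
        using F.star_D_mult_V[OF old(2) u'(3)] old(3) u'(4) by simp
      then have "F.eq (D (Inl y) * (poly_star (D (Inl y)) * V b)) (D (Inl y) * 0)"
        by (rule F.eq_mult_left[OF _ F.D_in_free[OF u'(3)]])
      then show ?thesis using u' old by (simp add: mult.assoc)
    next
      case (split y')
      have "F.eq ((D (Inl y) * poly_star (D (Inl y))) * (D (Inl y') * poly_star (D (Inl y'))))
          (if y = y' then D (Inl y) * V (head F (Inl y)) * poly_star (D (Inl y')) else 0)"
        using F.eq_star_D_mult_D_mid[OF u'(3) split(3) F.D_in_free[OF u'(3)] poly_star_in_free[OF F.D_in_free[OF split(3)]]]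
        by (cases "y = y'") simp_all
      also have "F.eq \<dots> (if y = y' then D (Inl y) * poly_star (D (Inl y)) else 0)"
        using F.D_mult_V_mult_star_D[OF u'(3) u'(3)] by (cases "y = y'") (simp_all add: F.eq_refl)
      finally show ?thesis using u'(1) split(1) by (cases "y = y'") simp_all
    qed
  qed
next
  fix u assume "u \<in> verts H"
  then show "F.eq (poly_star (contract_gen (Inl u))) (contract_gen (Inl u))"
  proof (cases rule: verts_H_cases)
    case (old v)
    then show ?thesis using F.star_V by simp
  next
    case (split y)
    show ?thesis
      by (simp add: split(1) poly_star_mult F.eq_refl mult_in_free poly_star_in_free F.D_in_free[OF split(3)])
  qed
next
  fix a b assume "a \<in> arcs H" "b \<in> arcs H"
  then have a: "a \<in> arcs F" and b: "b \<in> arcs F" by simp_all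
  show "F.eq (poly_star (contract_gen (Inr a)) * contract_gen (Inr b))
      (if a = b then contract_gen (Inl (head H a)) else 0)"
    using a
  proof (cases rule: arcs_F_cases)
    case a': (kept e)
    show ?thesis
      using b
    proof (cases rule: arcs_F_cases)
      case (kept f)
      then show ?thesis using F.star_D_mult_D[OF a'(2) kept(2)] a' by (cases "e = f") simp_all
    next
      case (pair p y)
      have "F.eq (poly_star (D (Inl e)) * D (Inr (p, y))) 0"
        using F.star_D_mult_D[OF a'(2) pair(2)] by simp
      then have "F.eq (poly_star (D (Inl e)) * D (Inr (p, y)) * poly_star (D (Inl y))) (0 * poly_star (D (Inl y)))"
        by (rule F.eq_mult_right[OF _ poly_star_in_free[OF F.D_in_free[OF pair(3)]]])
      then show ?thesis using a' pair by (simp add: mult.assoc)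
    qed
  next
    case a': (pair p y)
    show ?thesis
      using b
    proof (cases rule: arcs_F_cases)
      case (kept f)
      have "F.eq (poly_star (D (Inr (p, y))) * D (Inl f)) 0"
        using F.star_D_mult_D[OF a'(2) kept(2)] by simp
      then have "F.eq (D (Inl y) * (poly_star (D (Inr (p, y))) * D (Inl f))) (D (Inl y) * 0)"
        by (rule F.eq_mult_left[OF _ F.D_in_free[OF a'(3)]])
      then show ?thesis using a' kept by (simp add: poly_star_mult mult.assoc)
    next
      case (pair p' y')
      have "F.eq ((D (Inl y) * poly_star (D (Inr (p, y)))) * (D (Inr (p', y')) * poly_star (D (Inl y'))))
          (if a = b then D (Inl y) * V (head F (Inl y)) * poly_star (D (Inl y')) else 0)"
        using F.eq_star_D_mult_D_mid[OF a'(2) pair(2) F.D_in_free[OF a'(3)] poly_star_in_free[OF F.D_in_free[OF pair(3)]]]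
          a'(1) pair(1) by (cases "a = b") auto
      also have "F.eq \<dots> (if a = b then D (Inl y) * poly_star (D (Inl y)) else 0)"
        using F.D_mult_V_mult_star_D[OF a'(3) a'(3)] a'(1) pair(1) by (cases "a = b") (auto simp: F.eq_refl)
      finally show ?thesis using a'(1) pair(1) by (cases "a = b") (auto simp: poly_star_mult)
    qed
  qed
next
  fix a assume "a \<in> arcs H"
  then have "a \<in> arcs F" by simp
  then show "F.eq (contract_gen (Inl (tail H a)) * contract_gen (Inr a)) (contract_gen (Inr a))"
  proof (cases rule: arcs_F_cases)
    case (kept e)
    show ?thesis
    proof (cases "tail E e = w")
      case True
      then have "e \<in> out_arcs E w" using kept by auto
      then show ?thesis using star_D_mult_proj(2) kept(1) True by simp
    next
      case False
      then show ?thesis using F.V_tail_mult_D[OF kept(2)] kept(1) by simp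
    qed
  next
    case (pair p y)
    have "F.eq (V (tail F (Inr (p, y))) * D (Inr (p, y)) * poly_star (D (Inl y)))
        (D (Inr (p, y)) * poly_star (D (Inl y)))"
      by (intro F.eq_mult_right F.V_tail_mult_D pair poly_star_in_free F.D_in_free)
    then show ?thesis using pair(1) by (simp add: mult.assoc)
  qed
next
  fix u assume u: "u \<in> reg H"
  from H.reg_in_verts[OF u]
  show "F.eq (contract_gen (Inl u))
      (\<Sum>a\<in>out_arcs H u. contract_gen (Inr a) * poly_star (contract_gen (Inr a)))"
  proof (cases rule: verts_H_cases)
    case (old v)
    note out = out_arcs_H_Inl[OF old(3)]
    have "v \<in> reg F" using u old by (simp add: reg_def out)
    then have "F.eq (V v) (\<Sum>a\<in>out_arcs F v. D a * poly_star (D a))" by (rule F.Cuntz_Krieger)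
    also have "F.eq \<dots> (\<Sum>a\<in>out_arcs F v. contract_gen (Inr a) * poly_star (contract_gen (Inr a)))"
    proof (rule F.eq_sum)
      fix a assume "a \<in> out_arcs F v"
      then have "a \<in> arcs F" by (rule out_arcs_in_arcs)
      then show "F.eq (D a * poly_star (D a)) (contract_gen (Inr a) * poly_star (contract_gen (Inr a)))"
      proof (cases rule: arcs_F_cases)
        case (kept e)
        then show ?thesis by (auto intro!: F.eq_refl F.free_intros)
      next
        case (pair p y)
        show ?thesis using F.eq_sym[OF F_eq_pair[OF pair(2,5)]] pair(1) by simp
      qed
    qed
    finally show ?thesis using old(1) out by simp
  next
    case (split y)
    show ?thesis
      unfolding split(1) out_arcs_H_Inr[OF split(2)]
      by (simp add: F.eq_refl mult_in_free poly_star_in_free F.D_in_free[OF split(3)])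
  qed
qed

text \<open>The pushforward literally produces \<open>S_v S_v^*\<close> and
  \<open>S_e S_{t(e)}^*\<close>, where the factor for the vertex is absorbed by the projection
  relations.\<close>

lemma pushforward_gen_eq:
  assumes "x \<in> graph_gens H"
  shows "F.eq (pushforward_gen H \<phi> x) (contract_gen x)"
proof -
  from assms consider u where "x = Inl u" "u \<in> verts H" | a where "x = Inr a" "a \<in> arcs F"
    unfolding graph_gens_def arcs_H by blast
  then show ?thesis
  proof cases
    case 1
    show ?thesis
      using 1(2)
    proof (cases rule: verts_H_cases)
      case (old v)
      have "F.eq (V v * poly_star (V v)) (V v * V v)"
        by (intro F.eq_mult_left F.star_V F.V_in_free old)
      also have "F.eq \<dots> (V v)" using F.V_mult_V[OF old(2) old(2)] by simp
      finally show ?thesis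
        by (simp add: 1(1) old(1) pushforward_gen_def contract_def contract_path_def vpath_def start_edges_def)
    next
      case (split y)
      show ?thesis
        by (simp add: 1(1) split(1) pushforward_gen_def contract_def contract_path_def vpath_def
            start_edges_def F.eq_refl mult_in_free poly_star_in_free F.D_in_free[OF split(3)])
    qed
  next
    case 2
    show ?thesis
      using 2(2)
    proof (cases rule: arcs_F_cases)
      case (kept e)
      have "F.eq (D (Inl e) * poly_star (V (head F (Inl e)))) (D (Inl e) * V (head F (Inl e)))"
        by (intro F.eq_mult_left F.star_V F.D_in_free F.head_in_verts kept)
      also have "F.eq \<dots> (D (Inl e))" by (rule F.D_mult_V_head[OF kept(2)])
      finally show ?thesis
        by (simp add: 2(1) kept(1) pushforward_gen_def contract_def contract_path_def vpath_def epath_def start_edges_def)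
    next
      case (pair p y)
      then show ?thesis
        by (simp add: 2(1) pushforward_gen_def contract_def contract_path_def vpath_def epath_def start_edges_def
            F.eq_refl mult_in_free poly_star_in_free F.D_in_free del: F_simps)
    qed
  qed
qed

lemma presentation_hom_pushforward:
  "presentation_hom (graph_gens H) (graph_rels H) (graph_gens F) (graph_rels F) (pushforward_gen H \<phi>)"
  by (rule presentation_hom_cong[OF presentation_hom_contract_gen pushforward_gen_eq H.graph_rels_in_free])

lemma path_hom_pushforward_eq:
  "path_hom_pushforward H F \<phi> =
    induced_hom (graph_gens H) (graph_rels H) (graph_gens F) (graph_rels F) (pushforward_gen H \<phi>)"
  unfolding path_hom_pushforward_def
  by (rule universal_hom_eq_induced_hom[OF presentation_hom_pushforward])
    (simp_all only: pushforward_gen_def sum.case)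


section \<open>The unital reduction\<close>

lemma reduction_gen_simps [simp]:
  "reduction_gen (Inl v) = V v"
  "reduction_gen (Inr (Inl e)) = D e"
  "reduction_gen (Inr (Inr (x, y))) = D x * D y"
  by (simp_all add: reduction_gen_def)

lemma reduction_gen_in_free:
  assumes "x \<in> graph_gens F"
  shows "reduction_gen x \<in> E.Fr"
proof -
  from assms consider v where "x = Inl v" "v \<in> verts E" | a where "x = Inr a" "a \<in> arcs F"
    unfolding graph_gens_def by auto
  then show ?thesis
  proof cases
    case 1
    then show ?thesis by (simp add: E.V_in_free)
  next
    case 2
    show ?thesis using 2(2) by (cases rule: arcs_F_cases) (auto simp: 2(1) intro!: E.free_intros)
  qed
qed

text \<open>The Cuntz-Krieger relation at \<open>w\<close>, multiplied by \<open>S_x\<close> from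
  the left. It recombines the pairs \<open>xy\<close> into \<open>x\<close>, both in the
  Cuntz-Krieger relations of the reduction and in the proof that the two maps are inverse.\<close>

lemma sum_D_out_w:
  assumes "x \<in> in_arcs E w"
  shows "E.eq (\<Sum>y\<in>out_arcs E w. D x * D y * poly_star (D y)) (D x)"
proof -
  have x: "x \<in> arcs E" "head E x = w" using assms by auto
  have "E.eq (D x * (\<Sum>y\<in>out_arcs E w. D y * poly_star (D y))) (D x * V w)"
    by (intro E.eq_mult_left E.D_in_free x, rule E.eq_sym, rule E.Cuntz_Krieger[OF w])
  also have "E.eq \<dots> (D x)" using E.D_mult_V_head[OF x(1)] x(2) by simp
  finally show ?thesis by (simp add: sum_distrib_left mult.assoc)
qed

lemma presentation_hom_reduction_gen:
  "presentation_hom (graph_gens F) (graph_rels F) (graph_gens E) (graph_rels E) reduction_gen"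
proof (rule graph_presentation_homI[OF F.graph_algebra_axioms E.graph_algebra_axioms reduction_gen_in_free])
  fix u v assume "u \<in> verts F" "v \<in> verts F"
  then show "E.eq (reduction_gen (Inl u) * reduction_gen (Inl v)) (if u = v then reduction_gen (Inl v) else 0)"
    using E.V_mult_V[of u v] by (cases "u = v") simp_all
next
  fix v assume "v \<in> verts F"
  then show "E.eq (poly_star (reduction_gen (Inl v))) (reduction_gen (Inl v))"
    using E.star_V by simp
next
  fix a b assume a: "a \<in> arcs F" and b: "b \<in> arcs F"
  show "E.eq (poly_star (reduction_gen (Inr a)) * reduction_gen (Inr b))
      (if a = b then reduction_gen (Inl (head F a)) else 0)"
    using a
  proof (cases rule: arcs_F_cases)
    case a': (kept e)
    show ?thesis
      using b
    proof (cases rule: arcs_F_cases)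
      case (kept f)
      then show ?thesis using E.star_D_mult_D[OF a'(3) kept(3)] a' by (cases "e = f") simp_all
    next
      case (pair x y)
      then have xy: "x \<in> arcs E" "y \<in> arcs E" "head E x = w" by auto
      have "E.eq (poly_star (D e) * D x) 0"
        using E.star_D_mult_D[OF a'(3) xy(1)] a'(4) xy(3) by (cases "e = x") simp_all
      then have "E.eq (poly_star (D e) * D x * D y) (0 * D y)"
        by (rule E.eq_mult_right[OF _ E.D_in_free[OF xy(2)]])
      then show ?thesis using a' pair by (simp add: mult.assoc)
    qed
  next
    case a': (pair x y)
    then have xy: "x \<in> arcs E" "y \<in> arcs E" "head E x = w" "tail E y = w" by auto
    show ?thesis
      using b
    proof (cases rule: arcs_F_cases)
      case (kept f)
      have "E.eq (poly_star (D x) * D f) 0"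
        using E.star_D_mult_D[OF xy(1) kept(3)] kept(4) xy(3) by (cases "x = f") simp_all
      then have "E.eq (poly_star (D y) * (poly_star (D x) * D f)) (poly_star (D y) * 0)"
        by (rule E.eq_mult_left[OF _ poly_star_in_free[OF E.D_in_free[OF xy(2)]]])
      then show ?thesis using a' kept by (simp add: poly_star_mult mult.assoc)
    next
      case (pair x' y')
      then have xy': "x' \<in> arcs E" "y' \<in> arcs E" "tail E y' = w" by auto
      have "E.eq ((poly_star (D y) * poly_star (D x)) * (D x' * D y'))
          (if x = x' then poly_star (D y) * V w * D y' else 0)"
        using E.eq_star_D_mult_D_mid[OF xy(1) xy'(1) poly_star_in_free[OF E.D_in_free[OF xy(2)]] E.D_in_free[OF xy'(2)]]
          xy(3) by (cases "x = x'") auto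
      also have "E.eq \<dots> (if x = x' then poly_star (D y) * D y' else 0)"
        using E.eq_mult_left[OF E.V_tail_mult_D[OF xy'(2)] poly_star_in_free[OF E.D_in_free[OF xy(2)]]] xy'(3)
        by (cases "x = x'") (auto simp: E.eq_refl mult.assoc)
      also have "E.eq \<dots> (if a = b then V (head E y) else 0)"
        using E.star_D_mult_D[OF xy(2) xy'(2)] a'(1) pair(1)
        by (cases "x = x'"; cases "y = y'") (auto simp: E.eq_refl)
      finally show ?thesis using a'(1) pair(1) by (cases "a = b") (auto simp: poly_star_mult)
    qed
  qed
next
  fix a assume "a \<in> arcs F"
  then show "E.eq (reduction_gen (Inl (tail F a)) * reduction_gen (Inr a)) (reduction_gen (Inr a))"
  proof (cases rule: arcs_F_cases)
    case (kept e)
    then show ?thesis using E.V_tail_mult_D[of e] by simp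
  next
    case (pair x y)
    then have "x \<in> arcs E" "y \<in> arcs E" by auto
    then have "E.eq (V (tail E x) * D x * D y) (D x * D y)"
      by (intro E.eq_mult_right E.V_tail_mult_D E.D_in_free)
    then show ?thesis using pair(1) by (simp add: mult.assoc)
  qed
next
  fix v assume v: "v \<in> reg F"
  then have vE: "v \<in> reg E" by (simp only: reg_F)
  \<comment> \<open>The edges out of \<open>v\<close> that are kept are separated from those into
    \<open>w\<close>, which the reduction replaces by pairs; \<open>sum_D_out_w\<close> restores the
    contribution of the latter.\<close>
  let ?A = "out_arcs E v - in_arcs E w" and ?B = "out_arcs E v \<inter> in_arcs E w"
  have fin: "finite ?A" "finite ?B" using vE by (auto simp: reg_def)
  let ?f = "\<lambda>a. reduction_gen (Inr a) * poly_star (reduction_gen (Inr a))"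
  have "(\<Sum>a\<in>out_arcs F v. ?f a) = (\<Sum>a\<in>Inl ` ?A. ?f a) + (\<Sum>a\<in>Inr ` (?B \<times> out_arcs E w). ?f a)"
    unfolding out_arcs_F by (rule sum.union_disjoint) (use fin finite_out_w in auto)
  also have "(\<Sum>a\<in>Inl ` ?A. ?f a) = (\<Sum>e\<in>?A. D e * poly_star (D e))"
    by (subst sum.reindex) (auto simp: inj_on_def)
  also have "(\<Sum>a\<in>Inr ` (?B \<times> out_arcs E w). ?f a) =
      (\<Sum>(x, y)\<in>?B \<times> out_arcs E w. (D x * D y) * poly_star (D x * D y))"
    by (subst sum.reindex) (auto simp: inj_on_def case_prod_unfold intro!: sum.cong)
  also have "\<dots> = (\<Sum>x\<in>?B. \<Sum>y\<in>out_arcs E w. (D x * D y) * poly_star (D x * D y))"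
    by (rule sum.cartesian_product[symmetric])
  finally have split: "(\<Sum>a\<in>out_arcs F v. ?f a) = (\<Sum>e\<in>?A. D e * poly_star (D e)) +
      (\<Sum>x\<in>?B. \<Sum>y\<in>out_arcs E w. (D x * D y) * poly_star (D x * D y))" .
  have pair: "E.eq (D x * poly_star (D x)) (\<Sum>y\<in>out_arcs E w. (D x * D y) * poly_star (D x * D y))"
    if x: "x \<in> ?B" for x
  proof -
    have "E.eq (D x * poly_star (D x)) ((\<Sum>y\<in>out_arcs E w. D x * D y * poly_star (D y)) * poly_star (D x))"
      using x by (intro E.eq_mult_right, intro E.eq_sym[OF sum_D_out_w]) (auto intro!: E.free_intros)
    then show ?thesis by (simp add: sum_distrib_right poly_star_mult mult.assoc)
  qed
  have "E.eq (V v) (\<Sum>e\<in>out_arcs E v. D e * poly_star (D e))" by (rule E.Cuntz_Krieger[OF vE])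
  also have "out_arcs E v = ?A \<union> ?B" by blast
  also have "(\<Sum>e\<in>?A \<union> ?B. D e * poly_star (D e)) =
      (\<Sum>e\<in>?A. D e * poly_star (D e)) + (\<Sum>e\<in>?B. D e * poly_star (D e))"
    by (rule sum.union_disjoint) (use fin in auto)
  also have "E.eq \<dots> (\<Sum>a\<in>out_arcs F v. ?f a)"
    unfolding split
    by (intro E.eq_add E.eq_refl E.eq_sum pair) (auto intro!: E.free_intros)
  finally show "E.eq (reduction_gen (Inl v)) (\<Sum>a\<in>out_arcs F v. ?f a)" by simp
qed

lemma unital_reduction_hom_eq:
  "unital_reduction_hom E w =
    induced_hom (graph_gens F) (graph_rels F) (graph_gens E) (graph_rels E) reduction_gen"
  unfolding unital_reduction_hom_def
  by (rule universal_hom_eq_induced_hom[OF presentation_hom_reduction_gen])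
    (auto simp: reduction_gen_def split: sum.split)

section \<open>The inverse of the reduction homomorphism and its factorization\<close>

abbreviation \<theta> :: "'v + 'e \<Rightarrow> ('v + ('e + 'e \<times> 'e)) star_poly" where
  "\<theta> \<equiv> reduction_inv_gen E w"

lemma \<theta>_simps:
  "\<theta> (Inl v) = V v"
  "e \<notin> in_arcs E w \<Longrightarrow> \<theta> (Inr e) = D (Inl e)"
  "e \<in> in_arcs E w \<Longrightarrow> \<theta> (Inr e) = (\<Sum>y\<in>out_arcs E w. D (Inr (e, y)) * poly_star (D (Inl y)))"
  by (simp_all add: reduction_inv_gen_def del: in_in_arcs_conv)

lemma graph_gens_E_cases:
  assumes "x \<in> graph_gens E"
  obtains (vertex) v where "x = Inl v" "v \<in> verts E" "v \<noteq> w"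
    | (vertex_w) "x = Inl w"
    | (kept) e where "x = Inr e" "e \<in> arcs E" "e \<notin> in_arcs E w"
    | (into) e where "x = Inr e" "e \<in> in_arcs E w" "e \<in> arcs E" "head E e = w"
  using assms unfolding graph_gens_def by fastforce

lemma pushforward_pullback_eq:
  assumes "x \<in> graph_gens E"
  shows "F.eq (star_subst contract_gen (pullback_gen H g x)) (\<theta> x)"
  using assms
proof (cases rule: graph_gens_E_cases)
  case (vertex v)
  then show ?thesis by (simp add: pullback_gen_def vfiber_Inl \<theta>_simps F.eq_refl F.V_in_free)
next
  \<comment> \<open>The fiber of \<open>w\<close> contributes the sum of the
    \<open>S_y S_y^*\<close>, which is \<open>S_w\<close> because \<open>w\<close> is regular in the
    reduction too and emits the same edges there.\<close>
  case vertex_w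
  have "star_subst contract_gen (pullback_gen H g x) = (\<Sum>y\<in>out_arcs E w. D (Inl y) * poly_star (D (Inl y)))"
    by (simp add: vertex_w pullback_gen_def vfiber_w star_subst_sum sum.reindex)
  also have "\<dots> = (\<Sum>a\<in>out_arcs F w. D a * poly_star (D a))"
    by (simp add: out_arcs_F_w sum.reindex)
  also have "F.eq \<dots> (V w)"
    by (rule F.eq_sym, rule F.Cuntz_Krieger) (simp only: reg_F w)
  finally show ?thesis by (simp add: vertex_w \<theta>_simps)
next
  case (kept e)
  then have "Inl e \<in> arcs F" by auto
  with kept show ?thesis
    by (simp add: pullback_gen_def efiber_Inl \<theta>_simps F.eq_refl F.D_in_free del: in_in_arcs_conv F_simps)
next
  case (into e)
  have "Inr (e, y) \<in> arcs F" if "y \<in> out_arcs E w" for y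
    using into(2) that by (simp only: in_arcs_F)
  then have "F.eq (\<theta> x) (\<theta> x)"
    unfolding into(1) \<theta>_simps(3)[OF into(2)]
    by (intro F.eq_refl sum_in_free mult_in_free poly_star_in_free F.D_in_free out_w_arcs)
  moreover have "star_subst contract_gen (pullback_gen H g x) = \<theta> x"
    using into by (simp add: pullback_gen_def efiber_in \<theta>_simps star_subst_sum sum.reindex inj_on_def
        del: in_in_arcs_conv)
  ultimately show ?thesis by simp
qed

lemma pullback_gen_in_free: "x \<in> graph_gens E \<Longrightarrow> pullback_gen H g x \<in> H.Fr"
  using presentation_hom.gen_in[OF presentation_hom_pullback[OF H.graph_algebra_axioms E.graph_algebra_axioms admissible_g]]
  by blast

lemma \<theta>_eq:
  assumes "x \<in> graph_gens E"
  shows "F.eq (star_subst (pushforward_gen H \<phi>) (pullback_gen H g x)) (\<theta> x)"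
  by (rule F.eq_trans[OF F.star_subst_cong[OF pullback_gen_in_free[OF assms] pushforward_gen_eq]
        pushforward_pullback_eq[OF assms]])

lemma presentation_hom_comp_gen:
  "presentation_hom (graph_gens E) (graph_rels E) (graph_gens F) (graph_rels F)
    (\<lambda>x. star_subst (pushforward_gen H \<phi>) (pullback_gen H g x))"
  by (rule presentation_hom_comp[OF presentation_hom_pullback[OF H.graph_algebra_axioms E.graph_algebra_axioms admissible_g]
        presentation_hom_pushforward E.graph_rels_in_free])

lemma presentation_hom_\<theta>:
  "presentation_hom (graph_gens E) (graph_rels E) (graph_gens F) (graph_rels F) \<theta>"
  by (rule presentation_hom_cong[OF presentation_hom_comp_gen F.eq_sym[OF \<theta>_eq] E.graph_rels_in_free])

lemma pushforward_comp_pullback: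
  assumes "a \<in> carrier (graph_cstar E)"
  shows "path_hom_pushforward H F \<phi> (graph_hom_pullback H E g a) =
    induced_hom (graph_gens E) (graph_rels E) (graph_gens F) (graph_rels F) \<theta> a"
  using induced_hom_comp[OF presentation_hom_pullback[OF H.graph_algebra_axioms E.graph_algebra_axioms admissible_g]
      presentation_hom_pushforward E.graph_rels_in_free assms[unfolded graph_cstar_def]]
    induced_hom_cong[OF presentation_hom_comp_gen presentation_hom_\<theta> \<theta>_eq]
  by (simp add: path_hom_pushforward_eq
      graph_hom_pullback_eq[OF H.graph_algebra_axioms E.graph_algebra_axioms admissible_g])

lemma reduction_\<theta>:
  assumes "x \<in> graph_gens E"
  shows "E.eq (star_subst reduction_gen (\<theta> x)) (gen x)"
  using assms
proof (cases rule: graph_gens_E_cases)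
  case (into e)
  have "star_subst reduction_gen (\<theta> x) = (\<Sum>y\<in>out_arcs E w. D e * D y * poly_star (D y))"
    using into by (simp add: \<theta>_simps star_subst_sum star_subst_mult star_subst_star del: in_in_arcs_conv)
  then show ?thesis using sum_D_out_w[OF into(2)] into(1) by simp
qed (use w_in_verts in \<open>simp_all add: \<theta>_simps E.eq_refl E.V_in_free E.D_in_free del: in_in_arcs_conv\<close>)

lemma \<theta>_reduction:
  assumes "x \<in> graph_gens F"
  shows "F.eq (star_subst \<theta> (reduction_gen x)) (gen x)"
proof -
  from assms consider v where "x = Inl v" "v \<in> verts F" | a where "x = Inr a" "a \<in> arcs F"
    unfolding graph_gens_def by blast
  then show ?thesis
  proof cases
    case 1
    then show ?thesis using F.V_in_free by (simp add: \<theta>_simps F.eq_refl)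
  next
    case 2
    show ?thesis
      using 2(2)
    proof (cases rule: arcs_F_cases)
      case (kept e)
      then have "e \<notin> in_arcs E w" by simp
      then show ?thesis using F.D_in_free[OF 2(2)] kept(1)
        by (simp add: 2(1) \<theta>_simps F.eq_refl del: in_in_arcs_conv)
    next
      case (pair p y)
      have "y \<notin> in_arcs E w" using pair(5) no_loop by auto
      then have "star_subst \<theta> (reduction_gen x) =
          (\<Sum>y'\<in>out_arcs E w. D (Inr (p, y')) * (poly_star (D (Inl y')) * D (Inl y)))"
        using pair by (simp add: 2(1) \<theta>_simps star_subst_mult sum_distrib_right mult.assoc
            del: in_in_arcs_conv F_simps)
      \<comment> \<open>Distinct \<open>y'\<close> and \<open>y\<close> give
        \<open>S_{y'}^* S_y = 0\<close>, so one term of the sum remains.\<close>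
      also have "F.eq \<dots> (if y \<in> out_arcs E w then D (Inr (p, y)) else 0)"
      proof (rule F.eq_sum_single[OF finite_out_w])
        fix y' assume y': "y' \<in> out_arcs E w"
        have py': "Inr (p, y') \<in> arcs F" using pair(4) y' by (simp only: in_arcs_F)
        have "F.eq (D (Inr (p, y')) * (poly_star (D (Inl y')) * D (Inl y)))
            (D (Inr (p, y')) * (if y' = y then V (head F (Inr (p, y'))) else 0))"
          using F.star_D_mult_D[OF out_w_arcs[OF y'] pair(3)]
          by (intro F.eq_mult_left F.D_in_free py') (cases "y' = y"; simp)
        also have "F.eq \<dots> (if y' = y then D (Inr (p, y)) else 0)"
          using F.D_mult_V_head[OF pair(2)] by (simp add: F.eq_refl)
        finally show "F.eq (D (Inr (p, y')) * (poly_star (D (Inl y')) * D (Inl y)))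
            (if y' = y then D (Inr (p, y)) else 0)" .
      qed (rule F.D_in_free[OF pair(2)])
      finally show ?thesis using pair(1,5) by (simp add: 2(1) del: in_out_arcs_conv)
    qed
  qed
qed

lemma star_iso_unital_reduction_hom:
  "star_iso (graph_cstar F) (graph_cstar E) (unital_reduction_hom E w)"
  and unital_reduction_inv_eq: "a \<in> carrier (graph_cstar E) \<Longrightarrow>
    unital_reduction_inv E w a = induced_hom (graph_gens E) (graph_rels E) (graph_gens F) (graph_rels F) \<theta> a"
proof -
  interpret f: presentation_hom "graph_gens F" "graph_rels F" "graph_gens E" "graph_rels E" reduction_gen
    by (rule presentation_hom_reduction_gen)
  interpret t: presentation_hom "graph_gens E" "graph_rels E" "graph_gens F" "graph_rels F" \<theta>
    by (rule presentation_hom_\<theta>)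
  have tf: "t.ind (f.ind a) = a" if "a \<in> carrier (graph_cstar F)" for a
    by (rule induced_hom_inverse[OF presentation_hom_reduction_gen presentation_hom_\<theta> \<theta>_reduction
          that[unfolded graph_cstar_def]])
  have ft: "f.ind (t.ind a) = a" if "a \<in> carrier (graph_cstar E)" for a
    by (rule induced_hom_inverse[OF presentation_hom_\<theta> presentation_hom_reduction_gen reduction_\<theta>
          that[unfolded graph_cstar_def]])
  have f_in: "f.ind a \<in> carrier (graph_cstar E)" if "a \<in> carrier (graph_cstar F)" for a
    using that f.ind_in_carrier by (simp add: graph_cstar_def)
  have t_in: "t.ind a \<in> carrier (graph_cstar F)" if "a \<in> carrier (graph_cstar E)" for a
    using that t.ind_in_carrier by (simp add: graph_cstar_def)
  have bij: "bij_betw f.ind (carrier (graph_cstar F)) (carrier (graph_cstar E))"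
    by (rule bij_betw_byWitness[where f' = t.ind]) (use tf ft f_in t_in in auto)
  show "star_iso (graph_cstar F) (graph_cstar E) (unital_reduction_hom E w)"
    using f.star_hom_ind bij by (simp add: star_iso_def unital_reduction_hom_eq graph_cstar_def)
  show "unital_reduction_inv E w a = t.ind a" if a: "a \<in> carrier (graph_cstar E)"
    unfolding unital_reduction_inv_def unital_reduction_hom_eq
    using bij ft[OF a] t_in[OF a] by (intro inv_into_f_eq) (auto simp: bij_betw_def)
qed

lemma unital_reduction_inv_poly_class:
  assumes "x \<in> graph_gens E"
  shows "unital_reduction_inv E w (poly_class E (gen x)) = poly_class F (\<theta> x)"
proof -
  interpret t: presentation_hom "graph_gens E" "graph_rels E" "graph_gens F" "graph_rels F" \<theta>
    by (rule presentation_hom_\<theta>)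
  note fr = gen_in_free[OF assms]
  have "poly_class E (gen x) \<in> carrier (graph_cstar E)"
    unfolding poly_class_def graph_cstar_def by (intro E.cls_in_carrier E.const_in_cauchy_seqs fr)
  then show ?thesis
    using t.ind_cls_const[OF fr] by (simp add: unital_reduction_inv_eq poly_class_def)
qed

end

theorem corollary5p25:
  fixes E :: "('v, 'e) pre_digraph" and w :: 'v
  assumes "wf_digraph E"
    and "w \<in> reg E"
    and "\<forall>e\<in>out_arcs E w. head E e \<noteq> w"
  shows
    "star_iso (graph_cstar (unital_reduction E w)) (graph_cstar E) (unital_reduction_hom E w) \<and>
     (\<forall>v\<in>verts E.
        unital_reduction_inv E w (poly_class E (V v)) = poly_class (unital_reduction E w) (V v)) \<and>
     (\<forall>e\<in>arcs E - in_arcs E w.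
        unital_reduction_inv E w (poly_class E (D e)) =
          poly_class (unital_reduction E w) (D (Inl e))) \<and>
     (\<forall>p\<in>in_arcs E w.
        unital_reduction_inv E w (poly_class E (D p)) =
          poly_class (unital_reduction E w)
            (\<Sum>y\<in>out_arcs E w. D (Inr (p, y)) * poly_star (D (Inl y)))) \<and>
     (\<exists>(H :: ('v + 'e, 'e + 'e \<times> 'e) pre_digraph) g \<phi>.
        wf_digraph H \<and>
        admissible H E g \<and>
        extended_path_hom H (unital_reduction E w) \<phi> \<and>
        regular_hom H (unital_reduction E w) \<phi> \<and>
        (\<forall>a\<in>carrier (graph_cstar E).
           unital_reduction_inv E w a =
             path_hom_pushforward H (unital_reduction E w) \<phi> (graph_hom_pullback H E g a)))"
proof -
  interpret regular_loopless_vertex E w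
    by (rule regular_loopless_vertex.intro) (use assms in auto)
  have gens: "v \<in> verts E \<Longrightarrow> Inl v \<in> graph_gens E" "e \<in> arcs E \<Longrightarrow> Inr e \<in> graph_gens E" for v e
    by (auto simp: graph_gens_def)
  show ?thesis
  proof (intro conjI ballI)
    show "star_iso (graph_cstar F) (graph_cstar E) (unital_reduction_hom E w)"
      by (rule star_iso_unital_reduction_hom)
    show "unital_reduction_inv E w (poly_class E (V v)) = poly_class F (V v)" if "v \<in> verts E" for v
      using unital_reduction_inv_poly_class[OF gens(1)[OF that]] by (simp add: \<theta>_simps)
    show "unital_reduction_inv E w (poly_class E (D e)) = poly_class F (D (Inl e))"
      if "e \<in> arcs E - in_arcs E w" for e
      using unital_reduction_inv_poly_class[OF gens(2)] that by (simp add: \<theta>_simps)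
    show "unital_reduction_inv E w (poly_class E (D p)) =
        poly_class F (\<Sum>y\<in>out_arcs E w. D (Inr (p, y)) * poly_star (D (Inl y)))"
      if "p \<in> in_arcs E w" for p
      using unital_reduction_inv_poly_class[OF gens(2)] in_arcs_in_arcs[OF that] \<theta>_simps(3)[OF that] by simp
    show "\<exists>(H :: ('v + 'e, 'e + 'e \<times> 'e) pre_digraph) g \<phi>.
        wf_digraph H \<and> admissible H E g \<and> extended_path_hom H F \<phi> \<and> regular_hom H F \<phi> \<and>
        (\<forall>a\<in>carrier (graph_cstar E).
           unital_reduction_inv E w a = path_hom_pushforward H F \<phi> (graph_hom_pullback H E g a))"
      using wf_H admissible_g extended_path_hom_\<phi> regular_hom_\<phi> unital_reduction_inv_eq
        pushforward_comp_pullback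
      by (intro exI[of _ H] exI[of _ g] exI[of _ \<phi>]) simp
  qed
qed

end
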